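(* Let $q$ be an odd prime power, let $G=\mathrm{PSL}(2,q)$, and let $H$ be a finite $2$-subgroup of $\mathrm{V}(\mathbb{Z}G)$. Then $H$ is either cyclic or a dihedral group.
   Context: For a finite group $G$, $\mathbb{Z}G$ denotes the integral group ring, and $\mathrm{V}(\mathbb{Z}G)$ denotes the group of units $u=\sum_{g\in G}u_g g$ of $\mathbb{Z}G$ of augmentation $1$, i.e. with $\sum_{g\in G}u_g=1$. $\mathrm{PSL}(2,q)$ is the two-dimensional projective special linear group over the field with $q$ elements, i.e. $\mathrm{SL}(2,q)$ modulo its center. A finite $2$-subgroup is a finite subgroup whose order is a power of $2$. The four-group (direct product of two cyclic groups of order $2$) is counted as a dihedral group (of order $4$). *)

theory Defs
  imports
    "HOL-Analysis.Determinants"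
    "HOL-Algebra.Elementary_Groups"
    "HOL-Algebra.Ring"
    "HOL-Number_Theory.Prime_Powers"
begin

definition SL2 :: "('f::field ^ 2 ^ 2) monoid" where
  "SL2 = \<lparr>carrier = {A. det A = 1}, mult = (**), one = mat 1\<rparr>"

definition group_center :: "('a, 'b) monoid_scheme \<Rightarrow> 'a set" where
  "group_center G = {z \<in> carrier G. \<forall>g \<in> carrier G. z \<otimes>\<^bsub>G\<^esub> g = g \<otimes>\<^bsub>G\<^esub> z}"

text \<open>The field is the type argument, so \<open>PSL(2,q)\<close> is this constant at a field type \<open>'f\<close>
  with \<open>CARD('f) = q\<close>.\<close>

definition PSL2 :: "('f::field ^ 2 ^ 2) set monoid" where
  "PSL2 = SL2 Mod (group_center SL2)"

text \<open>An element \<open>\<Sum>g. u g * g\<close> is its coefficient function, which is required to vanish off the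
  carrier so that equality in the ring is equality of functions.  The sum in the product is
  meaningful for finite \<open>G\<close> only.\<close>

definition int_group_ring :: "('a, 'b) monoid_scheme \<Rightarrow> ('a \<Rightarrow> int) ring" where
  "int_group_ring G =
    \<lparr>carrier = {u. \<forall>g. g \<notin> carrier G \<longrightarrow> u g = 0},
     mult = (\<lambda>u v g. \<Sum>(h, k) \<in> {(h, k). h \<in> carrier G \<and> k \<in> carrier G \<and> h \<otimes>\<^bsub>G\<^esub> k = g}. u h * v k),
     one = (\<lambda>g. if g = \<one>\<^bsub>G\<^esub> then 1 else 0),
     zero = (\<lambda>g. 0),
     add = (\<lambda>u v g. u g + v g)\<rparr>"

definition augmentation :: "('a, 'b) monoid_scheme \<Rightarrow> ('a \<Rightarrow> int) \<Rightarrow> int" where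
  "augmentation G u = (\<Sum>g \<in> carrier G. u g)"

definition normalized_units :: "('a, 'b) monoid_scheme \<Rightarrow> ('a \<Rightarrow> int) monoid" where
  "normalized_units G =
    (units_of (int_group_ring G))
      \<lparr>carrier := {u \<in> Units (int_group_ring G). augmentation G u = 1}\<rparr>"

text \<open>The dihedral group of order \<open>2 * n\<close>, with \<open>(i, b)\<close> standing for \<open>r ^ i\<close> if \<open>b\<close> is false and
  for \<open>r ^ i * s\<close> if \<open>b\<close> is true, where \<open>r ^ n = s ^ 2 = 1\<close> and \<open>s * r = r ^ (-1) * s\<close>.\<close>

definition dihedral_group :: "nat \<Rightarrow> (int \<times> bool) monoid" where
  "dihedral_group n =
    \<lparr>carrier = {0..<int n} \<times> UNIV,
     mult = (\<lambda>(i, b) (j, c). ((if b then i - j else i + j) mod int n, b \<noteq> c)),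
     one = (0, False)\<rparr>"

text \<open>The bound \<open>n \<ge> 2\<close> admits the four-group and excludes the cyclic group of order 2.\<close>

definition is_dihedral :: "('a, 'b) monoid_scheme \<Rightarrow> bool" where
  "is_dihedral G \<longleftrightarrow> (\<exists>n \<ge> 2. G \<cong> dihedral_group n)"

lemma group_SL2: "group (SL2 :: ('f::field ^ 2 ^ 2) monoid)"
proof (rule groupI)
  fix A :: "'f ^ 2 ^ 2" assume "A \<in> carrier SL2"
  then have d: "det A = 1" by (simp add: SL2_def)
  then have "invertible A" by (simp add: invertible_det_nz)
  then obtain B where B: "A ** B = mat 1" "B ** A = mat 1" by (auto simp: invertible_def)
  have "det A * det B = 1" using B(1) by (metis det_mul det_I)
  then have "det B = 1" using d by simp
  then show "\<exists>y\<in>carrier SL2. y \<otimes>\<^bsub>SL2\<^esub> A = \<one>\<^bsub>SL2\<^esub>" using B by (auto simp: SL2_def)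
qed (auto simp: SL2_def det_mul matrix_mul_assoc)

lemma (in group) group_center_normal: "group_center G \<lhd> G"
proof -
  have *: "inv x \<otimes> g = g \<otimes> inv x"
    if x: "x \<in> carrier G" "\<forall>g\<in>carrier G. x \<otimes> g = g \<otimes> x" and g: "g \<in> carrier G" for x g
    using x g by (metis inv_closed inv_solve_left' inv_solve_right' m_closed)
  have "subgroup (group_center G) G"
  proof (rule subgroupI)
    fix x y assume "x \<in> group_center G" "y \<in> group_center G"
    then have xy: "x \<in> carrier G" "y \<in> carrier G"
      and c: "\<And>g. g \<in> carrier G \<Longrightarrow> x \<otimes> g = g \<otimes> x" "\<And>g. g \<in> carrier G \<Longrightarrow> y \<otimes> g = g \<otimes> y"
      by (auto simp: group_center_def)
    have "x \<otimes> y \<otimes> g = g \<otimes> (x \<otimes> y)" if g: "g \<in> carrier G" for g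
    proof -
      have "x \<otimes> y \<otimes> g = x \<otimes> (g \<otimes> y)" using xy g c(2)[OF g] by (simp add: m_assoc)
      also have "\<dots> = g \<otimes> x \<otimes> y" using xy g c(1)[OF g] by (simp flip: m_assoc)
      finally show ?thesis using xy g by (simp add: m_assoc)
    qed
    then show "x \<otimes> y \<in> group_center G" using xy by (simp add: group_center_def)
  next
    have "\<one> \<in> group_center G" by (simp add: group_center_def)
    then show "group_center G \<noteq> {}" by blast
  qed (auto simp: group_center_def *)
  moreover have "x \<otimes> h \<otimes> inv x \<in> group_center G"
    if "x \<in> carrier G" "h \<in> group_center G" for x h
  proof -
    have h: "h \<in> carrier G" "h \<otimes> x = x \<otimes> h" using that by (auto simp: group_center_def)
    have "x \<otimes> h \<otimes> inv x = h"
      using that h by (metis inv_closed m_assoc r_inv r_one)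
    then show ?thesis using that by simp
  qed
  ultimately show ?thesis by (simp add: normal_inv_iff)
qed

lemma group_PSL2: "group (PSL2 :: ('f::field ^ 2 ^ 2) set monoid)"
  unfolding PSL2_def by (intro normal.factorgroup_is_group group.group_center_normal group_SL2)

lemma int_group_ring_simps:
  "carrier (int_group_ring G) = {u. \<forall>g. g \<notin> carrier G \<longrightarrow> u g = 0}"
  "u \<otimes>\<^bsub>int_group_ring G\<^esub> v =
     (\<lambda>g. \<Sum>(h, k) \<in> {(h, k). h \<in> carrier G \<and> k \<in> carrier G \<and> h \<otimes>\<^bsub>G\<^esub> k = g}. u h * v k)"
  "\<one>\<^bsub>int_group_ring G\<^esub> = (\<lambda>g. if g = \<one>\<^bsub>G\<^esub> then 1 else 0)"
  "\<zero>\<^bsub>int_group_ring G\<^esub> = (\<lambda>g. 0)"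
  "u \<oplus>\<^bsub>int_group_ring G\<^esub> v = (\<lambda>g. u g + v g)"
  by (simp_all add: int_group_ring_def)

lemma (in group) int_group_ring_mult:
  assumes "finite (carrier G)"
  shows "(u \<otimes>\<^bsub>int_group_ring G\<^esub> v) g =
    (if g \<in> carrier G then \<Sum>h \<in> carrier G. u h * v (inv h \<otimes> g) else 0)"
proof (cases "g \<in> carrier G")
  case True
  have "(\<Sum>(h, k) \<in> {(h, k). h \<in> carrier G \<and> k \<in> carrier G \<and> h \<otimes> k = g}. u h * v k) =
    (\<Sum>h \<in> carrier G. u h * v (inv h \<otimes> g))"
    by (rule sum.reindex_bij_witness[where i = "\<lambda>h. (h, inv h \<otimes> g)" and j = fst])
      (use True in \<open>auto simp: m_assoc[symmetric]\<close>)
  then show ?thesis using True by (simp add: int_group_ring_simps)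
next
  case False
  then have "{(h, k). h \<in> carrier G \<and> k \<in> carrier G \<and> h \<otimes> k = g} = {}" by auto
  then show ?thesis using False by (simp only: int_group_ring_simps sum.empty if_False)
qed

lemma (in group) sum_translate:
  assumes "x \<in> carrier G"
  shows "(\<Sum>h \<in> carrier G. f h) = (\<Sum>h \<in> carrier G. f (x \<otimes> h))"
  by (rule sum.reindex_bij_witness[where i = "\<lambda>h. x \<otimes> h" and j = "\<lambda>h. inv x \<otimes> h"])
    (use assms in \<open>auto simp: m_assoc[symmetric]\<close>)

lemma (in group) ring_int_group_ring:
  assumes fin: "finite (carrier G)"
  shows "ring (int_group_ring G)"
proof (rule ringI)
  note mult = int_group_ring_mult[OF fin]
  show "abelian_group (int_group_ring G)"
  proof (rule abelian_groupI)
    fix u assume "u \<in> carrier (int_group_ring G)"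
    then show "\<exists>y\<in>carrier (int_group_ring G). y \<oplus>\<^bsub>int_group_ring G\<^esub> u = \<zero>\<^bsub>int_group_ring G\<^esub>"
      by (intro bexI[of _ "\<lambda>g. - u g"]) (auto simp: int_group_ring_simps)
  qed (auto simp: int_group_ring_simps algebra_simps)
  show "monoid (int_group_ring G)"
  proof (rule monoidI)
    fix u v w
    assume car: "u \<in> carrier (int_group_ring G)" "v \<in> carrier (int_group_ring G)"
      "w \<in> carrier (int_group_ring G)"
    show "u \<otimes>\<^bsub>int_group_ring G\<^esub> v \<in> carrier (int_group_ring G)"
      unfolding int_group_ring_simps(1) using mult by simp
    show "u \<otimes>\<^bsub>int_group_ring G\<^esub> v \<otimes>\<^bsub>int_group_ring G\<^esub> w =
      u \<otimes>\<^bsub>int_group_ring G\<^esub> (v \<otimes>\<^bsub>int_group_ring G\<^esub> w)"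
    proof
      fix g
      show "(u \<otimes>\<^bsub>int_group_ring G\<^esub> v \<otimes>\<^bsub>int_group_ring G\<^esub> w) g =
        (u \<otimes>\<^bsub>int_group_ring G\<^esub> (v \<otimes>\<^bsub>int_group_ring G\<^esub> w)) g"
      proof (cases "g \<in> carrier G")
        case g: True
        have "(u \<otimes>\<^bsub>int_group_ring G\<^esub> v \<otimes>\<^bsub>int_group_ring G\<^esub> w) g =
          (\<Sum>h\<in>carrier G. \<Sum>a\<in>carrier G. u a * v (inv a \<otimes> h) * w (inv h \<otimes> g))"
          using g by (simp add: mult sum_distrib_right)
        also have "\<dots> = (\<Sum>a\<in>carrier G. \<Sum>h\<in>carrier G. u a * v (inv a \<otimes> h) * w (inv h \<otimes> g))"
          by (rule sum.swap)
        also have "\<dots> = (\<Sum>a\<in>carrier G. \<Sum>h\<in>carrier G. u a * v h * w (inv h \<otimes> (inv a \<otimes> g)))"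
        proof (rule sum.cong[OF refl])
          fix a assume a: "a \<in> carrier G"
          show "(\<Sum>h\<in>carrier G. u a * v (inv a \<otimes> h) * w (inv h \<otimes> g)) =
            (\<Sum>h\<in>carrier G. u a * v h * w (inv h \<otimes> (inv a \<otimes> g)))"
            by (subst sum_translate[OF a], rule sum.cong[OF refl])
              (use a g in \<open>simp add: inv_mult_group m_assoc[symmetric]\<close>)
        qed
        also have "\<dots> = (u \<otimes>\<^bsub>int_group_ring G\<^esub> (v \<otimes>\<^bsub>int_group_ring G\<^esub> w)) g"
          using g by (simp add: mult sum_distrib_left mult.assoc)
        finally show ?thesis .
      qed (simp add: mult)
    qed
  next
    show "\<one>\<^bsub>int_group_ring G\<^esub> \<in> carrier (int_group_ring G)"
      by (auto simp: int_group_ring_simps)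
  next
    fix u assume u: "u \<in> carrier (int_group_ring G)"
    show "\<one>\<^bsub>int_group_ring G\<^esub> \<otimes>\<^bsub>int_group_ring G\<^esub> u = u"
    proof
      fix g
      have "(\<Sum>h\<in>carrier G. (if h = \<one> then 1 else 0) * u (inv h \<otimes> g)) = u g" if "g \<in> carrier G"
        using fin that by (subst sum.remove[of _ "\<one>"]) auto
      then show "(\<one>\<^bsub>int_group_ring G\<^esub> \<otimes>\<^bsub>int_group_ring G\<^esub> u) g = u g"
        using u by (auto simp: mult int_group_ring_simps(1,3))
    qed
    show "u \<otimes>\<^bsub>int_group_ring G\<^esub> \<one>\<^bsub>int_group_ring G\<^esub> = u"
    proof
      fix g
      have "(\<Sum>h\<in>carrier G. u h * (if inv h \<otimes> g = \<one> then 1 else 0)) = u g" if g: "g \<in> carrier G"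
      proof -
        have "(\<Sum>h\<in>carrier G. u h * (if inv h \<otimes> g = \<one> then 1 else 0)) =
          (\<Sum>h\<in>carrier G. if h = g then u h else 0)"
          using g by (intro sum.cong) (auto simp: inv_equality, metis inv_closed inv_equality inv_inv)
        then show ?thesis using fin g by simp
      qed
      then show "(u \<otimes>\<^bsub>int_group_ring G\<^esub> \<one>\<^bsub>int_group_ring G\<^esub>) g = u g"
        using u by (auto simp: mult int_group_ring_simps(1,3))
    qed
  qed
next
  fix u v w
  show "(u \<oplus>\<^bsub>int_group_ring G\<^esub> v) \<otimes>\<^bsub>int_group_ring G\<^esub> w =
    u \<otimes>\<^bsub>int_group_ring G\<^esub> w \<oplus>\<^bsub>int_group_ring G\<^esub> v \<otimes>\<^bsub>int_group_ring G\<^esub> w"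
    by (simp add: int_group_ring_simps(2,5) case_prod_unfold distrib_right sum.distrib)
  show "w \<otimes>\<^bsub>int_group_ring G\<^esub> (u \<oplus>\<^bsub>int_group_ring G\<^esub> v) =
    w \<otimes>\<^bsub>int_group_ring G\<^esub> u \<oplus>\<^bsub>int_group_ring G\<^esub> w \<otimes>\<^bsub>int_group_ring G\<^esub> v"
    by (simp add: int_group_ring_simps(2,5) case_prod_unfold distrib_left sum.distrib)
qed

lemma (in group) augmentation_mult:
  assumes fin: "finite (carrier G)"
  shows "augmentation G (u \<otimes>\<^bsub>int_group_ring G\<^esub> v) = augmentation G u * augmentation G v"
proof -
  have "augmentation G (u \<otimes>\<^bsub>int_group_ring G\<^esub> v) =
    (\<Sum>h\<in>carrier G. \<Sum>g\<in>carrier G. u h * v (inv h \<otimes> g))"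
    unfolding augmentation_def by (simp add: int_group_ring_mult[OF fin]) (rule sum.swap)
  also have "\<dots> = (\<Sum>h\<in>carrier G. \<Sum>g\<in>carrier G. u h * v g)"
  proof (rule sum.cong[OF refl])
    fix h assume "h \<in> carrier G"
    then show "(\<Sum>g\<in>carrier G. u h * v (inv h \<otimes> g)) = (\<Sum>g\<in>carrier G. u h * v g)"
      by (intro sum_translate[symmetric] inv_closed)
  qed
  finally show ?thesis by (simp add: augmentation_def sum_product)
qed

lemma (in group) group_normalized_units:
  assumes fin: "finite (carrier G)"
  shows "group (normalized_units G)"
proof -
  interpret R: ring "int_group_ring G" by (rule ring_int_group_ring[OF fin])
  have aug_one: "augmentation G \<one>\<^bsub>int_group_ring G\<^esub> = 1"
    using fin by (simp add: augmentation_def int_group_ring_simps(3))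
  have "subgroup {u \<in> Units (int_group_ring G). augmentation G u = 1} (units_of (int_group_ring G))"
  proof (rule group.subgroupI[OF R.units_group])
    fix u assume "u \<in> {u \<in> Units (int_group_ring G). augmentation G u = 1}"
    then have u: "u \<in> Units (int_group_ring G)" "augmentation G u = 1" by auto
    have "augmentation G (inv\<^bsub>int_group_ring G\<^esub> u) = 1"
      using augmentation_mult[OF fin, of u "inv\<^bsub>int_group_ring G\<^esub> u"] u aug_one by (simp add: R.Units_r_inv)
    then show "inv\<^bsub>units_of (int_group_ring G)\<^esub> u \<in> {u \<in> Units (int_group_ring G). augmentation G u = 1}"
      using u by (simp add: R.units_of_inv)
  qed (auto simp: units_of_def aug_one augmentation_mult[OF fin])
  then show ?thesis unfolding normalized_units_def
    by (rule subgroup.subgroup_is_group[OF _ R.units_group])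
qed

lemma group_dihedral_group:
  assumes "n > 0"
  shows "group (dihedral_group n)"
proof (rule groupI)
  fix x assume "x \<in> carrier (dihedral_group n)"
  moreover obtain i b where "x = (i, b)" by (cases x)
  ultimately show "\<exists>y\<in>carrier (dihedral_group n). y \<otimes>\<^bsub>dihedral_group n\<^esub> x = \<one>\<^bsub>dihedral_group n\<^esub>"
    using assms
    by (intro bexI[of _ "if b then (i, True) else ((- i) mod int n, False)"])
      (auto simp: dihedral_group_def mod_simps)
qed (use assms in \<open>auto simp: dihedral_group_def mod_simps algebra_simps split: prod.splits\<close>)

lemma order_dihedral_group: "order (dihedral_group n) = 2 * n"
  by (simp add: order_def dihedral_group_def card_cartesian_product)

end

theory Submission
  imports Defs "HOL-Algebra.Group_Action" "HOL-Algebra.Multiplicative_Group"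
    "HOL-Analysis.Analysis" "HOL-Number_Theory.Cong"
begin

text \<open>
  Let \<open>u\<close> be an involution of augmentation 1 in \<open>\<int>G\<close>. Expanding \<open>u = u\<^sup>n\<close>, for \<open>n\<close> a power of an odd
  prime, into words and rotating these shows that the functional \<open>u \<mapsto> \<Sum>g. u g * \<theta> g\<close> of a class
  function \<open>\<theta>\<close> does not change when \<open>\<theta>\<close> is composed with an odd power map.  So elements whose order
  is not a power of 2 contribute nothing to it, and for a 2-element \<open>x\<close> of order at least 4 only the
  sum over all generators of the group of \<open>x\<close> matters, which vanishes because \<open>x\<^sup>2\<close> acts freely on
  \<open>G\<close>.  As \<open>PSL(2,q)\<close> has one class of involutions, \<open>u\<close> has in every representation of it the same
  trace as an involution \<open>z\<close> of the group itself.

  The centralizer of \<open>z\<close> is dihedral, with abelian part \<open>T\<close>.  Inducing a real plane representation of it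
  that restricts to \<open>\<alpha> + \<alpha>\<^sup>-\<^sup>1\<close> on \<open>T\<close> gives a real representation of dimension \<open>2 N\<close>, where \<open>N\<close> is the
  odd number of involutions, with trace \<open>2 \<alpha>(z)\<close> at \<open>z\<close>.  For a suitable sign \<open>\<alpha>(z)\<close> the
  \<open>-1\<close>-eigenspace of \<open>z\<close>, hence of every involution of \<open>H\<close>, has dimension 2 modulo 4.  This excludes
  the subgroups \<open>C2 \<times> C2 \<times> C2\<close>, \<open>C4 \<times> C2\<close> (a complex structure needs even dimension) and \<open>Q8\<close>
  (a quaternionic structure needs dimension divisible by 4), and a 2-group without such subgroups is
  cyclic or dihedral.
\<close>

section \<open>Finite 2-groups\<close>

text \<open>A congruence modulo an odd prime alone would not give the invariance under odd powers.
  The words yield one modulo every power of that prime, and as \<open>u\<close> equals all its odd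
  powers, both sides stay the same while the modulus grows, so they are equal. Freeness enters
  through operators. Left multiplication by \<open>u\<close> combined with right multiplication by
  \<open>x\<close> squares to right multiplication by the square of \<open>x\<close>. On the
  functions where that square acts as 1 or as -1, the operator is an integer matrix with square 1 or
  -1; over one transversal of the cosets the two matrices are congruent modulo 2. This forces trace
  0 for the involution, and its trace is the sum over the generators. The -1 eigenspace of
  \<open>z\<close> has dimension N - 1 or N + 1 according to the sign \<alpha>(z), and for odd N
  exactly one of these is 2 modulo 4. Real scalars are essential: over the complex numbers an
  operator with square -1 puts no condition on the dimension.\<close>

lemma (in group) two_group_fixed_point:
  assumes ord: "Coset.order G = 2 ^ k" and fin: "finite E" and odd: "odd (card E)"
    and closed: "\<And>g x. g \<in> carrier G \<Longrightarrow> x \<in> E \<Longrightarrow> act g x \<in> E"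
    and one: "\<And>x. x \<in> E \<Longrightarrow> act \<one> x = x"
    and mult: "\<And>g h x. g \<in> carrier G \<Longrightarrow> h \<in> carrier G \<Longrightarrow> x \<in> E \<Longrightarrow> act (g \<otimes> h) x = act g (act h x)"
  obtains x where "x \<in> E" "\<And>g. g \<in> carrier G \<Longrightarrow> act g x = x"
proof -
  \<comment> \<open>\<open>group_action\<close> maps into \<open>BijGroup\<close>, whose elements
    are extensional; restricting to \<open>E\<close> lets \<open>act\<close> be arbitrary
    elsewhere.\<close>
  define \<phi> where "\<phi> = (\<lambda>g. \<lambda>x\<in>E. act g x)"
  have inv: "act (inv g) (act g x) = x" "act g (act (inv g) x) = x" if "g \<in> carrier G" "x \<in> E" for g x
    using that by (simp_all flip: mult add: one)
  have "bij_betw (act g) E E" if "g \<in> carrier G" for g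
    by (rule bij_betw_byWitness[where f' = "act (inv g)"]) (use that in \<open>auto simp: inv closed\<close>)
  then have bij: "\<phi> g \<in> Bij E" if "g \<in> carrier G" for g
    using that by (simp add: Bij_def \<phi>_def bij_betw_restrict_eq)
  have "\<phi> \<in> hom G (BijGroup E)"
    by (rule homI) (auto simp: BijGroup_def bij, auto simp: \<phi>_def compose_def closed mult fun_eq_iff)
  then interpret A: group_action G E \<phi>
    by (intro group_action.intro group_hom.intro group_hom_axioms.intro group_axioms group_BijGroup)
  \<comment> \<open>Orbit sizes divide \<open>2 ^ k\<close>, so an orbit of odd size would be a
    single fixed point.\<close>
  have orbit1: "even (card Ob)" if nofix: "\<nexists>x. x \<in> E \<and> (\<forall>g \<in> carrier G. act g x = x)" and Ob: "Ob \<in> orbits G E \<phi>" for Ob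
  proof -
    obtain x where x: "x \<in> E" "Ob = orbit G \<phi> x" using Ob unfolding orbits_def by blast
    have "card Ob dvd 2 ^ k"
      using A.orbit_stabilizer_theorem[OF x(1)] x(2) ord by (metis dvd_triv_left)
    then obtain i where i: "card Ob = 2 ^ i" by (auto simp: divides_primepow_nat[of 2])
    have "i \<noteq> 0"
    proof
      assume "i = 0"
      then have "card Ob = 1" using i by simp
      then obtain y where y: "Ob = {y}" by (auto simp: card_1_singleton_iff)
      have "\<phi> \<one> x \<in> Ob" using x by (auto simp: orbit_def)
      then have "y = x" using y x by (simp add: \<phi>_def one)
      moreover have "\<phi> g x \<in> Ob" if "g \<in> carrier G" for g using x that by (auto simp: orbit_def)
      ultimately have "act g x = x" if "g \<in> carrier G" for g using that y x by (simp add: \<phi>_def)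
      then show False using nofix x by auto
    qed
    then show ?thesis using i by simp
  qed
  have "\<exists>x. x \<in> E \<and> (\<forall>g \<in> carrier G. act g x = x)"
  proof (rule ccontr)
    assume *: "\<nexists>x. x \<in> E \<and> (\<forall>g \<in> carrier G. act g x = x)"
    have "card E = (\<Sum>Ob\<in>orbits G E \<phi>. card Ob)"
      using A.disjoint_sum[OF fin, of "\<lambda>_. 1::nat"] by simp
    then have "even (card E)" using orbit1[OF *] by (simp add: dvd_sum)
    then show False using odd by simp
  qed
  then show thesis using that by blast
qed

text \<open>\<open>K\<close> permutes its right cosets by right multiplication and fixes the coset
  \<open>K\<close>. The index is a nontrivial power of 2, so an odd number of cosets remain and one
  of them is fixed too; that \<open>K #> x\<close> is fixed means that \<open>x\<close> conjugates
  \<open>K\<close> into itself.\<close>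

lemma (in group) two_group_normalizer_growth:
  assumes ord: "Coset.order G = 2 ^ k" and K: "subgroup K G" "K \<noteq> carrier G"
  obtains g where "g \<in> carrier G" "g \<notin> K" "\<And>x. x \<in> K \<Longrightarrow> g \<otimes> x \<otimes> inv g \<in> K"
proof -
  have fin: "finite (carrier G)" using ord by (simp flip: order_gt_0_iff_finite)
  have Kc: "K \<subseteq> carrier G" using K by (simp add: subgroup.subset)
  interpret K: group "G\<lparr>carrier := K\<rparr>" using K by (simp add: subgroup.subgroup_is_group group_axioms)
  have lag: "card (rcosets K) * card K = 2 ^ k" using lagrange[OF K(1)] ord by simp
  have "card K dvd 2 ^ k" "card (rcosets K) dvd 2 ^ k" using lag by (metis dvd_triv_left dvd_triv_right)+
  then obtain a b where a: "card K = 2 ^ a" and b: "card (rcosets K) = 2 ^ b"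
    by (auto simp: divides_primepow_nat[of 2])
  have "b \<noteq> 0"
  proof
    assume "b = 0"
    then have "card K = card (carrier G)" using lag b ord by (simp add: Coset.order_def)
    then show False using K(2) Kc fin card_subset_eq by blast
  qed
  have finr: "finite (rcosets K)" using b by (simp add: card_ge_0_finite)
  have Kr: "K \<in> rcosets K" by (rule subgroup.subgroup_in_rcosets[OF K(1) group_axioms])
  have "odd (card (rcosets K - {K}))" using b \<open>b \<noteq> 0\<close> finr Kr by (simp add: card_Diff_subset)
  have sub: "R \<subseteq> carrier G" if "R \<in> rcosets K" for R
    using that subgroup.rcosets_carrier[OF K(1) group_axioms] by blast
  have act: "R #> g \<in> rcosets K - {K}" if gR: "g \<in> K" "R \<in> rcosets K - {K}" for g R
  proof -
    have g: "g \<in> carrier G" using that Kc by auto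
    obtain x where x: "R = K #> x" "x \<in> carrier G" using gR(2) unfolding RCOSETS_def by blast
    have "R #> g = K #> (x \<otimes> g)" using x g Kc by (simp add: coset_mult_assoc)
    moreover have "R #> g \<noteq> K"
    proof
      assume "R #> g = K"
      then have "R = K #> inv g" using g sub[of R] that coset_mult_assoc[of R g "inv g"]
        by (simp add: coset_mult_one)
      moreover have "K #> inv g = K" using that g K by (simp add: coset_join2 subgroup.m_inv_closed)
      ultimately show False using that by auto
    qed
    ultimately show ?thesis using x g Kc by (auto simp: rcosetsI)
  qed
  have "Coset.order (G\<lparr>carrier := K\<rparr>) = 2 ^ a" using a by (simp add: Coset.order_def)
  then obtain R where R: "R \<in> rcosets K - {K}" and fixR: "\<And>g. g \<in> K \<Longrightarrow> R #> inv g = R"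
  \<comment> \<open>Right multiplication is a right action; the inverse turns it into a left
    action.\<close>
  proof (rule K.two_group_fixed_point[where E = "rcosets K - {K}" and act = "\<lambda>g R. R #> inv g"])
    show "odd (card (rcosets K - {K}))" by fact
    show "finite (rcosets K - {K})" using finr by simp
  next
    fix g R assume "g \<in> carrier (G\<lparr>carrier := K\<rparr>)" "R \<in> rcosets K - {K}"
    then show "R #> inv g \<in> rcosets K - {K}" using act[of "inv g" R] K by (simp add: subgroup.m_inv_closed)
  next
    fix R assume "R \<in> rcosets K - {K}"
    then show "R #> inv \<one>\<^bsub>G\<lparr>carrier := K\<rparr>\<^esub> = R" using sub[of R] by (simp add: coset_mult_one)
  next
    fix g h R assume "g \<in> carrier (G\<lparr>carrier := K\<rparr>)" "h \<in> carrier (G\<lparr>carrier := K\<rparr>)" "R \<in> rcosets K - {K}"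
    then show "R #> inv (g \<otimes>\<^bsub>G\<lparr>carrier := K\<rparr>\<^esub> h) = R #> inv h #> inv g"
      using sub[of R] Kc by (auto simp: inv_mult_group coset_mult_assoc subset_iff)
  qed auto
  then obtain x where x: "R = K #> x" "x \<in> carrier G" unfolding RCOSETS_def by blast
  have "x \<notin> K" using R x K by (auto simp: coset_join2)
  moreover have "x \<otimes> y \<otimes> inv x \<in> K" if y: "y \<in> K" for y
  proof -
    have yc: "y \<in> carrier G" using y Kc by auto
    have "R #> y = R" using fixR[of "inv y"] y yc K by (simp add: subgroup.m_inv_closed)
    then have "K #> (x \<otimes> y) = K #> x" using x yc Kc by (simp add: coset_mult_assoc)
    then have "x \<otimes> y \<in> K #> x" using rcos_self[of "x \<otimes> y" K] x yc K by auto
    then obtain c where c: "c \<in> K" "x \<otimes> y = c \<otimes> x" by (auto simp: r_coset_def)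
    then have "x \<otimes> y \<otimes> inv x = c" using x yc Kc by (metis inv_solve_right subsetD m_closed)
    then show ?thesis using c by simp
  qed
  ultimately show thesis using that x by blast
qed

section \<open>Powers of conjugates, recognition of dihedral groups, and the classification\<close>

lemma (in group) inv_cancel_left:
  assumes "a \<in> carrier G" "b \<in> carrier G"
  shows "inv a \<otimes> (a \<otimes> b) = b" "a \<otimes> (inv a \<otimes> b) = b"
  using assms by (simp_all flip: m_assoc)

lemma (in group) conj_nat_pow:
  fixes n :: nat
  assumes "g \<in> carrier G" "x \<in> carrier G"
  shows "(g \<otimes> x \<otimes> inv g) [^] n = g \<otimes> x [^] n \<otimes> inv g"
  using assms by (induction n) (simp_all add: m_assoc inv_cancel_left)

lemma (in group) conj_int_pow:
  fixes i :: int
  assumes "g \<in> carrier G" "x \<in> carrier G"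
  shows "(g \<otimes> x \<otimes> inv g) [^] i = g \<otimes> x [^] i \<otimes> inv g"
  using assms
  by (cases i rule: int_cases2)
    (simp_all add: int_pow_int int_pow_neg conj_nat_pow, simp add: inv_mult_group m_assoc)

text \<open>\<open>b \<otimes> a\<close> is the conjugate of \<open>a \<otimes> b\<close> by
  \<open>b\<close>. In this form it shows that a class function composed with a power map is again a
  class function.\<close>

lemma (in group) pow_mult_commute:
  fixes n :: nat
  assumes "a \<in> carrier G" "b \<in> carrier G"
  shows "(b \<otimes> a) [^] n = b \<otimes> (a \<otimes> b) [^] n \<otimes> inv b"
proof -
  have "b \<otimes> a = b \<otimes> (a \<otimes> b) \<otimes> inv b" using assms by (simp add: m_assoc)
  then show ?thesis using assms by (simp only: conj_nat_pow m_closed)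
qed

text \<open>The relations make the normal form map a homomorphism, \<open>vn\<close> makes it
  injective and \<open>gen\<close> surjective. The relations do not imply \<open>vn\<close>: for
  \<open>ord x = 2\<close> they also hold with \<open>v = x\<close>. Allowing that order covers the
  four-group.\<close>

lemma (in group) is_dihedralI:
  assumes x: "x \<in> carrier G" and v: "v \<in> carrier G"
    and n: "ord x \<ge> 2" and vv: "v \<otimes> v = \<one>" and vx: "v \<otimes> x = inv x \<otimes> v"
    and vn: "\<And>i::int. v \<noteq> x [^] i"
    and gen: "\<And>g. g \<in> carrier G \<Longrightarrow> \<exists>i::int. g = x [^] i \<or> g = x [^] i \<otimes> v"
  shows "is_dihedral G"
proof -
  define n where "n = ord x"
  define f where "f = (\<lambda>(i::int, b). if b then x [^] i \<otimes> v else x [^] i)"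
  have n0: "n \<ge> 2" using n by (simp add: n_def)
  have modn: "x [^] (i mod int n) = x [^] i" for i :: int
    unfolding int_pow_eq[OF x] n_def by (simp add: mod_eq_dvd_iff[symmetric])
  have vxi: "v \<otimes> x [^] i = x [^] (- i) \<otimes> v" for i :: int
  proof -
    have "v \<otimes> x \<otimes> inv v = inv x" using vx x v by (metis inv_closed inv_solve_right m_closed)
    then have "v \<otimes> x [^] i \<otimes> inv v = x [^] (- i)"
      using conj_int_pow[OF v x, of i] x by (simp add: int_pow_inv int_pow_neg)
    then show ?thesis using x v by (metis int_pow_closed inv_solve_right m_closed)
  qed
  have add: "x [^] i \<otimes> x [^] j = x [^] (i + j)" for i j :: int using x by (simp add: int_pow_mult)
  have add': "x [^] i \<otimes> (x [^] j \<otimes> y) = x [^] (i + j) \<otimes> y" if "y \<in> carrier G" for i j :: int and y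
    using x that by (simp add: int_pow_mult m_assoc[symmetric])
  have vxi': "v \<otimes> (x [^] i \<otimes> y) = x [^] (- i) \<otimes> (v \<otimes> y)" if "y \<in> carrier G" for i :: int and y
    using x v that vxi[of i] by (metis int_pow_closed m_assoc)
  have hom: "f \<in> hom (dihedral_group n) G"
  proof (rule homI)
    fix p assume "p \<in> carrier (dihedral_group n)"
    then show "f p \<in> carrier G" using x v by (auto simp: f_def split: prod.splits)
  next
    fix p r assume "p \<in> carrier (dihedral_group n)" "r \<in> carrier (dihedral_group n)"
    obtain i b j c where pr: "p = (i, b)" "r = (j, c)" by (cases p, cases r)
    show "f (p \<otimes>\<^bsub>dihedral_group n\<^esub> r) = f p \<otimes> f r"
      using x v by (cases b; cases c)
        (simp_all add: pr f_def dihedral_group_def modn add vxi vxi' add' m_assoc vv)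
  qed
  have inj: "inj_on f (carrier (dihedral_group n))"
  proof (rule inj_onI)
    fix p r assume p: "p \<in> carrier (dihedral_group n)" and r: "r \<in> carrier (dihedral_group n)" and e: "f p = f r"
    obtain i b j c where pr: "p = (i, b)" "r = (j, c)" by (cases p, cases r)
    have *: "i = j" if "x [^] i = x [^] j"
    proof -
      have "int n dvd j - i" using that x by (simp add: int_pow_eq n_def)
      then show ?thesis using p r pr by (auto simp: dihedral_group_def mod_eq_dvd_iff[symmetric])
    qed
    have no: "x [^] k \<otimes> v \<noteq> x [^] l" for k l :: int
    proof
      assume "x [^] k \<otimes> v = x [^] l"
      then have "x [^] (- k) \<otimes> (x [^] k \<otimes> v) = x [^] (- k) \<otimes> x [^] l" by simp
      then have "v = x [^] (l - k)" using x v by (simp add: add add')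
      then show False using vn by blast
    qed
    show "p = r"
      using e no[of i j] no[of j i] * x v by (auto simp: pr f_def split: if_splits)
  qed
  have surj: "f ` carrier (dihedral_group n) = carrier G"
  proof
    show "f ` carrier (dihedral_group n) \<subseteq> carrier G" using hom by (auto simp: hom_def)
    show "carrier G \<subseteq> f ` carrier (dihedral_group n)"
    proof
      fix g assume "g \<in> carrier G"
      then obtain i :: int where "g = x [^] i \<or> g = x [^] i \<otimes> v" using gen by blast
      then have "g = f (i, False) \<or> g = f (i, True)" by (simp add: f_def)
      then obtain b where "g = f (i, b)" by blast
      then have "g = f (i mod int n, b)" by (simp add: f_def modn)
      then show "g \<in> f ` carrier (dihedral_group n)" using n0 by (auto simp: dihedral_group_def)
    qed
  qed
  have "f \<in> iso (dihedral_group n) G" using hom inj surj by (simp add: iso_def bij_betw_def)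
  then have "dihedral_group n \<cong> G" by (auto simp: is_iso_def)
  moreover have "group (dihedral_group n)" using n0 by (simp add: group_dihedral_group)
  ultimately have "G \<cong> dihedral_group n" using group.iso_sym by blast
  then show ?thesis using n0 by (auto simp: is_dihedral_def)
qed

lemma (in group) two_power_reaches_order_2:
  assumes ord: "Coset.order G = 2 ^ k" and x: "x \<in> carrier G" "x \<noteq> \<one>"
  obtains i where "x [^] (2 ^ i :: nat) \<noteq> \<one>" "x [^] (2 ^ Suc i :: nat) = \<one>"
proof -
  let ?P = "\<lambda>i. x [^] (2 ^ i :: nat) = \<one>"
  define i where "i = (LEAST i. ?P i)"
  have "?P k" using pow_order_eq_1[OF x(1)] ord by simp
  then have 1: "?P i" unfolding i_def by (rule LeastI)
  then have "i \<noteq> 0" using x by (intro notI) simp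
  then obtain j where j: "i = Suc j" by (cases i) auto
  have "\<not> ?P j" using not_less_Least[of j ?P] j i_def by auto
  then show thesis using 1 j that by blast
qed

text \<open>Given an element \<open>y\<close> of order 4, its centralizer \<open>C\<close> contains
  one involution only and turns out to be cyclic. Elements outside \<open>C\<close> that preserve
  \<open>{y, inv y}\<close> are involutions, and every element preserves that pair. So
  \<open>C\<close> has index at most 2, with nothing but reflections outside.\<close>

theorem (in group) two_group_cyclic_or_dihedral:
  assumes ord: "Coset.order G = 2 ^ k"
    and no_222: "\<And>a b c. \<lbrakk>a \<in> carrier G; b \<in> carrier G; c \<in> carrier G; a \<otimes> a = \<one>; b \<otimes> b = \<one>; c \<otimes> c = \<one>;
      a \<otimes> b = b \<otimes> a; a \<otimes> c = c \<otimes> a; b \<otimes> c = c \<otimes> b; a \<noteq> \<one>; b \<noteq> \<one>; b \<noteq> a\<rbrakk> \<Longrightarrow> c \<in> {\<one>, a, b, a \<otimes> b}"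
    and no_42: "\<And>y t. \<lbrakk>y \<in> carrier G; t \<in> carrier G; y \<otimes> y \<noteq> \<one>; (y \<otimes> y) \<otimes> (y \<otimes> y) = \<one>;
      t \<otimes> y = y \<otimes> t; t \<otimes> t = \<one>; t \<noteq> \<one>\<rbrakk> \<Longrightarrow> t = y \<otimes> y"
    and no_Q8: "\<And>y v. \<lbrakk>y \<in> carrier G; v \<in> carrier G; y \<otimes> y \<noteq> \<one>; (y \<otimes> y) \<otimes> (y \<otimes> y) = \<one>;
      v \<otimes> y = inv y \<otimes> v\<rbrakk> \<Longrightarrow> v \<otimes> v \<noteq> y \<otimes> y"
  shows "cyclic_group G \<or> is_dihedral G"
proof (cases "\<forall>x \<in> carrier G. x \<otimes> x = \<one>")
  case True
  have fin: "finite (carrier G)" using ord by (simp flip: order_gt_0_iff_finite)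
  have inv: "inv x = x" if "x \<in> carrier G" for x using True that by (simp add: inv_equality)
  have comm: "x \<otimes> y = y \<otimes> x" if "x \<in> carrier G" "y \<in> carrier G" for x y
    using that by (metis inv inv_mult_group m_closed)
  show ?thesis
  proof (cases "\<exists>a \<in> carrier G. carrier G = {\<one>, a}")
    case True
    then obtain a where a: "a \<in> carrier G" "carrier G = {\<one>, a}" by blast
    have "range (\<lambda>n::int. a [^] n) = carrier G"
    proof
      show "range (\<lambda>n::int. a [^] n) \<subseteq> carrier G" using a(1) by auto
      have "a [^] (0::int) = \<one>" "a [^] (1::int) = a" using a(1) by (auto simp: int_pow_1)
      then show "carrier G \<subseteq> range (\<lambda>n::int. a [^] n)" unfolding a(2)
        by (metis empty_subsetI insert_subset rangeI)
    qed
    then show ?thesis using a(1) cyclic_group by auto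
  next
    case False
    then obtain a where a: "a \<in> carrier G" "a \<noteq> \<one>" using one_closed by blast
    then obtain b where b: "b \<in> carrier G" "b \<notin> {\<one>, a}" using False by blast
    have ord_a: "ord a = 2"
    proof -
      have "a [^] (2::nat) = \<one>" using a(1) True by (simp add: numeral_2_eq_2)
      then have "ord a dvd 2" using a(1) by (simp add: pow_eq_id)
      moreover have "ord a \<noteq> 1" using a ord_eq_1 by blast
      ultimately show ?thesis using prime_nat_iff two_is_prime_nat by blast
    qed
    have pow: "a [^] i = (if even i then \<one> else a)" for i :: int
    proof -
      have "a [^] i = a [^] (if even i then 0 else 1 :: int)"
        unfolding int_pow_eq[OF a(1)] ord_a by auto
      then show ?thesis using a(1) by (auto simp: int_pow_1)
    qed
    have "is_dihedral G"
    proof (rule is_dihedralI[of a b])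
      fix g assume g: "g \<in> carrier G"
      \<comment> \<open>In exponent 2 everything commutes, so \<open>no_222\<close> bounds the order
        by 4.\<close>
      have "g \<in> {\<one>, a, b, a \<otimes> b}" using a b g True comm by (intro no_222) auto
      then have "g = a [^] (0::int) \<or> g = a [^] (1::int) \<or> g = a [^] (0::int) \<otimes> b \<or> g = a [^] (1::int) \<otimes> b"
        using a b by (auto simp: pow)
      then show "\<exists>i::int. g = a [^] i \<or> g = a [^] i \<otimes> b" by blast
    qed (use a b fin True ord_a comm in \<open>auto simp: pow inv\<close>)
    then show ?thesis ..
  qed
next
  case False
  have fin: "finite (carrier G)" using ord by (simp flip: order_gt_0_iff_finite)
  obtain y where y: "y \<in> carrier G" "y \<otimes> y \<noteq> \<one>" "(y \<otimes> y) \<otimes> (y \<otimes> y) = \<one>"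
  proof -
    obtain x where x: "x \<in> carrier G" "x \<otimes> x \<noteq> \<one>" using False by blast
    then obtain i where i: "(x \<otimes> x) [^] (2 ^ i :: nat) \<noteq> \<one>" "(x \<otimes> x) [^] (2 ^ Suc i :: nat) = \<one>"
      using two_power_reaches_order_2[OF ord, of "x \<otimes> x"] by auto
    have sq: "x [^] (2 ^ i :: nat) \<otimes> x [^] (2 ^ i :: nat) = (x \<otimes> x) [^] (2 ^ i :: nat)"
      using x by (simp add: pow_mult_distrib)
    have "(x \<otimes> x) [^] (2 ^ i :: nat) \<otimes> (x \<otimes> x) [^] (2 ^ i :: nat) = \<one>"
      using i x by (simp add: nat_pow_mult mult_2)
    then show thesis using that[of "x [^] (2 ^ i :: nat)"] x i sq by auto
  qed
  define z where "z = y \<otimes> y"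
  have z: "z \<in> carrier G" "z \<noteq> \<one>" "z \<otimes> z = \<one>" using y by (auto simp: z_def)
  have y_inv: "y \<noteq> inv y" using y by (metis r_inv)
  define C where "C = {g \<in> carrier G. g \<otimes> y = y \<otimes> g}"
  have C_car: "g \<in> carrier G" if "g \<in> C" for g using that by (simp add: C_def)
  have yC: "y \<in> C" and zC: "z \<in> C" and oneC: "\<one> \<in> C" using y z by (auto simp: C_def z_def m_assoc)
  have CI: "g \<in> C" if "g \<in> carrier G" "g \<otimes> y \<otimes> inv g = y" for g
    using that y by (metis (mono_tags, lifting) C_def inv_solve_right m_closed mem_Collect_eq)
  have C_conj: "g \<otimes> y \<otimes> inv g = y" if "g \<in> C" for g
    using that y by (metis (mono_tags, lifting) C_def inv_solve_right' m_closed mem_Collect_eq)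
  have Csub: "subgroup C G"
  proof (rule subgroupI)
    fix a b assume "a \<in> C" "b \<in> C"
    then have ab: "a \<in> carrier G" "b \<in> carrier G" "a \<otimes> y = y \<otimes> a" "b \<otimes> y = y \<otimes> b" by (auto simp: C_def)
    have "a \<otimes> b \<otimes> y = a \<otimes> (y \<otimes> b)" using ab y by (simp add: m_assoc)
    also have "\<dots> = y \<otimes> a \<otimes> b" using ab y by (simp flip: m_assoc)
    finally show "a \<otimes> b \<in> C" using ab y by (simp add: C_def m_assoc)
  next
    fix a assume "a \<in> C"
    then have a: "a \<in> carrier G" "a \<otimes> y = y \<otimes> a" by (auto simp: C_def)
    then have "inv a \<otimes> y = y \<otimes> inv a" using y(1)
      by (metis inv_closed inv_solve_left inv_solve_right m_assoc m_closed)
    then show "inv a \<in> C" using a by (simp add: C_def)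
  qed (use y in \<open>auto simp: C_def\<close>)
  have Cm: "a \<otimes> b \<in> C" if "a \<in> C" "b \<in> C" for a b using that Csub by (simp add: subgroup.m_closed)
  have Cinv: "inv a \<in> C" if "a \<in> C" for a using that Csub by (simp add: subgroup.m_inv_closed)
  have Cpow: "a [^] n \<in> C" if "a \<in> C" for a and n :: nat
    by (induction n) (use that oneC Cm in auto)
  have z_comm: "z \<otimes> g = g \<otimes> z" if "g \<in> C" for g
    using that y(1) by (simp add: C_def z_def) (metis m_assoc)
  \<comment> \<open>Any other involution of \<open>C\<close> would generate a group C4 x C2 together
    with \<open>y\<close>.\<close>
  have C2: "g \<in> {\<one>, z}" if g: "g \<in> C" "g \<otimes> g = \<one>" for g
    using no_42[of y g] g y by (auto simp: C_def z_def)
  \<comment> \<open>If \<open>g\<close> has order 4, then \<open>g \<otimes> g = z\<close> by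
    \<open>C2\<close>, so \<open>g \<otimes> y\<close> has square
    \<open>z \<otimes> z = \<one>\<close> and \<open>C2\<close> applies to it as well.\<close>
  have C4: "g \<in> {\<one>, z, y, inv y}" if g: "g \<in> C" "(g \<otimes> g) \<otimes> (g \<otimes> g) = \<one>" for g
  proof (cases "g \<otimes> g = \<one>")
    case False
    have gy: "g \<in> carrier G" "g \<otimes> y = y \<otimes> g" using g by (auto simp: C_def)
    have "g \<otimes> g = z" using C2[of "g \<otimes> g"] g Cm False by auto
    moreover have "(g \<otimes> y) \<otimes> (g \<otimes> y) = (g \<otimes> g) \<otimes> z"
    proof -
      have "(g \<otimes> y) \<otimes> (g \<otimes> y) = g \<otimes> (y \<otimes> g) \<otimes> y" using gy(1) y by (simp add: m_assoc)
      also have "\<dots> = g \<otimes> (g \<otimes> y) \<otimes> y" by (simp only: gy(2))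
      also have "\<dots> = (g \<otimes> g) \<otimes> z" using gy(1) y by (simp add: z_def m_assoc)
      finally show ?thesis .
    qed
    ultimately have "(g \<otimes> y) \<otimes> (g \<otimes> y) = \<one>" using z by simp
    then have "g \<otimes> y \<in> {\<one>, z}" using C2 Cm g yC by auto
    moreover have "g = inv y" if "g \<otimes> y = \<one>"
      using inv_equality[OF that] gy(1) y(1) by simp
    moreover have "g = y" if "g \<otimes> y = z"
      using that gy(1) y(1) by (simp add: z_def)
    ultimately show ?thesis by blast
  qed (use C2 g in auto)
  obtain x where x: "x \<in> C" and xmax: "\<And>g. g \<in> C \<Longrightarrow> ord g \<le> ord x"
  proof -
    have "finite C" using fin by (simp add: C_def)
    then have fo: "finite (ord ` C)" "ord ` C \<noteq> {}" using oneC by auto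
    from Max_in[OF this] obtain x where "x \<in> C" "Max (ord ` C) = ord x" by auto
    then show thesis using that Max_ge[OF fo(1)] by force
  qed
  have xc: "x \<in> carrier G" using x C_car by blast
  define X where "X = generate G {x}"
  have X_nat: "X = range (\<lambda>n::nat. x [^] n)" unfolding X_def using generate_pow_nat[OF xc] ord_ge_1[OF fin xc] by (auto simp: image_def)
  have X_int: "X = range (\<lambda>n::int. x [^] n)" unfolding X_def using generate_pow[OF xc] by auto
  have Xsub: "subgroup X G" unfolding X_def using xc by (intro generate_is_subgroup) auto
  have XC: "X \<subseteq> C" unfolding X_def using generate_subgroup_incl[OF _ Csub, of "{x}"] x by auto
  have ord2: "\<exists>e. ord g = 2 ^ e" if "g \<in> carrier G" for g
    using ord_dvd_group_order[OF that] ord by (auto simp: divides_primepow_nat[of 2])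
  obtain K where K: "ord x = 2 ^ K" using ord2[OF xc] by blast
  have pow2: "g [^] (2::nat) = g \<otimes> g" if "g \<in> carrier G" for g using that by (simp add: numeral_2_eq_2)
  have pow4: "g [^] (4::nat) = (g \<otimes> g) \<otimes> (g \<otimes> g)" if "g \<in> carrier G" for g
    using nat_pow_pow[of g 2 2] that by (simp add: pow2)
  have "K \<ge> 2"
  proof -
    obtain e where e: "ord y = 2 ^ e" using ord2 y by blast
    have "\<not> ord y dvd 2" using y pow2[of y] by (simp flip: pow_eq_id)
    then have "e \<noteq> 0" "e \<noteq> 1" using e by (auto intro!: notI gr0I)
    then have "e \<ge> 2" by simp
    then have "(2::nat) ^ 2 \<le> 2 ^ e" by (intro power_increasing) auto
    then have "(2::nat) ^ 2 \<le> 2 ^ K" using xmax[OF yC] e K by linarith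
    then show ?thesis using power_le_imp_le_exp one_less_numeral_iff semiring_norm(76) by blast
  qed
  then obtain K0 where K0: "K = Suc (Suc K0)" by (metis add_2_eq_Suc le_Suc_ex)
  \<comment> \<open>The power of \<open>x\<close> that has order 4. By \<open>C4\<close> it is
    \<open>y\<close> or its inverse, which brings \<open>y\<close> into \<open>X\<close>.\<close>
  define w where "w = x [^] (2 ^ (K - 2) :: nat)"
  have w: "w \<in> C" "w \<in> X" using XC X_nat by (auto simp: w_def)
  have "w = y \<or> w = inv y"
  proof -
    have wc: "w \<in> carrier G" using w C_car by blast
    have e4: "(2::nat) ^ (K - 2) * 4 = 2 ^ K"
      by (simp add: K0)
    then have e2: "\<not> 2 ^ K dvd (2::nat) ^ (K - 2) * 2"
      by (intro nat_dvd_not_less) (auto simp flip: e4)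
    have "w [^] (4::nat) = \<one>" "w [^] (2::nat) \<noteq> \<one>"
      using e2 by (simp_all add: w_def xc nat_pow_pow pow_eq_id K e4)
    then show ?thesis using C4[OF w(1)] wc z by (auto simp: pow2 pow4)
  qed
  then have yX: "y \<in> X" using w Xsub y by (metis inv_inv subgroup.m_inv_closed)
  have iyX: "inv y \<in> X" using yX Xsub by (simp add: subgroup.m_inv_closed)
  have oneX: "\<one> \<in> X" using Xsub by (simp add: subgroup.one_closed)
  have zX: "z \<in> X" using yX Xsub by (simp add: z_def subgroup.m_closed)
  have w_comm: "w \<otimes> g = g \<otimes> w" if "g \<in> C" for g
  proof -
    have gy: "g \<in> carrier G" "g \<otimes> y = y \<otimes> g" using that by (auto simp: C_def)
    have "g \<otimes> inv y = inv y \<otimes> (y \<otimes> g) \<otimes> inv y" using gy(1) y(1) by (simp flip: m_assoc)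
    also have "\<dots> = inv y \<otimes> g" unfolding gy(2)[symmetric] using gy(1) y(1) by (simp add: m_assoc)
    finally have "g \<otimes> inv y = inv y \<otimes> g" .
    with gy(2) have "g \<otimes> y = y \<otimes> g" "g \<otimes> inv y = inv y \<otimes> g" by auto
    then show ?thesis using \<open>w = y \<or> w = inv y\<close> by auto
  qed
  \<comment> \<open>Otherwise some \<open>v\<close> in \<open>C\<close> normalizes \<open>X\<close>,
    lies outside it and has its square inside. Correcting \<open>v\<close> by a power of
    \<open>x\<close> produces \<open>u\<close> with trivial fourth power, and \<open>C4\<close> puts
    \<open>u\<close>, hence \<open>v\<close>, into \<open>X\<close>.\<close>
  have CX: "C = X"
  proof (rule ccontr)
    assume "C \<noteq> X"
    interpret C: group "G\<lparr>carrier := C\<rparr>" using Csub by (simp add: subgroup.subgroup_is_group group_axioms)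
    obtain c where c: "Coset.order (G\<lparr>carrier := C\<rparr>) = 2 ^ c"
    proof -
      have "card C dvd 2 ^ k" using lagrange[OF Csub] ord by (metis dvd_triv_right)
      then show thesis using that by (auto simp: Coset.order_def divides_primepow_nat[of 2])
    qed
    have "subgroup X (G\<lparr>carrier := C\<rparr>)" using Xsub XC Csub by (simp add: subgroup_incl)
    then obtain v0 where v0: "v0 \<in> C" "v0 \<notin> X" "\<And>g. g \<in> X \<Longrightarrow> v0 \<otimes> g \<otimes> inv v0 \<in> X"
      using C.two_group_normalizer_growth[OF c, of X] \<open>C \<noteq> X\<close> m_inv_consistent[OF Csub] by auto
    define P where "P = (\<lambda>i. v0 [^] (2 ^ i :: nat) \<in> X)"
    define i where "i = (LEAST i. P i)"
    have v0c: "v0 \<in> carrier G" using v0 C_car by blast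
    have "P k" using pow_order_eq_1[OF v0c] ord oneX by (simp add: P_def)
    then have 1: "P i" unfolding i_def by (rule LeastI)
    then have "i \<noteq> 0" using v0 v0c by (intro notI) (simp add: P_def)
    then obtain j where j: "i = Suc j" by (cases i) auto
    have 2: "\<not> P j" using not_less_Least[of j P] j i_def by auto
    \<comment> \<open>The last of the iterated squares of \<open>v0\<close> that is still outside
      \<open>X\<close>.\<close>
    define v where "v = v0 [^] (2 ^ j :: nat)"
    have vX: "v \<notin> X" and vvX: "v \<otimes> v \<in> X" using 1 2 v0c by (simp_all add: P_def v_def j nat_pow_mult mult_2)
    have vc: "v \<in> carrier G" using v0c by (simp add: v_def)
    have "v0 [^] n \<in> C" for n :: nat by (induction n) (use v0 oneC Cm in auto)
    then have vC: "v \<in> C" by (simp add: v_def)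
    have vnorm: "v \<otimes> x \<otimes> inv v \<in> X"
    proof -
      have "v0 [^] n \<otimes> x \<otimes> inv (v0 [^] n) \<in> X" for n :: nat
      proof (induction n)
        case 0
        then show ?case using xc X_nat by (auto intro: range_eqI[of _ _ "1::nat"])
      next
        case (Suc n)
        have "v0 [^] Suc n = v0 \<otimes> v0 [^] n" using v0c by (metis nat_pow_Suc2)
        then show ?case using v0(3)[OF Suc] v0c xc by (simp add: inv_mult_group m_assoc)
      qed
      then show ?thesis by (simp add: v_def)
    qed
    then obtain m :: nat where m: "v \<otimes> x \<otimes> inv v = x [^] m" using X_nat by auto
    obtain l :: nat where l: "v \<otimes> v = x [^] l" using vvX X_nat by auto
    \<comment> \<open>For odd \<open>l\<close> the square of \<open>v\<close> would generate
      \<open>X\<close>, and \<open>ord v = 2 * ord x\<close> would contradict the choice of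
      \<open>x\<close>.\<close>
    have "even l"
    proof (rule ccontr)
      assume "odd l"
      then have "ord (x [^] l) = ord x" using pow_ord_eq_ord_iff[OF fin xc] K by simp
      moreover obtain e where e: "ord v = 2 ^ e" using ord2 vc by blast
      moreover have "e \<noteq> 0" using e vc vX oneX ord_eq_1[OF vc] by (intro notI) auto
      moreover have "ord (v [^] (2::nat)) = ord v div gcd (ord v) 2" using ord_pow_gen[OF vc, of 2] by simp
      ultimately have "ord v = 2 * ord x" using l pow2[OF vc] by (cases e) auto
      then show False using xmax[OF vC] K by simp
    qed
    then obtain i where i: "l = 2 * i" by blast
    have conj_pow: "v \<otimes> x [^] n \<otimes> inv v = (v \<otimes> x \<otimes> inv v) [^] n" for n :: nat
      by (rule conj_nat_pow[OF vc xc, symmetric])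
    \<comment> \<open>\<open>v\<close> commutes with \<open>w\<close>, which has order 4 in
      \<open>X\<close>; so conjugation by \<open>v\<close> is trivial on exponents modulo 4.\<close>
    have m1: "4 dvd int m - 1"
    proof -
      have "v \<otimes> w \<otimes> inv v = w" using w_comm[OF vC] vc w C_car by (metis inv_solve_right' m_closed)
      then have "x [^] (m * 2 ^ (K - 2)) = x [^] (2 ^ (K - 2) :: nat)"
        using conj_pow[of "2 ^ (K - 2)"] by (simp add: w_def m nat_pow_pow xc)
      then have "x [^] int (m * 2 ^ (K - 2)) = x [^] int (2 ^ (K - 2))" by (simp only: int_pow_int)
      then have "int (2 ^ K) dvd int (2 ^ (K - 2)) - int (m * 2 ^ (K - 2))" using int_pow_eq[OF xc] K by simp
      also have "int (2 ^ (K - 2)) - int (m * 2 ^ (K - 2)) = 2 ^ (K - 2) * (1 - int m)" by (simp add: algebra_simps)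
      also have "int (2 ^ K) = 2 ^ (K - 2) * 4" by (simp add: K0)
      finally have "4 dvd 1 - int m" by simp
      then show ?thesis by (metis dvd_minus_iff minus_diff_eq)
    qed
    \<comment> \<open>\<open>v \<otimes> v\<close> lies in \<open>X\<close> and commutes with
      \<open>x\<close>, so \<open>m * m\<close> is 1 modulo \<open>2 ^ K\<close>. By
      \<open>m1\<close> the factor \<open>m + 1\<close> is twice an odd number, hence
      \<open>m - 1\<close> carries all but at most one of the factors 2.\<close>
    have mm: "2 ^ K dvd 2 * (int m - 1)"
    proof -
      have "(v \<otimes> v) \<otimes> x \<otimes> inv (v \<otimes> v) = v \<otimes> (v \<otimes> x \<otimes> inv v) \<otimes> inv v"
        using vc xc by (simp add: m_assoc inv_mult_group)
      also have "\<dots> = x [^] (m * m)" by (simp add: m conj_pow nat_pow_pow xc)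
      finally have "x [^] (m * m) = (v \<otimes> v) \<otimes> x \<otimes> inv (v \<otimes> v)" ..
      also have "\<dots> = x" unfolding l using xc
        by (metis inv_solve_right' nat_pow_Suc nat_pow_Suc2 nat_pow_closed)
      finally have "x [^] int (m * m) = x [^] int 1" using xc by (simp only: int_pow_int nat_pow_eone)
      then have "2 ^ K dvd 1 - int m * int m" using int_pow_eq[OF xc] K by simp
      then have d: "2 ^ K dvd (int m - 1) * (int m + 1)"
        by (metis (no_types, opaque_lifting) dvd_minus_iff minus_diff_eq mult.commute mult_1 square_diff_one_factored)
      obtain t where t: "int m - 1 = 4 * t" using m1 by blast
      then have "int m + 1 = 2 * (2 * t + 1)" by simp
      with d have "2 ^ K dvd (2 * (int m - 1)) * (2 * t + 1)" by (simp add: mult_ac)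
      moreover have "coprime (2 ^ K) (2 * t + 1 :: int)" by simp
      ultimately show ?thesis using coprime_dvd_mult_left_iff by blast
    qed
    define d where "d = v \<otimes> x \<otimes> inv v \<otimes> inv x"
    have dc: "d \<in> carrier G" using vc xc by (simp add: d_def)
    have d_pow: "d = x [^] (int m - 1)"
      using xc by (simp add: d_def m int_pow_diff int_pow_int int_pow_1)
    then have "d \<otimes> d = x [^] (2 * (int m - 1))" by (simp only: int_pow_mult[OF xc] mult_2)
    then have "d \<otimes> d = \<one>" using mm K xc by (simp add: int_pow_eq_id)
    moreover have dX: "d \<in> X" using d_pow X_int by auto
    ultimately have d: "d = \<one> \<or> d = z" using C2[of d] XC by auto
    have dd: "d \<otimes> d = \<one>" by fact
    have d_comm: "d \<otimes> g = g \<otimes> d" if "g \<in> C" for g using d z_comm[OF that] C_car[OF that] by auto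
    have vx: "v \<otimes> x = d \<otimes> x \<otimes> v" using vc xc by (simp add: d_def m_assoc)
    \<comment> \<open>Since \<open>v \<otimes> v = x [^] (2 * i)\<close>, this would have square
      \<open>\<one>\<close> if \<open>v\<close> and \<open>x\<close> commuted. Their commutator
      \<open>d\<close> is central in \<open>C\<close> and has square \<open>\<one>\<close>, so what
      remains is \<open>u \<otimes> u = d [^] i\<close>.\<close>
    define u where "u = v \<otimes> inv (x [^] i)"
    have xiC: "x [^] i \<in> C" using XC X_nat by auto
    have uC: "u \<in> C" unfolding u_def using vC xiC Cm Cinv by blast
    have "(u \<otimes> u) \<otimes> (u \<otimes> u) = \<one>"
    proof -
      have "v \<otimes> x [^] n \<otimes> inv v = d [^] n \<otimes> x [^] n" for n :: nat
      proof -
        have "v \<otimes> x \<otimes> inv v = d \<otimes> x" using vc xc by (simp add: d_def m_assoc)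
        then show ?thesis using conj_pow[of n] pow_mult_distrib[OF d_comm[OF x] dc xc] by simp
      qed
      then have "v \<otimes> x [^] i = d [^] i \<otimes> x [^] i \<otimes> v" using vc xc dc by (metis inv_solve_right m_closed nat_pow_closed)
      let ?e = "d [^] i"
      have e: "?e \<in> carrier G" "?e \<otimes> ?e = \<one>"
        using dc dd pow_mult_distrib[of d d i] by (simp_all add: nat_pow_one)
      have ev: "?e \<otimes> g = g \<otimes> ?e" if "g \<in> C" for g
      proof (induction i)
        case (Suc n)
        then show ?case using d_comm[OF that] dc C_car[OF that] by (simp add: m_assoc) (simp flip: m_assoc)
      qed (use C_car[OF that] in simp)
      have a: "inv (x [^] i) \<otimes> v = ?e \<otimes> (v \<otimes> inv (x [^] i))"
      proof -
        have "v \<otimes> inv (x [^] i) = inv (x [^] i) \<otimes> (x [^] i \<otimes> v) \<otimes> inv (x [^] i)" using vc xc by (simp add: m_assoc inv_cancel_left)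
        also have "x [^] i \<otimes> v = ?e \<otimes> (v \<otimes> x [^] i)"
          using \<open>v \<otimes> x [^] i = ?e \<otimes> x [^] i \<otimes> v\<close> e vc xc by (simp flip: m_assoc)
        also have "inv (x [^] i) \<otimes> (?e \<otimes> (v \<otimes> x [^] i)) \<otimes> inv (x [^] i) = ?e \<otimes> (inv (x [^] i) \<otimes> v)"
          using e vc xc ev[OF Cinv[OF xiC]] by (simp add: m_assoc) (simp flip: m_assoc)
        finally show ?thesis using e vc xc by (simp flip: m_assoc)
      qed
      have "u \<otimes> u = v \<otimes> (inv (x [^] i) \<otimes> v) \<otimes> inv (x [^] i)" using vc xc by (simp add: u_def m_assoc)
      also have "\<dots> = v \<otimes> (?e \<otimes> (v \<otimes> inv (x [^] i))) \<otimes> inv (x [^] i)" by (simp only: a)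
      also have "\<dots> = ?e \<otimes> ((v \<otimes> v) \<otimes> (inv (x [^] i) \<otimes> inv (x [^] i)))"
      proof -
        have "v \<otimes> (?e \<otimes> (v \<otimes> inv (x [^] i))) \<otimes> inv (x [^] i) = (v \<otimes> ?e) \<otimes> (v \<otimes> (inv (x [^] i) \<otimes> inv (x [^] i)))"
          using e(1) vc xc by (simp add: m_assoc)
        also have "v \<otimes> ?e = ?e \<otimes> v" using ev[OF vC] by simp
        finally show ?thesis using e(1) vc xc by (simp add: m_assoc)
      qed
      also have "inv (x [^] i) \<otimes> inv (x [^] i) = inv (v \<otimes> v)"
        using xc by (simp add: l i mult_2 nat_pow_mult[symmetric] inv_mult_group)
      finally have "u \<otimes> u = ?e" using e vc by simp
      then show ?thesis using e by simp
    qed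
    then have "u \<in> X" using C4[OF uC] yX iyX oneX zX by auto
    moreover have "v = u \<otimes> x [^] i" using vc xc by (simp add: u_def m_assoc)
    moreover have "x [^] i \<in> X" using X_nat by auto
    ultimately have "v \<in> X" using Xsub by (simp add: subgroup.m_closed)
    then show False using vX by simp
  qed
  \<comment> \<open>The normalizer of the cyclic group of \<open>y\<close>.\<close>
  define N where "N = {g \<in> carrier G. g \<otimes> y \<otimes> inv g \<in> {y, inv y}}"
  have Nsub: "subgroup N G"
  proof (rule subgroupI)
    show "N \<noteq> {}" using y by (auto simp: N_def intro!: exI[of _ \<one>])
  next
    fix a assume "a \<in> N"
    then have a: "a \<in> carrier G" "a \<otimes> y \<otimes> inv a = y \<or> a \<otimes> y \<otimes> inv a = inv y" by (auto simp: N_def)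
    have "y = inv a \<otimes> (a \<otimes> y \<otimes> inv a) \<otimes> a" using a(1) y(1) by (simp add: m_assoc inv_cancel_left)
    then have "y = inv a \<otimes> y \<otimes> a \<or> y = inv a \<otimes> inv y \<otimes> a" using a(2) by auto
    moreover have "inv (inv a \<otimes> inv y \<otimes> a) = inv a \<otimes> y \<otimes> a" using a(1) y(1) by (simp add: inv_mult_group m_assoc)
    ultimately have "inv a \<otimes> y \<otimes> a \<in> {y, inv y}" by auto
    then show "inv a \<in> N" using a by (simp add: N_def)
  next
    fix a b assume "a \<in> N" "b \<in> N"
    then have ab: "a \<in> carrier G" "b \<in> carrier G" "a \<otimes> y \<otimes> inv a = y \<or> a \<otimes> y \<otimes> inv a = inv y"
      "b \<otimes> y \<otimes> inv b = y \<or> b \<otimes> y \<otimes> inv b = inv y" by (auto simp: N_def)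
    have "a \<otimes> inv y \<otimes> inv a = inv (a \<otimes> y \<otimes> inv a)" using ab(1) y(1) by (simp add: inv_mult_group m_assoc)
    then have *: "a \<otimes> inv y \<otimes> inv a \<in> {y, inv y}" using ab(3) y(1) by auto
    have "a \<otimes> b \<otimes> y \<otimes> inv (a \<otimes> b) = a \<otimes> (b \<otimes> y \<otimes> inv b) \<otimes> inv a"
      using ab(1,2) y(1) by (simp add: inv_mult_group m_assoc)
    then have "a \<otimes> b \<otimes> y \<otimes> inv (a \<otimes> b) \<in> {y, inv y}" using ab(3,4) * by auto
    then show "a \<otimes> b \<in> N" using ab(1,2) by (simp add: N_def)
  qed (auto simp: N_def)
  have Nc: "g \<in> carrier G" if "g \<in> N" for g using that by (simp add: N_def)
  have CN: "C \<subseteq> N" using C_conj C_car by (auto simp: N_def)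
  have N_inverts: "v \<otimes> y = inv y \<otimes> v" if "v \<in> N" "v \<notin> C" for v
  proof -
    have "v \<in> carrier G" "v \<otimes> y \<otimes> inv v = inv y" using that CI by (auto simp: N_def)
    then show ?thesis using y(1) by (metis inv_solve_right inv_closed m_closed)
  qed
  \<comment> \<open>\<open>v\<close> commutes with the powers of \<open>v \<otimes> v\<close> but
    inverts \<open>y\<close>, so none of these powers is \<open>y\<close> or \<open>inv y\<close>.
    By \<open>C4\<close> the order of \<open>v \<otimes> v\<close> is then at most 2, and the value
    \<open>z\<close> is the case of the quaternion group.\<close>
  have N_invol: "v \<otimes> v = \<one>" if v: "v \<in> N" "v \<notin> C" for v
  proof -
    have vc: "v \<in> carrier G" using v Nc by simp
    have vy: "v \<otimes> y = inv y \<otimes> v" using N_inverts v by blast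
    have vy': "v \<otimes> inv y = y \<otimes> v"
    proof -
      have "y \<otimes> v = y \<otimes> (v \<otimes> y) \<otimes> inv y" using vc y(1) by (simp add: m_assoc)
      also have "\<dots> = v \<otimes> inv y" unfolding vy using vc y(1) by (simp flip: m_assoc)
      finally show ?thesis ..
    qed
    have "v \<otimes> v \<otimes> y = v \<otimes> (inv y \<otimes> v)" using vc y(1) vy by (simp add: m_assoc)
    also have "\<dots> = y \<otimes> v \<otimes> v" using vc y(1) vy' by (simp flip: m_assoc)
    finally have vvC: "v \<otimes> v \<in> C" using vc y(1) by (simp add: C_def m_assoc)
    have v_pow: "v \<otimes> (v \<otimes> v) [^] n = (v \<otimes> v) [^] n \<otimes> v" for n :: nat
      using vc by (metis m_assoc m_closed nat_pow_comm nat_pow_eone group_commutes_pow)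
    have no: "(v \<otimes> v) [^] n \<noteq> y" "(v \<otimes> v) [^] n \<noteq> inv y" for n :: nat
    proof -
      show "(v \<otimes> v) [^] n \<noteq> y"
      proof
        assume "(v \<otimes> v) [^] n = y"
        then have "inv y \<otimes> v = y \<otimes> v" using v_pow[of n] vy by simp
        then show False using vc y(1) y_inv by simp
      qed
      show "(v \<otimes> v) [^] n \<noteq> inv y"
      proof
        assume "(v \<otimes> v) [^] n = inv y"
        then have "inv y \<otimes> v = y \<otimes> v" using v_pow[of n] vy' by simp
        then show False using vc y(1) y_inv by simp
      qed
    qed
    have "(v \<otimes> v) \<otimes> (v \<otimes> v) = \<one>"
    proof (rule ccontr)
      let ?w = "(v \<otimes> v) \<otimes> (v \<otimes> v)"
      assume "?w \<noteq> \<one>"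
      then obtain i where i: "?w [^] (2 ^ i :: nat) \<noteq> \<one>" "?w [^] (2 ^ Suc i :: nat) = \<one>"
        using two_power_reaches_order_2[OF ord, of ?w] vc by auto
      let ?u = "(v \<otimes> v) [^] (2 ^ i :: nat)"
      have uC: "?u \<in> C" using Cpow[OF vvC] by blast
      have u: "?u \<in> carrier G" using vc by simp
      have uu: "?u \<otimes> ?u = ?w [^] (2 ^ i :: nat)" using vc by (simp add: pow_mult_distrib)
      have "(?u \<otimes> ?u) \<otimes> (?u \<otimes> ?u) = \<one>" using i vc unfolding uu by (simp add: nat_pow_mult mult_2)
      then have "?u \<in> {\<one>, z, y, inv y}" using C4[OF uC] by blast
      moreover have "?u \<noteq> \<one>" "?u \<noteq> z" using i uu z by auto
      ultimately show False using no by blast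
    qed
    then have "v \<otimes> v = \<one> \<or> v \<otimes> v = z" using C2[OF vvC] by blast
    then show ?thesis using no_Q8[OF y(1) vc y(2,3) vy] by (auto simp: z_def)
  qed
  \<comment> \<open>If \<open>g\<close> normalizes \<open>N\<close>, it sends \<open>y\<close> to an
    element of order 4 in \<open>N\<close>. Outside \<open>C\<close> there are only involutions, so
    the image is in \<open>C\<close>, and \<open>C4\<close> makes it \<open>y\<close> or
    \<open>inv y\<close>.\<close>
  have NG: "N = carrier G"
  proof (rule ccontr)
    assume "N \<noteq> carrier G"
    then obtain g where g: "g \<in> carrier G" "g \<notin> N" "\<And>a. a \<in> N \<Longrightarrow> g \<otimes> a \<otimes> inv g \<in> N"
      using two_group_normalizer_growth[OF ord Nsub] by blast
    let ?u = "g \<otimes> y \<otimes> inv g"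
    have "?u \<in> N" using g(3) yC CN by blast
    have uc: "?u \<in> carrier G" using g(1) y(1) by simp
    have uu: "?u \<otimes> ?u = g \<otimes> (y \<otimes> y) \<otimes> inv g" using g(1) y(1) by (simp add: m_assoc inv_cancel_left)
    have "?u \<otimes> ?u \<noteq> \<one>"
    proof
      assume "?u \<otimes> ?u = \<one>"
      then have "g \<otimes> (y \<otimes> y) = g" using uu g(1) y(1) by (metis inv_solve_right' l_one m_closed one_closed)
      then show False using g(1) y(1,2) by simp
    qed
    then have uC: "?u \<in> C" using N_invol \<open>?u \<in> N\<close> by blast
    have "(?u \<otimes> ?u) \<otimes> (?u \<otimes> ?u) = g \<otimes> ((y \<otimes> y) \<otimes> (y \<otimes> y)) \<otimes> inv g" unfolding uu using g(1) y(1) by (simp add: m_assoc inv_cancel_left)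
    then have "(?u \<otimes> ?u) \<otimes> (?u \<otimes> ?u) = \<one>" using y(3) g(1) by simp
    then have "?u \<in> {y, inv y}" using C4[OF uC] \<open>?u \<otimes> ?u \<noteq> \<one>\<close> z uc by auto
    then show False using g by (simp add: N_def)
  qed
  show ?thesis
  proof (cases "C = carrier G")
    case True
    then have "carrier G = range (\<lambda>n::int. x [^] n)" using CX X_int by simp
    then show ?thesis using cyclic_group xc by blast
  next
    case False
    then obtain v where v: "v \<in> carrier G" "v \<notin> C" using C_car by blast
    have vv: "v \<otimes> v = \<one>" using N_invol v NG by blast
    have inv_v: "inv v = v" using vv v by (simp add: inv_equality)
    \<comment> \<open>So \<open>v\<close> and \<open>v \<otimes> x\<close> are both involutions,
      which amounts to the dihedral relation.\<close>
    have "v \<otimes> x \<notin> C"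
    proof
      assume "v \<otimes> x \<in> C"
      then have "(v \<otimes> x) \<otimes> inv x \<in> C" using Cm Cinv x by blast
      then show False using v xc by (simp add: m_assoc)
    qed
    then have "(v \<otimes> x) \<otimes> (v \<otimes> x) = \<one>" using N_invol NG v xc by blast
    then have "inv (v \<otimes> x) = v \<otimes> x" using v xc by (simp add: inv_equality)
    then have vx: "v \<otimes> x = inv x \<otimes> v" using v xc inv_v by (simp add: inv_mult_group)
    have "is_dihedral G"
    proof (rule is_dihedralI[OF xc v(1) _ vv vx])
      show "2 \<le> ord x" using K K0 by simp
      show "v \<noteq> x [^] i" for i :: int using v CX X_int by blast
      fix g assume g: "g \<in> carrier G"
      show "\<exists>i::int. g = x [^] i \<or> g = x [^] i \<otimes> v"
      proof (cases "g \<in> C")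
        case True
        then show ?thesis using CX X_int by auto
      next
        case False
        have gv_y: "(g \<otimes> v) \<otimes> y = y \<otimes> (g \<otimes> v)"
        proof -
          have gy: "g \<otimes> y = inv y \<otimes> g" using N_inverts g False NG by blast
          have "(g \<otimes> v) \<otimes> y = g \<otimes> (v \<otimes> y)" using g v y(1) by (simp add: m_assoc)
          also have "\<dots> = g \<otimes> inv y \<otimes> v" using N_inverts v NG g y(1) by (simp add: m_assoc)
          also have "g \<otimes> inv y = y \<otimes> (inv y \<otimes> g) \<otimes> inv y" using g y(1) by (simp flip: m_assoc)
          also have "\<dots> = y \<otimes> g" unfolding gy[symmetric] using g y(1) by (simp add: m_assoc)
          finally show ?thesis using g v y(1) by (simp add: m_assoc)
        qed
        then have "g \<otimes> v \<in> C" using g v by (simp add: C_def)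
        then obtain i :: int where "g \<otimes> v = x [^] i" using CX X_int by auto
        then have "g = x [^] i \<otimes> v" using g v xc vv inv_v by (metis inv_solve_right int_pow_closed)
        then show ?thesis by blast
      qed
    qed
    then show ?thesis ..
  qed
qed

section \<open>Odd powers of involutions in the group ring\<close>

text \<open>Every orbit has exactly \<open>n\<close> elements and \<open>w\<close> is constant on
  it; the induction removes one orbit at a time. Weights are needed for rotations of words; with
  weight 1 and \<open>n = 2\<close> the lemma gives parity counts in a group and in a field.\<close>

lemma free_cyclic_action_dvd_sum:
  fixes w :: "'x \<Rightarrow> int"
  assumes "finite X" and n: "n > 0"
    and closed: "\<And>x. x \<in> X \<Longrightarrow> \<sigma> x \<in> X"
    and period: "\<And>x. x \<in> X \<Longrightarrow> (\<sigma> ^^ n) x = x"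
    and free: "\<And>x i. x \<in> X \<Longrightarrow> 0 < i \<Longrightarrow> i < n \<Longrightarrow> (\<sigma> ^^ i) x \<noteq> x"
    and w: "\<And>x. x \<in> X \<Longrightarrow> w (\<sigma> x) = w x"
  shows "int n dvd (\<Sum>x\<in>X. w x)"
  using assms(1) closed period free w
proof (induction X rule: finite_psubset_induct)
  case (psubset X)
  show ?case
  proof (cases "X = {}")
    case False
    then obtain x where x: "x \<in> X" by blast
    have iter: "(\<sigma> ^^ i) x \<in> X \<and> w ((\<sigma> ^^ i) x) = w x" for i
      by (induction i) (use x psubset.prems in auto)
    have per: "(\<sigma> ^^ (i + n * j)) x = (\<sigma> ^^ i) x" for i j
    proof (induction j)
      case (Suc j)
      have "(\<sigma> ^^ (i + n * Suc j)) x = (\<sigma> ^^ n) ((\<sigma> ^^ (i + n * j)) x)"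
        by (simp add: funpow_add[of n "i + n * j", unfolded comp_def, THEN fun_cong, symmetric] add_ac)
      also have "\<dots> = (\<sigma> ^^ (i + n * j)) x" using psubset.prems(2) iter by blast
      finally show ?case using Suc by simp
    qed simp
    have modn: "(\<sigma> ^^ i) x = (\<sigma> ^^ (i mod n)) x" for i
      using per[of "i mod n" "i div n"] by simp
    define Ob where "Ob = (\<lambda>i. (\<sigma> ^^ i) x) ` {..<n}"
    have in_Ob: "(\<sigma> ^^ i) x \<in> Ob" for i using modn[of i] n by (auto simp: Ob_def)
    have inj: "inj_on (\<lambda>i. (\<sigma> ^^ i) x) {..<n}"
    proof (rule linorder_inj_onI')
      fix i j assume ij: "i \<in> {..<n}" "j \<in> {..<n}" "i < j"
      show "(\<sigma> ^^ i) x \<noteq> (\<sigma> ^^ j) x"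
      proof
        assume "(\<sigma> ^^ i) x = (\<sigma> ^^ j) x"
        then have "(\<sigma> ^^ (n - j + i)) x = (\<sigma> ^^ (n - j + j)) x" unfolding funpow_add comp_def by simp
        also have "\<dots> = x" using ij psubset.prems(2)[OF x] by simp
        finally have "(\<sigma> ^^ (n - j + i)) x = x" .
        moreover have "0 < n - j + i" "n - j + i < n" using ij by auto
        ultimately show False using psubset.prems(3)[OF x, of "n - j + i"] by metis
      qed
    qed
    have sub: "Ob \<subseteq> X" using iter by (auto simp: Ob_def)
    have preim: "y \<in> Ob" if yX: "y \<in> X" "\<sigma> y \<in> Ob" for y
    proof -
      obtain i where i: "\<sigma> y = (\<sigma> ^^ i) x" using yX(2) unfolding Ob_def by blast
      have "y = (\<sigma> ^^ Suc (n - 1)) y" using psubset.prems(2)[OF that(1)] n by simp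
      also have "\<dots> = (\<sigma> ^^ (n - 1)) (\<sigma> y)" by (simp only: funpow_Suc_right comp_def)
      also have "\<dots> = (\<sigma> ^^ (n - 1 + i)) x" by (simp add: i funpow_add)
      finally show ?thesis using in_Ob by metis
    qed
    have "int n dvd (\<Sum>x\<in>X - Ob. w x)"
    proof (rule psubset.IH)
      show "X - Ob \<subset> X" using x in_Ob[of 0] by auto
    qed (use psubset.prems preim in auto)
    moreover have "(\<Sum>y\<in>Ob. w y) = int n * w x"
      unfolding Ob_def by (subst sum.reindex[OF inj]) (simp add: iter)
    ultimately show ?thesis using sum.subset_diff[OF sub psubset.hyps, of w] by simp
  qed simp
qed

section \<open>Words, their rotations and powers of group ring elements\<close>

definition words :: "'i set \<Rightarrow> nat \<Rightarrow> 'i list set" where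
  "words I n = {w. set w \<subseteq> I \<and> length w = n}"

lemma finite_words: "finite I \<Longrightarrow> finite (words I n)"
  unfolding words_def by (rule finite_lists_length_eq)

lemma rotate_multiple: "rotate m w = w \<Longrightarrow> rotate (j * m) w = w"
  by (induction j) (auto simp: rotate_add)

text \<open>By Bezout the rotation by the gcd of \<open>i\<close> and the length also fixes
  \<open>w\<close>, and that gcd is a proper divisor of \<open>r ^ Suc k\<close>, hence a divisor of
  \<open>r ^ k\<close>. So a word either has a full orbit or is fixed by this one rotation.\<close>

lemma rotate_prime_power_period:
  assumes r: "prime (r :: nat)" and len: "length w = r ^ Suc k"
    and i: "0 < i" "i < r ^ Suc k" "rotate i w = w"
  shows "rotate (r ^ k) w = w"
proof -
  let ?n = "r ^ Suc k"
  obtain a b where ab: "i * a = ?n * b + gcd i ?n" using bezout_nat[of i ?n] i by auto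
  have "rotate (i * a) w = w" using rotate_multiple[OF i(3), of a] by (simp add: mult.commute)
  moreover have "rotate (gcd i ?n + b * ?n) w = rotate (gcd i ?n) (rotate (b * ?n) w)"
    by (simp only: rotate_rotate)
  moreover have "rotate (b * ?n) w = w" by (rule rotate_multiple) (simp add: len[symmetric] del: power_Suc)
  ultimately have g: "rotate (gcd i ?n) w = w" using ab by (simp add: mult.commute add.commute)
  have "gcd i ?n dvd ?n" by simp
  then obtain j where j: "j \<le> Suc k" "gcd i ?n = r ^ j" using divides_primepow_nat[OF r] by blast
  have "gcd i ?n \<le> i" using i by (simp add: gcd_le1_nat)
  then have "j \<noteq> Suc k" using i j(2) by (metis linorder_not_less)
  then have "r ^ k = r ^ (k - j) * r ^ j" using j by (simp flip: power_add)
  then show ?thesis using rotate_multiple[of "r ^ j" w "r ^ (k - j)"] g j by simp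
qed

lemma commuting_append_replicate:
  assumes "length q = n * length v" "q @ v = v @ q"
  shows "q = concat (replicate n v)"
  using assms
proof (induction n arbitrary: q)
  case (Suc n)
  have "take (length v) (q @ v) = v" using Suc.prems by simp
  then have "take (length v) q = v" using Suc.prems(1) by simp
  then obtain q' where q: "q = v @ q'" by (metis append_take_drop_id)
  then have "q' = concat (replicate n v)" using Suc.prems by (intro Suc.IH) auto
  then show ?case using q by simp
qed simp

text \<open>Split \<open>w = v @ q\<close> with \<open>v\<close> of length \<open>m\<close>. Being
  fixed means that \<open>v\<close> and \<open>q\<close> commute as words, which makes
  \<open>q\<close> a repetition of \<open>v\<close>.\<close>

lemma rotate_fixed_words:
  assumes "r > 0"
  shows "bij_betw (\<lambda>v. concat (replicate r v)) (words I m) {w \<in> words I (r * m). rotate m w = w}"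
proof (rule bij_betw_byWitness[where f' = "take m"])
  obtain r' where r: "r = Suc r'" using assms by (cases r) auto
  show "\<forall>v\<in>words I m. take m (concat (replicate r v)) = v" by (auto simp: words_def r)
  have len: "length (concat (replicate r v)) = r * length v" for v :: "'a list" and r
    by (induction r) auto
  have comm: "concat (replicate r' v) @ v = v @ concat (replicate r' v)" for v :: "'a list"
    by (induction r') auto
  show "(\<lambda>v. concat (replicate r v)) ` words I m \<subseteq> {w \<in> words I (r * m). rotate m w = w}"
  proof safe
    fix v assume v: "v \<in> words I m"
    have "set (concat (replicate r v)) \<subseteq> set v" by auto
    then show "concat (replicate r v) \<in> words I (r * m)" using v len[of r v] by (auto simp: words_def)
    have "rotate (length v) (v @ concat (replicate r' v)) = concat (replicate r' v) @ v" by (rule rotate_append)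
    then show "rotate m (concat (replicate r v)) = concat (replicate r v)"
      using v comm[of v] by (simp add: r words_def)
  qed
  have preim: "concat (replicate r (take m w)) = w \<and> take m w \<in> words I m"
    if w: "w \<in> words I (r * m)" "rotate m w = w" for w
  proof -
    define v q where "v = take m w" and "q = drop m w"
    have len: "length v = m" "length q = r' * length v" using w by (auto simp: v_def q_def words_def r)
    have wvq: "w = v @ q" by (simp add: v_def q_def)
    have "rotate m w = q @ v" unfolding wvq using len rotate_append[of v q] by simp
    then have "q @ v = v @ q" using w wvq by simp
    then have "q = concat (replicate r' v)" using len(2) by (intro commuting_append_replicate) auto
    moreover have "set v \<subseteq> I" using w set_take_subset[of m w] by (auto simp: words_def v_def)
    ultimately show ?thesis using wvq len by (auto simp: r words_def v_def[symmetric])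
  qed
  then show "\<forall>w\<in>{w \<in> words I (r * m). rotate m w = w}. concat (replicate r (take m w)) = w" by blast
  show "take m ` {w \<in> words I (r * m). rotate m w = w} \<subseteq> words I m" using preim by blast
qed

context group
begin

definition word_prod :: "('i \<Rightarrow> 'a) \<Rightarrow> 'i list \<Rightarrow> 'a" where
  "word_prod \<gamma> w = foldr (\<lambda>i g. \<gamma> i \<otimes> g) w \<one>"

lemma word_prod_simps [simp]:
  "word_prod \<gamma> [] = \<one>" "word_prod \<gamma> (i # w) = \<gamma> i \<otimes> word_prod \<gamma> w"
  by (simp_all add: word_prod_def)

lemma word_prod_closed:
  "\<gamma> ` I \<subseteq> carrier G \<Longrightarrow> set w \<subseteq> I \<Longrightarrow> word_prod \<gamma> w \<in> carrier G"
  by (induction w) auto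

lemma word_prod_append:
  "\<gamma> ` I \<subseteq> carrier G \<Longrightarrow> set v \<subseteq> I \<Longrightarrow> set w \<subseteq> I \<Longrightarrow>
    word_prod \<gamma> (v @ w) = word_prod \<gamma> v \<otimes> word_prod \<gamma> w"
  by (induction v) (auto simp: word_prod_closed m_assoc image_subset_iff subset_iff)

lemma word_prod_replicate:
  assumes "\<gamma> ` I \<subseteq> carrier G" "set v \<subseteq> I"
  shows "word_prod \<gamma> (concat (replicate r v)) = word_prod \<gamma> v [^] r"
proof (induction r)
  case (Suc r)
  have "set (concat (replicate r v)) \<subseteq> I" using assms by auto
  then have "word_prod \<gamma> (concat (replicate (Suc r) v)) = word_prod \<gamma> v \<otimes> word_prod \<gamma> v [^] r"
    using assms word_prod_append[of \<gamma> I v] by (simp add: Suc)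
  then show ?case using word_prod_closed[OF assms] by (metis nat_pow_Suc2)
qed simp

text \<open>A group ring element is presented as a signed sum of group elements indexed by \<open>I\<close>: for odd
  \<open>r\<close> a sign is its own \<open>r\<close>-th power, so repeating a word \<open>r\<close> times does not change its weight.\<close>

lemma power_as_sum_over_words:
  fixes \<theta> :: "'a \<Rightarrow> int"
  assumes fin: "finite (carrier G)" and "finite I" and u: "u \<in> carrier (int_group_ring G)"
    and \<gamma>: "\<gamma> ` I \<subseteq> carrier G"
    and rep: "\<And>F :: 'a \<Rightarrow> int. (\<Sum>g\<in>carrier G. u g * F g) = (\<Sum>i\<in>I. s i * F (\<gamma> i))"
  shows "(\<Sum>g\<in>carrier G. (u [^]\<^bsub>int_group_ring G\<^esub> n) g * \<theta> g) =
    (\<Sum>w\<in>words I n. prod_list (map s w) * \<theta> (word_prod \<gamma> w))"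
proof (induction n arbitrary: \<theta>)
  interpret R: ring "int_group_ring G" by (rule ring_int_group_ring[OF fin])
  {
    case 0
    have "words I 0 = {[]}" by (auto simp: words_def)
    then show ?case using fin by (simp add: int_group_ring_simps sum.remove[of _ \<one>])
  next
    case (Suc n)
    let ?v = "u [^]\<^bsub>int_group_ring G\<^esub> n"
    have "(\<Sum>g\<in>carrier G. (u \<otimes>\<^bsub>int_group_ring G\<^esub> ?v) g * \<theta> g) =
      (\<Sum>g\<in>carrier G. \<Sum>h\<in>carrier G. u h * (?v (inv h \<otimes> g) * \<theta> g))"
      by (intro sum.cong refl) (simp add: int_group_ring_mult[OF fin] sum_distrib_right mult.assoc)
    also have "\<dots> = (\<Sum>h\<in>carrier G. u h * (\<Sum>g\<in>carrier G. ?v (inv h \<otimes> g) * \<theta> g))"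
      by (subst sum.swap) (simp add: sum_distrib_left)
    also have "\<dots> = (\<Sum>h\<in>carrier G. u h * (\<Sum>g\<in>carrier G. ?v g * \<theta> (h \<otimes> g)))"
    proof (rule sum.cong[OF refl])
      fix h assume h: "h \<in> carrier G"
      have "(\<Sum>g\<in>carrier G. ?v (inv h \<otimes> g) * \<theta> g) = (\<Sum>g\<in>carrier G. ?v g * \<theta> (h \<otimes> g))"
        by (subst sum_translate[OF h], rule sum.cong) (use h in \<open>simp_all flip: m_assoc\<close>)
      then show "u h * (\<Sum>g\<in>carrier G. ?v (inv h \<otimes> g) * \<theta> g) = u h * (\<Sum>g\<in>carrier G. ?v g * \<theta> (h \<otimes> g))"
        by simp
    qed
    also have "\<dots> = (\<Sum>h\<in>carrier G. u h * (\<Sum>w\<in>words I n. prod_list (map s w) * \<theta> (h \<otimes> word_prod \<gamma> w)))"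
      by (simp only: Suc.IH)
    also have "\<dots> = (\<Sum>i\<in>I. s i * (\<Sum>w\<in>words I n. prod_list (map s w) * \<theta> (\<gamma> i \<otimes> word_prod \<gamma> w)))"
      by (rule rep)
    also have "\<dots> = (\<Sum>(i, w)\<in>I \<times> words I n. prod_list (map s (i # w)) * \<theta> (word_prod \<gamma> (i # w)))"
      by (simp add: sum.cartesian_product[symmetric] sum_distrib_left mult.assoc)
    also have "\<dots> = (\<Sum>w\<in>words I (Suc n). prod_list (map s w) * \<theta> (word_prod \<gamma> w))"
      by (rule sum.reindex_bij_witness[where i = "\<lambda>w. (hd w, tl w)" and j = "\<lambda>(i, w). i # w"])
        (auto simp: words_def length_Suc_conv)
    also have "u \<otimes>\<^bsub>int_group_ring G\<^esub> ?v = u [^]\<^bsub>int_group_ring G\<^esub> Suc n"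
      using u by (metis R.nat_pow_Suc2)
    finally show ?case .
  }
qed

text \<open>As \<theta> is a class function, rotating a word keeps its weight. Words not fixed by
  rotation by \<open>r ^ k\<close> lie in orbits of size \<open>r ^ Suc k\<close> and cancel modulo
  that number. The others are \<open>r\<close>-fold repetitions of words of length
  \<open>r ^ k\<close>, whose products are \<open>r\<close>-th powers; they make up the second
  sum.\<close>

lemma prime_power_trace_cong:
  fixes \<theta> :: "'a \<Rightarrow> int" and r :: nat
  assumes fin: "finite (carrier G)" and u: "u \<in> carrier (int_group_ring G)"
    and class_fun: "\<And>a b. a \<in> carrier G \<Longrightarrow> b \<in> carrier G \<Longrightarrow> \<theta> (a \<otimes> b) = \<theta> (b \<otimes> a)"
    and r: "prime r" "odd r"
  shows "int (r ^ Suc k) dvd (\<Sum>g\<in>carrier G. (u [^]\<^bsub>int_group_ring G\<^esub> (r ^ Suc k)) g * \<theta> g) -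
    (\<Sum>g\<in>carrier G. (u [^]\<^bsub>int_group_ring G\<^esub> (r ^ k)) g * \<theta> (g [^] r))"
proof -
  \<comment> \<open>\<open>\<bar>u g\<bar>\<close> copies of \<open>g\<close>, each carrying the
    sign of \<open>u g\<close>: letters get signs instead of arbitrary integers as weights.\<close>
  define I where "I = (SIGMA g:carrier G. {..<nat \<bar>u g\<bar>})"
  define s where "s = (\<lambda>(g, j::nat). sgn (u g))"
  define \<gamma> where "\<gamma> = (fst :: 'a \<times> nat \<Rightarrow> 'a)"
  have finI: "finite I" using fin by (simp add: I_def)
  have \<gamma>: "\<gamma> ` I \<subseteq> carrier G" by (auto simp: I_def \<gamma>_def)
  have rep: "(\<Sum>g\<in>carrier G. u g * F g) = (\<Sum>i\<in>I. s i * F (\<gamma> i))" for F :: "'a \<Rightarrow> int"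
  proof -
    have "(\<Sum>i\<in>I. s i * F (\<gamma> i)) = (\<Sum>g\<in>carrier G. \<Sum>j<nat \<bar>u g\<bar>. sgn (u g) * F g)"
      unfolding I_def by (subst sum.Sigma) (use fin in \<open>auto simp: s_def \<gamma>_def case_prod_unfold\<close>)
    also have "\<dots> = (\<Sum>g\<in>carrier G. u g * F g)"
      by (intro sum.cong refl) (simp add: sgn_if)
    finally show ?thesis ..
  qed
  note expand = power_as_sum_over_words[OF fin finI u \<gamma> rep]
  define m n where "m = r ^ k" and "n = r ^ Suc k"
  have n: "n = r * m" "n > 0" using r by (auto simp: m_def n_def prime_gt_0_nat)
  define wt where "wt = (\<lambda>w. prod_list (map s w) * \<theta> (word_prod \<gamma> w))"
  have wt_rot: "wt (rotate1 w) = wt w" if "set w \<subseteq> I" for w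
  proof (cases w)
    case (Cons i v)
    then have iv: "i \<in> I" "set v \<subseteq> I" using that by auto
    have "word_prod \<gamma> (v @ [i]) = word_prod \<gamma> v \<otimes> \<gamma> i"
      using word_prod_append[OF \<gamma>, of v "[i]"] iv \<gamma> by (simp add: image_subset_iff)
    then show ?thesis
      using Cons iv class_fun[of "\<gamma> i" "word_prod \<gamma> v"] \<gamma> word_prod_closed[OF \<gamma>, of v]
      by (simp add: wt_def image_subset_iff mult_ac)
  qed simp
  let ?fix = "{w \<in> words I n. rotate m w = w}"
  have dvd: "int n dvd (\<Sum>w\<in>words I n - ?fix. wt w)"
  proof (rule free_cyclic_action_dvd_sum[where \<sigma> = rotate1])
    show "finite (words I n - ?fix)" using finite_words[OF finI] by auto
    show "n > 0" by fact
  next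
    fix w assume w: "w \<in> words I n - ?fix"
    then show "wt (rotate1 w) = wt w" by (intro wt_rot) (auto simp: words_def)
    have "rotate n w = w" using w by (auto simp: words_def)
    then show "(rotate1 ^^ n) w = w" by (simp add: rotate_def)
    have "rotate m (rotate1 w) = rotate1 w \<Longrightarrow> rotate m w = w"
    proof -
      assume "rotate m (rotate1 w) = rotate1 w"
      then have "rotate (n - 1) (rotate m (rotate1 w)) = rotate (n - 1) (rotate1 w)" by simp
      moreover have "rotate (n - 1) (rotate1 w) = w"
        using \<open>rotate n w = w\<close> n(2) rotate_rotate[of "n - 1" 1 w] by (simp add: rotate_def)
      moreover have "rotate (n - 1) (rotate m (rotate1 w)) = rotate m (rotate (n - 1) (rotate1 w))"
        by (simp add: rotate_rotate add.commute)
      ultimately show "rotate m w = w" by simp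
    qed
    then show "rotate1 w \<in> words I n - ?fix" using w by (auto simp: words_def)
    fix i assume i: "0 < i" "i < n"
    show "(rotate1 ^^ i) w \<noteq> w"
    proof
      assume "(rotate1 ^^ i) w = w"
      then have "rotate m w = w" unfolding m_def
        using i w by (intro rotate_prime_power_period[OF r(1)]) (auto simp: words_def n_def rotate_def)
      then show False using w by auto
    qed
  qed
  have "(\<Sum>w\<in>?fix. wt w) = (\<Sum>v\<in>words I m. wt (concat (replicate r v)))"
    using sum.reindex_bij_betw[OF rotate_fixed_words[of r I m], of wt] r n by (simp add: prime_gt_0_nat)
  also have "\<dots> = (\<Sum>v\<in>words I m. prod_list (map s v) * \<theta> (word_prod \<gamma> v [^] r))"
  proof (rule sum.cong[OF refl])
    fix v assume v: "v \<in> words I m"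
    have "prod_list (map s v) \<in> {-1, 0, 1}"
      by (induction v) (auto simp: s_def sgn_if split: prod.splits)
    then have "prod_list (map s v) ^ r = prod_list (map s v)"
      using r by (auto simp: minus_one_power_iff zero_power odd_pos)
    moreover have "prod_list (map s (concat (replicate r v))) = prod_list (map s v) ^ r" for r
      by (induction r) (auto simp: prod_list.append)
    moreover have "word_prod \<gamma> (concat (replicate r v)) = word_prod \<gamma> v [^] r"
      using v by (intro word_prod_replicate[OF \<gamma>]) (auto simp: words_def)
    ultimately show "wt (concat (replicate r v)) = prod_list (map s v) * \<theta> (word_prod \<gamma> v [^] r)"
      by (simp add: wt_def)
  qed
  also have "\<dots> = (\<Sum>g\<in>carrier G. (u [^]\<^bsub>int_group_ring G\<^esub> m) g * \<theta> (g [^] r))"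
    using expand[of m "\<lambda>g. \<theta> (g [^] r)"] by simp
  finally have fix_sum: "(\<Sum>w\<in>?fix. wt w) = (\<Sum>g\<in>carrier G. (u [^]\<^bsub>int_group_ring G\<^esub> m) g * \<theta> (g [^] r))" .
  have "(\<Sum>g\<in>carrier G. (u [^]\<^bsub>int_group_ring G\<^esub> n) g * \<theta> g) = (\<Sum>w\<in>words I n. wt w)"
    using expand[of n \<theta>] by (simp add: wt_def)
  also have "\<dots> = (\<Sum>w\<in>words I n - ?fix. wt w) + (\<Sum>w\<in>?fix. wt w)"
    by (rule sum.subset_diff) (use finite_words[OF finI] in auto)
  finally show ?thesis using dvd fix_sum by (simp add: n_def m_def)
qed

text \<open>For a prime \<open>r\<close> and integer values the difference of the two sides is
  divisible by all powers of \<open>r\<close>, as \<open>u\<close> is its own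
  \<open>r ^ k\<close>-th power. A real \<theta> is a combination of the indicator functions of its
  level sets, which are integer class functions. Composite exponents follow one prime factor at a
  time.\<close>

theorem involution_unit_odd_power_invariance:
  fixes \<theta> :: "'a \<Rightarrow> real" and N :: nat
  assumes fin: "finite (carrier G)" and u: "u \<in> carrier (int_group_ring G)"
    and uu: "u \<otimes>\<^bsub>int_group_ring G\<^esub> u = \<one>\<^bsub>int_group_ring G\<^esub>"
    and class_fun: "\<And>a b. a \<in> carrier G \<Longrightarrow> b \<in> carrier G \<Longrightarrow> \<theta> (a \<otimes> b) = \<theta> (b \<otimes> a)"
    and N: "odd N"
  shows "(\<Sum>g\<in>carrier G. u g * \<theta> g) = (\<Sum>g\<in>carrier G. u g * \<theta> (g [^] N))"
proof -
  interpret R: ring "int_group_ring G" by (rule ring_int_group_ring[OF fin])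
  have odd_pow: "u [^]\<^bsub>int_group_ring G\<^esub> n = u" if n: "odd n" for n :: nat
  proof -
    obtain j where j: "n = Suc (2 * j)" using oddE[OF n] by auto
    have "u [^]\<^bsub>int_group_ring G\<^esub> (2::nat) = \<one>\<^bsub>int_group_ring G\<^esub>"
      using uu u by (simp add: numeral_2_eq_2)
    then have "u [^]\<^bsub>int_group_ring G\<^esub> (2 * j) = \<one>\<^bsub>int_group_ring G\<^esub>"
      by (metis R.nat_pow_one R.nat_pow_pow u)
    then show ?thesis using u by (simp add: j)
  qed
  have prime_int: "(\<Sum>g\<in>carrier G. u g * \<theta> g) = (\<Sum>g\<in>carrier G. u g * \<theta> (g [^] r))"
    if r: "prime r" "odd r" and class_fun: "\<And>a b. a \<in> carrier G \<Longrightarrow> b \<in> carrier G \<Longrightarrow> \<theta> (a \<otimes> b) = \<theta> (b \<otimes> a)"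
    for r :: nat and \<theta> :: "'a \<Rightarrow> int"
  proof -
    define D where "D = (\<Sum>g\<in>carrier G. u g * \<theta> g) - (\<Sum>g\<in>carrier G. u g * \<theta> (g [^] r))"
    have dvd: "int (r ^ Suc k) dvd D" for k
      using prime_power_trace_cong[where \<theta> = \<theta> and k = k, OF fin u class_fun r] r by (simp add: odd_pow D_def)
    have "D = 0"
    proof (rule ccontr)
      assume "D \<noteq> 0"
      have "int (r ^ Suc (nat \<bar>D\<bar>)) \<le> \<bar>D\<bar>" using dvd_imp_le_int[OF \<open>D \<noteq> 0\<close> dvd] by simp
      moreover have "nat \<bar>D\<bar> < r ^ nat \<bar>D\<bar>" using prime_ge_2_nat[OF r(1)] by (intro power_gt_expt) auto
      moreover have "r ^ nat \<bar>D\<bar> \<le> r ^ Suc (nat \<bar>D\<bar>)" using prime_gt_0_nat[OF r(1)] by simp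
      ultimately show False by linarith
    qed
    then show ?thesis by (simp add: D_def)
  qed
  have prime_real: "(\<Sum>g\<in>carrier G. u g * \<theta> g) = (\<Sum>g\<in>carrier G. u g * \<theta> (g [^] r))"
    if r: "prime r" "odd r" and class_fun: "\<And>a b. a \<in> carrier G \<Longrightarrow> b \<in> carrier G \<Longrightarrow> \<theta> (a \<otimes> b) = \<theta> (b \<otimes> a)"
    for r :: nat and \<theta> :: "'a \<Rightarrow> real"
  proof -
    define V where "V = \<theta> ` carrier G"
    have "finite V" using fin by (simp add: V_def)
    have decomp: "(\<Sum>g\<in>carrier G. u g * \<theta> (f g)) =
      (\<Sum>v\<in>V. v * real_of_int (\<Sum>g\<in>carrier G. u g * of_bool (\<theta> (f g) = v)))"
      if f: "\<And>g. g \<in> carrier G \<Longrightarrow> f g \<in> carrier G" for f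
    proof -
      have "(\<Sum>v\<in>V. v * real_of_int (\<Sum>g\<in>carrier G. u g * of_bool (\<theta> (f g) = v))) =
        (\<Sum>g\<in>carrier G. \<Sum>v\<in>V. if \<theta> (f g) = v then u g * \<theta> (f g) else 0)"
        by (subst sum.swap) (auto simp: sum_distrib_left intro!: sum.cong)
      also have "\<dots> = (\<Sum>g\<in>carrier G. u g * \<theta> (f g))"
        by (intro sum.cong refl) (use f \<open>finite V\<close> in \<open>auto simp: V_def\<close>)
      finally show ?thesis ..
    qed
    have "(\<Sum>g\<in>carrier G. u g * of_bool (\<theta> g = v)) = (\<Sum>g\<in>carrier G. u g * of_bool (\<theta> (g [^] r) = v))" for v
      using prime_int[OF r, of "\<lambda>g. of_bool (\<theta> g = v)"] class_fun by simp
    then show ?thesis using decomp[of "\<lambda>g. g"] decomp[of "\<lambda>g. g [^] r"] by simp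
  qed
  show ?thesis
    using N class_fun
  proof (induction N arbitrary: \<theta> rule: less_induct)
    case (less N)
    show ?case
    proof (cases "N = 1")
      case True
      then show ?thesis by (intro sum.cong) auto
    next
      case False
      then obtain r where r: "prime r" "r dvd N" using prime_factor_nat by blast
      then obtain M where M: "N = r * M" by blast
      have odd: "odd r" "odd M" using less.prems(1) M by auto
      have "M > 0" using odd(2) by (cases M) auto
      then have "M < N" using M prime_gt_1_nat[OF r(1)] by simp
      have pow_class: "\<theta> ((a \<otimes> b) [^] r) = \<theta> ((b \<otimes> a) [^] r)" if ab: "a \<in> carrier G" "b \<in> carrier G" for a b
      proof -
        have "\<theta> ((b \<otimes> a) [^] r) = \<theta> (b \<otimes> (a \<otimes> b) [^] r \<otimes> inv b)" by (simp only: pow_mult_commute[OF ab])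
        also have "\<dots> = \<theta> (inv b \<otimes> (b \<otimes> (a \<otimes> b) [^] r))" using ab by (intro less.prems(2)) auto
        finally show ?thesis using ab by (simp add: inv_cancel_left)
      qed
      have "(\<Sum>g\<in>carrier G. u g * \<theta> g) = (\<Sum>g\<in>carrier G. u g * \<theta> (g [^] r))"
        using prime_real[OF r(1) odd(1)] less.prems(2) by blast
      also have "\<dots> = (\<Sum>g\<in>carrier G. u g * \<theta> ((g [^] M) [^] r))"
        using less.IH[OF \<open>M < N\<close> odd(2), of "\<lambda>g. \<theta> (g [^] r)"] pow_class by blast
      also have "\<dots> = (\<Sum>g\<in>carrier G. u g * \<theta> (g [^] N))"
        by (intro sum.cong refl) (simp add: M nat_pow_pow mult.commute)
      finally show ?thesis .
    qed
  qed
qed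

end

section \<open>Traces and invariant structures on real vector spaces\<close>

definition lin_trace :: "('v::euclidean_space \<Rightarrow> 'v) \<Rightarrow> real" where
  "lin_trace f = (\<Sum>b\<in>Basis. f b \<bullet> b)"

lemma lin_trace_add: "lin_trace (\<lambda>v. f v + g v) = lin_trace f + lin_trace g"
  and lin_trace_diff: "lin_trace (\<lambda>v. f v - g v) = lin_trace f - lin_trace g"
  and lin_trace_scaleR: "lin_trace (\<lambda>v. c *\<^sub>R f v) = c * lin_trace f"
  by (simp_all add: lin_trace_def inner_add_left inner_diff_left sum.distrib sum_subtractf sum_distrib_left)

lemma lin_trace_comp_commute:
  fixes f g :: "'v::euclidean_space \<Rightarrow> 'v"
  assumes f: "linear f" and g: "linear g"
  shows "lin_trace (\<lambda>v. f (g v)) = lin_trace (\<lambda>v. g (f v))"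
proof -
  have expand: "h (k b) \<bullet> b = (\<Sum>c\<in>Basis. (k b \<bullet> c) * (h c \<bullet> b))" if h: "linear h" for h k :: "'v \<Rightarrow> 'v" and b
  proof -
    have "h (k b) = h (\<Sum>c\<in>Basis. (k b \<bullet> c) *\<^sub>R c)" by (simp add: euclidean_representation)
    also have "\<dots> = (\<Sum>c\<in>Basis. (k b \<bullet> c) *\<^sub>R h c)" by (simp add: linear_sum[OF h] linear_scale[OF h])
    finally show ?thesis by (simp add: inner_sum_left)
  qed
  show ?thesis unfolding lin_trace_def expand[OF f, of g] expand[OF g, of f]
    by (subst sum.swap) (simp add: mult.commute)
qed

text \<open>Let \<open>P\<close> be the orthogonal projection onto the range. Both maps fix that
  range, so \<open>P\<close> after \<open>f\<close> is \<open>f\<close> and \<open>f\<close> after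
  \<open>P\<close> is \<open>P\<close>; commuting under the trace gives equal traces, and that of
  \<open>P\<close> counts an orthonormal basis.\<close>

lemma lin_trace_idempotent:
  fixes f :: "'v::euclidean_space \<Rightarrow> 'v"
  assumes f: "linear f" and idem: "\<And>v. f (f v) = f v"
  shows "lin_trace f = real (dim (range f))"
proof -
  have "subspace (range f)" using f by (simp add: linear_subspace_image)
  then obtain B where B: "B \<subseteq> range f" "pairwise orthogonal B" "\<And>x. x \<in> B \<Longrightarrow> norm x = 1"
      "independent B" "card B = dim (range f)" "span B = range f"
    using orthonormal_basis_subspace by blast
  have finB: "finite B" using B(4) by (rule independent_imp_finite)
  define P where "P = (\<lambda>v. \<Sum>c\<in>B. (v \<bullet> c) *\<^sub>R c)"
  have linP: "linear P" unfolding P_def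
    by (intro linear_compose_sum ballI linearI) (auto simp: inner_add_left scaleR_add_left)
  have P_f: "P (f v) = f v" for v
    unfolding P_def using B(6) by (intro orthonormal_basis_expand B finB) auto
  have "P v \<in> range f" for v unfolding P_def B(6)[symmetric]
    by (intro span_sum span_scale span_base)
  then have f_P: "f (P v) = P v" for v by (metis idem rangeE)
  have "lin_trace f = lin_trace (\<lambda>v. P (f v))" by (simp add: P_f)
  also have "\<dots> = lin_trace P" by (subst lin_trace_comp_commute[OF linP f]) (simp add: f_P)
  also have "\<dots> = (\<Sum>b\<in>Basis. \<Sum>c\<in>B. (b \<bullet> c) * (c \<bullet> b))"
    by (simp add: lin_trace_def P_def inner_sum_left)
  also have "\<dots> = (\<Sum>c\<in>B. c \<bullet> c)"
    by (subst sum.swap) (simp add: euclidean_inner[of c c for c] inner_commute)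
  also have "\<dots> = real (dim (range f))" using B(3,5) by (simp add: dot_square_norm)
  finally show ?thesis .
qed

section \<open>Dimensions of spaces with a complex or a quaternionic structure\<close>

lemma span_insert_closed:
  assumes "linear I" "\<And>u. u \<in> X \<Longrightarrow> I u \<in> span Y" "x \<in> span X"
  shows "I x \<in> span Y"
proof -
  have "I ` span X = span (I ` X)" using assms(1) by (simp add: linear_span_image)
  also have "\<dots> \<subseteq> span Y" using assms(2) by (intro span_minimal) auto
  finally show ?thesis using assms(3) by auto
qed

text \<open>A relation \<open>v - k *\<^sub>R I v \<in> U\<close> combined with its image under
  \<open>I\<close> gives \<open>(1 + k * k) *\<^sub>R v \<in> U\<close>, and
  \<open>1 + k * k\<close> is not 0 for real \<open>k\<close>.\<close>

lemma complex_structure_extend: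
  fixes U :: "'v::euclidean_space set"
  assumes I: "linear I" and U: "subspace U" "\<And>u. u \<in> U \<Longrightarrow> I u \<in> U"
    and v: "v \<notin> U" "I (I v) = - v"
  shows "dim (span (insert v (insert (I v) U))) = dim U + 2"
    and "\<And>x. x \<in> span (insert v (insert (I v) U)) \<Longrightarrow> I x \<in> span (insert v (insert (I v) U))"
proof -
  have "v \<notin> span (insert (I v) U)"
  proof
    assume "v \<in> span (insert (I v) U)"
    then obtain k where k: "v - k *\<^sub>R I v \<in> U" using span_breakdown_eq span_eq_iff U(1) by metis
    have "I (v - k *\<^sub>R I v) = I v + k *\<^sub>R v" using v by (simp add: linear_diff[OF I] linear_scale[OF I])
    then have "I v + k *\<^sub>R v \<in> U" using U(2)[OF k] by simp
    then have "(v - k *\<^sub>R I v) + k *\<^sub>R (I v + k *\<^sub>R v) \<in> U"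
      by (rule subspace_add[OF U(1) k subspace_scale[OF U(1)]])
    then have "(1 + k * k) *\<^sub>R v \<in> U" by (simp add: algebra_simps)
    then have "inverse (1 + k * k) *\<^sub>R ((1 + k * k) *\<^sub>R v) \<in> U" by (rule subspace_scale[OF U(1)])
    moreover have "1 + k * k \<noteq> 0" by (smt (verit) zero_le_square)
    ultimately show False using v by simp
  qed
  moreover have "I v \<notin> span U"
  proof
    assume "I v \<in> span U"
    then have "I (I v) \<in> U" using U by (metis span_eq_iff)
    then show False using v U(1) subspace_neg by force
  qed
  ultimately show "dim (span (insert v (insert (I v) U))) = dim U + 2"
    by (simp add: dim_insert)
  fix x assume "x \<in> span (insert v (insert (I v) U))"
  then show "I x \<in> span (insert v (insert (I v) U))"
    by (rule span_insert_closed[OF I, rotated]) (use U(2) v in \<open>auto intro: span_base intro!: span_neg\<close>)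
qed

lemma complex_structure_even_codim:
  fixes S U :: "'v::euclidean_space set"
  assumes I: "linear I" and S: "subspace S" "\<And>v. v \<in> S \<Longrightarrow> I v \<in> S" "\<And>v. v \<in> S \<Longrightarrow> I (I v) = - v"
    and U: "subspace U" "U \<subseteq> S" "\<And>u. u \<in> U \<Longrightarrow> I u \<in> U"
  shows "even (dim S - dim U)"
  using U
proof (induction "dim S - dim U" arbitrary: U rule: less_induct)
  case less
  show ?case
  proof (cases "U = S")
    case False
    then obtain v where v: "v \<in> S" "v \<notin> U" using less.prems by blast
    let ?U' = "span (insert v (insert (I v) U))"
    note ext = complex_structure_extend[OF I less.prems(1,3) v(2) S(3)[OF v(1)]]
    have sub: "?U' \<subseteq> S" using v S less.prems by (intro span_minimal) auto
    then have le: "dim U + 2 \<le> dim S" using ext(1) dim_subset by metis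
    have "even (dim S - dim ?U')"
      by (rule less.hyps) (use ext sub le in auto)
    then show ?thesis using ext(1) le by (simp add: even_diff_nat)
  qed simp
qed

lemma complex_structure_even_dim:
  fixes S :: "'v::euclidean_space set"
  assumes "linear I" "subspace S" "\<And>v. v \<in> S \<Longrightarrow> I v \<in> S" "\<And>v. v \<in> S \<Longrightarrow> I (I v) = - v"
  shows "even (dim S)"
  using complex_structure_even_codim[OF assms, of "{0}"] linear_0[OF assms(1)] subspace_0[OF assms(2)]
  by simp

text \<open>An invariant subspace grows in steps of dimension 4: it is extended by \<open>v\<close>
  and \<open>I v\<close>, then by \<open>J v\<close> and \<open>I (J v)\<close>. The point to prove
  is that \<open>J v\<close> is still outside after the first extension.\<close>

lemma quaternionic_structure_codim:
  fixes S U :: "'v::euclidean_space set"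
  assumes I: "linear I" and J: "linear J" and S: "subspace S"
    "\<And>v. v \<in> S \<Longrightarrow> I v \<in> S" "\<And>v. v \<in> S \<Longrightarrow> I (I v) = - v"
    "\<And>v. v \<in> S \<Longrightarrow> J v \<in> S" "\<And>v. v \<in> S \<Longrightarrow> J (J v) = - v"
    "\<And>v. v \<in> S \<Longrightarrow> J (I v) = - I (J v)"
    and U: "subspace U" "U \<subseteq> S" "\<And>u. u \<in> U \<Longrightarrow> I u \<in> U" "\<And>u. u \<in> U \<Longrightarrow> J u \<in> U"
  shows "4 dvd dim S - dim U"
  using U
proof (induction "dim S - dim U" arbitrary: U rule: less_induct)
  case less
  show ?case
  proof (cases "U = S")
    case False
    then obtain v where v: "v \<in> S" "v \<notin> U" using less.prems by blast
    let ?U2 = "span (insert v (insert (I v) U))"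
    let ?U4 = "span (insert (J v) (insert (I (J v)) ?U2))"
    note ext = complex_structure_extend[OF I less.prems(1,3) v(2) S(3)[OF v(1)]]
    have "J v \<notin> ?U2"
    proof
      assume "J v \<in> ?U2"
      then obtain a b where "J v - a *\<^sub>R v - b *\<^sub>R I v \<in> span U" using span_breakdown_eq by metis
      then have p: "J v - a *\<^sub>R v - b *\<^sub>R I v \<in> U" using less.prems(1) by (metis span_eq_iff)
      let ?p = "J v - a *\<^sub>R v - b *\<^sub>R I v"
      have Jp: "J ?p = - v - a *\<^sub>R J v + b *\<^sub>R I (J v)"
        using S(5)[OF v(1)] S(6)[OF v(1)] by (simp add: linear_diff[OF J] linear_scale[OF J])
      have Ip: "I ?p = I (J v) - a *\<^sub>R I v + b *\<^sub>R v"
        using S(3)[OF v(1)] by (simp add: linear_diff[OF I] linear_scale[OF I])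
      \<comment> \<open>Minus the norm of the quaternion \<open>J - a - b I\<close> that produces
        \<open>?p\<close> from \<open>v\<close>. Applying \<open>J + a - b I\<close>, the negative
        of its conjugate, to \<open>?p\<close> leaves \<open>c\<close> times
        \<open>v\<close>.\<close>
      define c where "c = - (1 + a * a + b * b)"
      have "c \<noteq> 0" unfolding c_def by (smt (verit) zero_le_square)
      have "J ?p + a *\<^sub>R ?p - b *\<^sub>R I ?p \<in> U"
        using less.prems(3,4)[OF p] p less.prems(1) by (metis subspace_add subspace_diff subspace_scale)
      also have "J ?p + a *\<^sub>R ?p - b *\<^sub>R I ?p = c *\<^sub>R v"
        unfolding Jp Ip c_def by (simp add: algebra_simps)
      finally have "inverse c *\<^sub>R (c *\<^sub>R v) \<in> U"
        by (rule subspace_scale[OF less.prems(1)])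
      then show False using v \<open>c \<noteq> 0\<close> by simp
    qed
    note ext' = complex_structure_extend[OF I subspace_span ext(2) this S(3)[OF S(4)[OF v(1)]]]
    have "?U2 \<subseteq> S" using v S less.prems by (intro span_minimal) auto
    then have sub: "?U4 \<subseteq> S" using v S by (intro span_minimal) auto
    have d: "dim ?U4 = dim U + 4" using ext(1) ext'(1) by simp
    then have le: "dim U + 4 \<le> dim S" using sub dim_subset by metis
    have J4: "J x \<in> ?U4" if "x \<in> ?U4" for x
      using that
    proof (rule span_insert_closed[OF J, rotated])
      have in2: "y \<in> ?U4" if "y \<in> ?U2" for y using that by (auto intro: span_base)
      have v2: "v \<in> ?U2" "I v \<in> ?U2" by (auto intro: span_base)
      have J2: "J y \<in> ?U4" if "y \<in> ?U2" for y
        using that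
      proof (rule span_insert_closed[OF J, rotated])
        fix u assume "u \<in> insert v (insert (I v) U)"
        then consider "u = v" | "u = I v" | "u \<in> U" by blast
        then show "J u \<in> ?U4"
        proof cases
          case 2
          then show ?thesis using S(6)[OF v(1)] by (auto intro!: span_neg intro: span_base)
        next
          case 3
          then have "J u \<in> ?U2" using less.prems(4) by (auto intro: span_base)
          then show ?thesis by (rule in2)
        qed (auto intro: span_base)
      qed
      fix u assume "u \<in> insert (J v) (insert (I (J v)) ?U2)"
      then consider "u = J v" | "u = I (J v)" | "u \<in> ?U2" by blast
      then show "J u \<in> ?U4"
      proof cases
        case 1
        then show ?thesis using S(5)[OF v(1)] in2 v2 by (auto intro: span_neg)
      next
        case 2
        have "J (I (J v)) = I v"
          using S(6)[OF S(4)[OF v(1)]] S(5)[OF v(1)] by (simp add: linear_neg[OF I])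
        then show ?thesis using 2 in2 v2 by simp
      qed (rule J2)
    qed
    have "4 dvd dim S - dim ?U4"
      by (rule less.hyps) (use d ext'(2) J4 sub le in auto)
    moreover have "dim S - dim U = (dim S - dim ?U4) + 4" using d le by simp
    ultimately show ?thesis by simp
  qed simp
qed

lemma quaternionic_structure_dim:
  fixes S :: "'v::euclidean_space set"
  assumes "linear I" "linear J" "subspace S"
    "\<And>v. v \<in> S \<Longrightarrow> I v \<in> S" "\<And>v. v \<in> S \<Longrightarrow> I (I v) = - v"
    "\<And>v. v \<in> S \<Longrightarrow> J v \<in> S" "\<And>v. v \<in> S \<Longrightarrow> J (J v) = - v"
    "\<And>v. v \<in> S \<Longrightarrow> J (I v) = - I (J v)"
  shows "4 dvd dim S"
  using quaternionic_structure_codim[OF assms, of "{0}"] linear_0[OF assms(1)] linear_0[OF assms(2)] subspace_0[OF assms(3)]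
  by simp

section \<open>Integer matrices congruent modulo 2\<close>

lemma odd_det_of_cong_identity:
  fixes Z :: "int^'n^'n"
  shows "odd (det (mat 1 + (Z + Z)))"
proof -
  have entry: "[(mat 1 + (Z + Z)) $ i $ j = mat 1 $ i $ j] (mod 2)" for i j
    by (simp add: cong_iff_dvd_diff)
  have "[det (mat 1 + (Z + Z)) = det (mat 1 :: int^'n^'n)] (mod 2)"
    unfolding det_def by (intro cong_sum cong_mult cong_refl cong_prod entry)
  then have "[det (mat 1 + (Z + Z)) = 1] (mod 2)" by simp
  then show ?thesis by (simp add: cong_def odd_iff_mod_2_eq_one)
qed

definition real_matrix :: "int^'n^'n \<Rightarrow> real^'n^'n" where
  "real_matrix A = (\<chi> i j. real_of_int (A $ i $ j))"

lemma real_matrix_simps: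
  "real_matrix (A ** B) = real_matrix A ** real_matrix B"
  "real_matrix (A + B) = real_matrix A + real_matrix B"
  "real_matrix (A - B) = real_matrix A - real_matrix B"
  "real_matrix (- A) = - real_matrix A"
  "real_matrix (mat 1) = mat 1"
  by (simp_all add: real_matrix_def matrix_matrix_mult_def vec_eq_iff mat_def)

lemma det_real_matrix: "det (real_matrix A) = real_of_int (det A)"
  by (simp add: det_def real_matrix_def)

lemma dim_sums_le:
  fixes S T :: "'v::euclidean_space set"
  assumes "subspace S" "subspace T"
  shows "dim {x + y |x y. x \<in> S \<and> y \<in> T} \<le> dim S + dim T"
  using dim_sums_Int[OF assms] by linarith

lemma lin_trace_matrix: "lin_trace (\<lambda>v :: real^'n. A *v v) = trace A"
proof -
  have "Basis = range (\<lambda>i :: 'n. axis i (1 :: real))" by (auto simp: Basis_vec_def)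
  moreover have "inj (\<lambda>i :: 'n. axis i (1 :: real))" by (auto simp: inj_on_def axis_eq_axis)
  ultimately have "lin_trace (\<lambda>v :: real^'n. A *v v) = (\<Sum>i\<in>UNIV. (A *v axis i 1) \<bullet> axis i 1)"
    unfolding lin_trace_def using sum.reindex[of "\<lambda>i :: 'n. axis i (1 :: real)" UNIV "\<lambda>b. (A *v b) \<bullet> b"] by simp
  then show ?thesis by (simp add: inner_axis matrix_vector_mult_basis column_def trace_def)
qed

text \<open>\<open>A\<close> is an involution congruent modulo 2 to a complex structure \<open>B\<close>, both on the coordinate
  subspace \<open>Y\<close>.  The relation \<open>N ** Q + Q ** N = 1\<close> modulo 2 for \<open>N = A - 1\<close> and for \<open>N = A + 1\<close> bounds
  the ranks of both from below by half the dimension.\<close>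

lemma involution_trace_zero:
  fixes A B Q K :: "int^'n^'n" and Y :: "'n set"
  defines "K \<equiv> (\<chi> i j. of_bool (i = j \<and> i \<in> Y))"
  assumes AA: "A ** A = K" and BB: "B ** B = - K" and AB: "A = B + (Q + Q)"
    and KA: "K ** A = A" "A ** K = A" and KQ: "K ** Q = Q" "Q ** K = Q"
  shows "trace A = 0"
proof -
  define a b q k where "a = (\<lambda>v :: real^'n. real_matrix A *v v)" and "b = (\<lambda>v :: real^'n. real_matrix B *v v)"
    and "q = (\<lambda>v :: real^'n. real_matrix Q *v v)" and "k = (\<lambda>v :: real^'n. real_matrix K *v v)"
  have lin: "linear a" "linear q" "linear k" "linear b" by (simp_all add: a_def b_def q_def k_def)
  note defs = a_def b_def q_def k_def matrix_vector_mul_assoc real_matrix_simps[symmetric]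
  have aa: "a (a v) = k v" and bb: "b (b v) = - k v" and ka: "k (a v) = a v" and ak: "a (k v) = a v"
    and kq: "k (q v) = q v" and qk: "q (k v) = q v" for v
    by (simp_all add: defs AA BB KA KQ)
      (simp add: real_matrix_simps matrix_vector_mult_def vec_eq_iff sum_negf)
  have ab: "a v = b v + 2 *\<^sub>R q v" for v
    by (simp only: a_def b_def q_def AB real_matrix_simps scaleR_2 matrix_vector_mult_add_rdistrib)
  have kk: "k (k v) = k v" for v by (metis aa ak ka)
  \<comment> \<open>Squaring \<open>B = A - 2 Q\<close> gives
    \<open>- K = K - 2 (A Q + Q A) + 4 Q Q\<close>, and the relation is this divided by 2.\<close>
  have aq: "a (q v) + q (a v) = k v + 2 *\<^sub>R q (q v)" for v
  proof -
    have b: "b w = a w - 2 *\<^sub>R q w" for w using ab[of w] by simp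
    have "- k v = b (b v)" using bb by simp
    also have "\<dots> = k v - 2 *\<^sub>R (a (q v) + q (a v)) + 4 *\<^sub>R q (q v)"
      by (simp add: b linear_diff[OF lin(1)] linear_diff[OF lin(2)] linear_scale[OF lin(1)]
          linear_scale[OF lin(2)] aa algebra_simps)
    finally have "- (k v $ i) = k v $ i - 2 * (a (q v) $ i + q (a v) $ i) + 4 * (q (q v) $ i)" for i
      by (simp add: vec_eq_iff)
    then show ?thesis by (simp add: vec_eq_iff) (smt (verit))
  qed
  have tr_k: "lin_trace k = real (card Y)"
  proof -
    have "lin_trace k = trace (real_matrix K)" by (simp add: k_def lin_trace_matrix)
    also have "\<dots> = (\<Sum>i\<in>UNIV. of_bool (i \<in> Y))" by (simp add: trace_def real_matrix_def K_def)
    also have "\<dots> = real (card Y)" by (simp add: sum_of_bool_eq)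
    finally show ?thesis .
  qed
  \<comment> \<open>The projection onto the coordinates outside \<open>Y\<close>. Adding it turns
    the relation on \<open>Y\<close> into one for an operator that is invertible on the whole
    space.\<close>
  define c where "c = (\<lambda>v. v - k v)"
  have lin_c: "linear c" unfolding c_def by (intro linear_compose_sub linear_id[unfolded id_def] lin)
  have dim_c: "real (dim (range c)) = real CARD('n) - real (card Y)"
  proof -
    have "real (dim (range c)) = lin_trace c"
      by (rule lin_trace_idempotent[symmetric, OF lin_c]) (simp add: c_def linear_diff[OF lin(3)] kk)
    also have "\<dots> = lin_trace (\<lambda>v :: real^'n. mat 1 *v v) - lin_trace k"
      by (simp add: c_def lin_trace_diff)
    finally show ?thesis by (simp only: lin_trace_matrix tr_k) (simp add: trace_I)
  qed
  have half: "real (card Y) \<le> 2 * lin_trace (\<lambda>v. (1/2) *\<^sub>R (k v - s *\<^sub>R a v))" if s: "s = 1 \<or> s = -1" for s :: real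
  proof -
    define n where "n = (\<lambda>v. a v - s *\<^sub>R k v)"
    \<comment> \<open>The projection onto the eigenspace of \<open>a\<close> for \<open>- s\<close>
      inside the coordinates of \<open>Y\<close>. It is a nonzero multiple of \<open>n\<close>, so
      its trace is the rank of \<open>n\<close>.\<close>
    define e where "e = (\<lambda>v. (1/2) *\<^sub>R (k v - s *\<^sub>R a v))"
    have n: "linear n" unfolding n_def by (intro linear_compose_sub linear_compose_scale_right lin)
    have e: "linear e" unfolding e_def by (intro linear_compose_sub linear_compose_scale_right lin)
    have ke: "k (e v) = e v" for v
      by (simp only: e_def linear_scale[OF lin(3)] linear_diff[OF lin(3)] kk ka)
    have ae: "a (e v) = (1/2) *\<^sub>R (a v - s *\<^sub>R k v)" for v
      by (simp only: e_def linear_scale[OF lin(1)] linear_diff[OF lin(1)] ak aa)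
    have idem: "e (e v) = e v" for v
    proof -
      have "e (e v) = (1/2) *\<^sub>R (e v - s *\<^sub>R (1/2) *\<^sub>R (a v - s *\<^sub>R k v))"
        using e_def[THEN fun_cong, of "e v"] by (simp only: ke ae)
      also have "\<dots> = e v" using s by (auto simp: e_def vec_eq_iff field_simps)
      finally show ?thesis .
    qed
    have ne: "n v = (-2 * s) *\<^sub>R e v" "e v = (-s/2) *\<^sub>R n v" for v
      using s by (auto simp: e_def n_def vec_eq_iff)
    have "range n = range e"
    proof
      show "range n \<subseteq> range e" using ne(1) linear_scale[OF e] by (metis image_subsetI rangeI)
      show "range e \<subseteq> range n" using ne(2) linear_scale[OF n] by (metis image_subsetI rangeI)
    qed
    then have tr_e: "lin_trace e = real (dim (range n))" using lin_trace_idempotent[OF e idem] by simp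
    \<comment> \<open>Chosen so that \<open>n q + q n + c\<close> equals \<open>1 + 2 W\<close>,
      which is invertible because its determinant is odd. As \<open>n q\<close> and
      \<open>q n\<close> have rank at most that of \<open>n\<close>, twice this rank is at least the
      size of \<open>Y\<close>.\<close>
    define W where "W = (if s = 1 then Q ** Q - Q else Q ** Q + Q)"
    define Z where "Z = real_matrix (mat 1 + (W + W))"
    have "det Z \<noteq> 0" using odd_det_of_cong_identity[of W] by (auto simp: Z_def det_real_matrix)
    then have "invertible Z" by (simp add: invertible_det_nz)
    then have "range (\<lambda>v. Z *v v) = UNIV"
      by (metis invertible_def matrix_vector_mul_assoc matrix_vector_mul_lid surjI)
    moreover have "Z *v v = n (q v) + q (n v) + c v" for v
    proof -
      have "Z *v v = v + (real_matrix W *v v + real_matrix W *v v)"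
        by (simp only: Z_def real_matrix_simps matrix_vector_mult_add_rdistrib matrix_vector_mul_lid)
      also have "real_matrix W *v v = q (q v) - s *\<^sub>R q v"
        using s by (auto simp: W_def real_matrix_simps q_def matrix_vector_mul_assoc
            matrix_vector_mult_add_rdistrib matrix_vector_mult_diff_rdistrib)
      also have "v + (q (q v) - s *\<^sub>R q v + (q (q v) - s *\<^sub>R q v)) = n (q v) + q (n v) + c v"
      proof -
        have "n (q v) = a (q v) - s *\<^sub>R q v" by (simp only: n_def kq)
        then have 1: "n (q v) $ i = a (q v) $ i - s * q v $ i" for i by simp
        have "q (n v) = q (a v) - s *\<^sub>R q v"
          by (simp only: n_def linear_diff[OF lin(2)] linear_scale[OF lin(2)] qk)
        then have 2: "q (n v) $ i = q (a v) $ i - s * q v $ i" for i by simp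
        have "(a (q v) + q (a v)) $ i = (k v + 2 *\<^sub>R q (q v)) $ i" for i by (simp only: aq)
        then have 3: "a (q v) $ i = k v $ i + 2 * q (q v) $ i - q (a v) $ i" for i
          by (simp add: algebra_simps)
        show ?thesis by (simp add: c_def vec_eq_iff 1 2 3)
      qed
      finally show ?thesis .
    qed
    ultimately have "UNIV = (\<lambda>v. n (q v) + q (n v) + c v) ` UNIV" by simp
    also have "\<dots> \<subseteq> {x + y |x y. x \<in> {x + y |x y. x \<in> range n \<and> y \<in> q ` range n} \<and> y \<in> range c}" by blast
    finally have "dim (UNIV :: (real^'n) set) \<le> dim {x + y |x y. x \<in> {x + y |x y. x \<in> range n \<and> y \<in> q ` range n} \<and> y \<in> range c}"
      by (rule dim_subset)
    also have "\<dots> \<le> dim {x + y |x y. x \<in> range n \<and> y \<in> q ` range n} + dim (range c)"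
    proof -
      have "subspace {x + y |x y. x \<in> range n \<and> y \<in> q ` range n}"
        by (intro subspace_sums linear_subspace_image lin n subspace_UNIV)
      then show ?thesis by (intro dim_sums_le linear_subspace_image[OF lin_c subspace_UNIV])
    qed
    also have "dim {x + y |x y. x \<in> range n \<and> y \<in> q ` range n} \<le> dim (range n) + dim (q ` range n)"
      by (intro dim_sums_le linear_subspace_image lin n subspace_UNIV)
    also have "dim (q ` range n) \<le> dim (range n)" by (rule dim_image_le[OF lin(2)])
    finally have "CARD('n) \<le> 2 * dim (range n) + dim (range c)" by simp
    then have "real CARD('n) \<le> 2 * real (dim (range n)) + real (dim (range c))" by linarith
    then show ?thesis using dim_c tr_e by (simp add: e_def)
  qed
  have tr_half: "lin_trace (\<lambda>v. (1/2) *\<^sub>R (k v - s *\<^sub>R a v)) = (real (card Y) - s * lin_trace a) * (1/2)" for s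
    by (simp only: lin_trace_scaleR lin_trace_diff tr_k)
  have "real (card Y) \<le> real (card Y) - s * lin_trace a" if "s = 1 \<or> s = -1" for s
    using half[OF that] unfolding tr_half by simp
  from this[of 1] this[of "-1"] have "lin_trace a = 0" by simp
  then have "real_of_int (trace A) = 0" by (simp add: a_def lin_trace_matrix trace_def real_matrix_def)
  then show ?thesis by simp
qed

section \<open>Partial augmentations of involutory units\<close>

lemma sum_periodic_shift:
  fixes F :: "nat \<Rightarrow> 'b::comm_monoid_add"
  assumes "\<And>l. F (l + s) = F l"
  shows "(\<Sum>j<s. F (i + j)) = (\<Sum>l<s. F l)"
proof (induction i)
  case (Suc i)
  have "(\<Sum>j<s. F (Suc i + j)) = (\<Sum>j<s. F (i + j))"
  proof (cases s)
    case (Suc t)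
    have "(\<Sum>j<s. F (Suc i + j)) = (\<Sum>j<t. F (i + Suc j)) + F (i + s)"
      by (simp add: Suc)
    also have "F (i + s) = F (i + 0)" using assms by simp
    also have "(\<Sum>j<t. F (i + Suc j)) + F (i + 0) = (\<Sum>j<s. F (i + j))"
      unfolding Suc by (subst sum.lessThan_Suc_shift) (simp add: add.commute)
    finally show ?thesis .
  qed simp
  then show ?case using Suc by simp
qed simp

text \<open>The group ring product in kernel form, as it arises when matrices indexed by group
  elements are multiplied.\<close>

lemma (in group) convolution_at_product:
  assumes fin: "finite (carrier G)" and ab: "a \<in> carrier G" "b \<in> carrier G"
  shows "(\<Sum>h\<in>carrier G. u (a \<otimes> inv h) * v (h \<otimes> b)) = (u \<otimes>\<^bsub>int_group_ring G\<^esub> v) (a \<otimes> b)"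
proof -
  have "(\<Sum>h\<in>carrier G. u (a \<otimes> inv h) * v (h \<otimes> b)) = (\<Sum>h\<in>carrier G. u h * v (inv h \<otimes> (a \<otimes> b)))"
    by (rule sum.reindex_bij_witness[where i = "\<lambda>h. inv h \<otimes> a" and j = "\<lambda>h. a \<otimes> inv h"])
      (use ab in \<open>auto simp: inv_mult_group m_assoc\<close>, (simp flip: m_assoc)+)
  then show ?thesis using ab by (simp add: int_group_ring_mult[OF fin])
qed

lemma (in group) cyclic_transversal:
  assumes w: "w \<in> carrier G" and s: "ord w = s" "s > 0"
  obtains Y where "Y \<subseteq> carrier G" "bij_betw (\<lambda>(y, i). y \<otimes> w [^] i) (Y \<times> {..<s}) (carrier G)"
proof -
  define cos where "cos = (\<lambda>g. range (\<lambda>i::nat. g \<otimes> w [^] i))"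
  define rep where "rep = (\<lambda>g. SOME h. h \<in> cos g)"
  have cos_car: "cos g \<subseteq> carrier G" if "g \<in> carrier G" for g using that w by (auto simp: cos_def)
  have sub: "cos h \<subseteq> cos g" if gh: "g \<in> carrier G" "h \<in> cos g" for g h
  proof -
    obtain i :: nat where i: "h = g \<otimes> w [^] i" using gh(2) unfolding cos_def by blast
    have "h \<otimes> w [^] j = g \<otimes> w [^] (i + j)" for j :: nat
      using gh(1) w by (simp add: i m_assoc nat_pow_mult)
    then show ?thesis unfolding cos_def by blast
  qed
  have modw: "w [^] i = w [^] (i mod s)" for i :: nat
  proof -
    have "w [^] i = w [^] (s * (i div s) + i mod s)" by simp
    also have "\<dots> = (w [^] s) [^] (i div s) \<otimes> w [^] (i mod s)" using w by (simp add: nat_pow_mult nat_pow_pow)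
    also have "w [^] s = \<one>" using pow_ord_eq_1[OF w] s(1) by simp
    finally show ?thesis using w by simp
  qed
  have sym: "g \<in> cos h" if gh: "g \<in> carrier G" "h \<in> cos g" for g h
  proof -
    obtain i :: nat where i: "h = g \<otimes> w [^] i" using gh(2) unfolding cos_def by blast
    have "w [^] (s * i) = \<one>" using w s by (simp add: pow_eq_id)
    moreover have "i + (s * i - i) = s * i" using s by simp
    ultimately have "g = h \<otimes> w [^] (s * i - i)" using gh w i by (simp add: m_assoc nat_pow_mult)
    then show ?thesis by (auto simp: cos_def)
  qed
  have self: "g \<in> cos g" if "g \<in> carrier G" for g
    using that unfolding cos_def by (auto intro: range_eqI[of _ _ "0::nat"])
  have rep: "rep g \<in> cos g" if "g \<in> carrier G" for g
    unfolding rep_def using someI[of "\<lambda>h. h \<in> cos g", OF self[OF that]] .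
  have cos_eq: "cos h = cos g" if "g \<in> carrier G" "h \<in> cos g" for g h
    using sub sym that cos_car by blast
  have rep_rep: "rep h = rep g" if "g \<in> carrier G" "h \<in> cos g" for g h
    using cos_eq[OF that] by (simp add: rep_def)
  define Y where "Y = rep ` carrier G"
  have Y: "Y \<subseteq> carrier G" using rep cos_car by (auto simp: Y_def)
  have repY: "rep y = y" if "y \<in> Y" for y using that rep_rep rep by (auto simp: Y_def)
  have inj: "inj_on (\<lambda>(y, i). y \<otimes> w [^] i) (Y \<times> {..<s})"
  proof (rule inj_onI, clarify)
    fix y i z j assume *: "y \<in> Y" "z \<in> Y" "i < s" "j < s" "y \<otimes> w [^] i = z \<otimes> w [^] j"
    have "rep (t \<otimes> w [^] n) = t" if "t \<in> Y" for t and n :: nat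
      using that Y repY[OF that] rep_rep[of t "t \<otimes> w [^] n"] by (auto simp: cos_def)
    from this[OF *(1), of i] this[OF *(2), of j] have "rep (y \<otimes> w [^] i) = y" "rep (z \<otimes> w [^] j) = z" .
    then have "y = z" using * by simp
    then have "w [^] i = w [^] j" using * Y w by (simp add: subset_iff)
    then have "w [^] int i = w [^] int j" by (simp add: int_pow_int)
    then have "int s dvd int j - int i" using int_pow_eq[OF w] s by simp
    then have "i mod s = j mod s" by (metis mod_eq_dvd_iff zmod_int of_nat_eq_iff)
    then show "y = z \<and> i = j" using * \<open>y = z\<close> by simp
  qed
  have "(\<lambda>(y, i). y \<otimes> w [^] i) ` (Y \<times> {..<s}) = carrier G"
  proof
    show "(\<lambda>(y, i). y \<otimes> w [^] i) ` (Y \<times> {..<s}) \<subseteq> carrier G" using Y w by auto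
    show "carrier G \<subseteq> (\<lambda>(y, i). y \<otimes> w [^] i) ` (Y \<times> {..<s})"
    proof
      fix g assume g: "g \<in> carrier G"
      then obtain i :: nat where "g = rep g \<otimes> w [^] i" using sym[OF g rep] by (auto simp: cos_def)
      then have "g = rep g \<otimes> w [^] (i mod s)" using modw by metis
      then show "g \<in> (\<lambda>(y, i). y \<otimes> w [^] i) ` (Y \<times> {..<s})"
        using g s by (intro image_eqI[of _ _ "(rep g, i mod s)"]) (auto simp: Y_def)
    qed
  qed
  then show thesis using that Y inj by (simp add: bij_betw_def)
qed

text \<open>For \<open>s\<close> a power of 2 the exponents \<open>2 * i + 1\<close> run through the
  generators of the group of \<open>x\<close>. \<open>M \<omega>\<close> is, over the transversal
  \<open>Y\<close>, the matrix of left multiplication by \<open>u\<close> combined with right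
  multiplication by \<open>x\<close> where the square of \<open>x\<close> acts as the scalar
  \<omega>. The value -1 is admissible since \<open>s\<close> is even. \<open>M 1\<close> and
  \<open>M (-1)\<close> have squares 1 and -1 on \<open>Y\<close> and agree modulo 2, so the trace
  of \<open>M 1\<close> is 0.\<close>

lemma involution_unit_generator_sum:
  fixes G :: "('a::finite, 'b) monoid_scheme" (structure) and u :: "'a \<Rightarrow> int"
  assumes "group G" and uu: "u \<otimes>\<^bsub>int_group_ring G\<^esub> u = \<one>\<^bsub>int_group_ring G\<^esub>"
    and x: "x \<in> carrier G" and ord: "group.ord G x = 2 * s" and s: "even s" "s > 0"
  shows "(\<Sum>m\<in>carrier G. \<Sum>i<s. u (m \<otimes> x [^] (2 * i + 1) \<otimes> inv m)) = 0"
proof -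
  interpret group G by fact
  \<comment> \<open>The inverse makes \<open>inv (h \<otimes> w [^] i)\<close> equal to
    \<open>x [^] (2 * i) \<otimes> inv h\<close>, so in a matrix product the double sum over
    \<open>h\<close> in \<open>Y\<close> and \<open>i\<close> becomes a sum over the whole
    group.\<close>
  define w where "w = inv (x [^] (2 :: nat))"
  have w: "w \<in> carrier G" using x by (simp add: w_def)
  have ordw: "ord w = s" using x ord s by (simp add: w_def ord_pow)
  have wi: "w [^] i = inv (x [^] (2 * i))" for i :: nat using x by (simp add: w_def nat_pow_inv nat_pow_pow)
  obtain Y where Y: "Y \<subseteq> carrier G" and bij: "bij_betw (\<lambda>(y, i). y \<otimes> w [^] i) (Y \<times> {..<s}) (carrier G)"
    using cyclic_transversal[OF w ordw s(2)] by blast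
  have Yc: "y \<in> carrier G" if "y \<in> Y" for y using that Y by blast
  have sum_bij: "(\<Sum>m\<in>carrier G. F m) = (\<Sum>y\<in>Y. \<Sum>i<s. F (y \<otimes> w [^] i))" for F :: "'a \<Rightarrow> int"
    using sum.reindex_bij_betw[OF bij, of F] by (simp add: sum.cartesian_product case_prod_unfold)
  have x2s: "x [^] (2 * s) = \<one>" using x ord by (metis pow_ord_eq_1)
  define c where "c = (\<lambda>g i h. u (g \<otimes> x [^] (2 * i + 1 :: nat) \<otimes> inv h))"
  define M :: "int \<Rightarrow> int^'a^'a" where "M = (\<lambda>\<omega>. \<chi> g h. if g \<in> Y \<and> h \<in> Y then \<Sum>i<s. \<omega> ^ i * c g i h else 0)"
  define K :: "int^'a^'a" where "K = (\<chi> g h. of_bool (g = h \<and> g \<in> Y))"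
  define Q :: "int^'a^'a" where "Q = (\<chi> g h. if g \<in> Y \<and> h \<in> Y then \<Sum>i<s. of_bool (odd i) * c g i h else 0)"
  have square: "(M \<omega> ** M \<omega>) $ g $ k = \<omega> ^ (s - 1) * of_bool (g = k)"
    if \<omega>: "\<omega> ^ s = 1" and gk: "g \<in> Y" "k \<in> Y" for \<omega> g k
  proof -
    have gkc: "g \<in> carrier G" "k \<in> carrier G" using gk Yc by auto
    define S where "S = (\<lambda>h. \<Sum>l<s. \<omega> ^ l * u (h \<otimes> x [^] (2 * l + 1) \<otimes> inv k))"
    have shift: "(\<Sum>j<s. (\<omega> ^ i * c g i h) * (\<omega> ^ j * c h j k)) =
        u (g \<otimes> x \<otimes> inv (h \<otimes> w [^] i)) * S (h \<otimes> w [^] i)" if h: "h \<in> Y" for h i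
    proof -
      let ?h = "h \<otimes> w [^] i"
      have hc: "h \<in> carrier G" using h Yc by blast
      have "inv ?h = x [^] (2 * i) \<otimes> inv h" using hc x by (simp add: wi inv_mult_group)
      then have 1: "c g i h = u (g \<otimes> x \<otimes> inv ?h)"
        using gkc hc x by (simp add: c_def m_assoc nat_pow_Suc2[symmetric] inv_cancel_left) (simp flip: m_assoc nat_pow_Suc2)
      have 2: "c h j k = u (?h \<otimes> x [^] (2 * (i + j) + 1) \<otimes> inv k)" for j
      proof -
        have "x [^] (2 * (i + j) + 1) = x [^] (2 * i) \<otimes> x [^] (2 * j + 1)" using x by (simp only: nat_pow_mult) (simp add: algebra_simps)
        then have "?h \<otimes> x [^] (2 * (i + j) + 1) = h \<otimes> (inv (x [^] (2 * i)) \<otimes> (x [^] (2 * i) \<otimes> x [^] (2 * j + 1)))"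
          using x hc by (simp only: wi m_assoc nat_pow_closed inv_closed m_closed)
        also have "\<dots> = h \<otimes> x [^] (2 * j + 1)" using x hc by (simp only: l_inv l_one nat_pow_closed inv_closed m_assoc[symmetric] m_closed)
        finally show ?thesis by (simp only: c_def)
      qed
      define F where "F = (\<lambda>l. \<omega> ^ l * u (?h \<otimes> x [^] (2 * l + 1) \<otimes> inv k))"
      have per: "F (l + s) = F l" for l
      proof -
        have "x [^] (2 * (l + s) + 1) = x [^] (2 * l + 1) \<otimes> x [^] (2 * s)" using x by (simp only: nat_pow_mult) (simp add: algebra_simps)
        then have "x [^] (2 * (l + s) + 1) = x [^] (2 * l + 1)" using x x2s by simp
        then show ?thesis by (simp only: F_def power_add \<omega> mult_1_right)
      qed
      have "(\<Sum>j<s. (\<omega> ^ i * c g i h) * (\<omega> ^ j * c h j k)) = (\<Sum>j<s. u (g \<otimes> x \<otimes> inv ?h) * F (i + j))"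
        by (simp only: 1 2 F_def power_add mult_ac)
      also have "\<dots> = u (g \<otimes> x \<otimes> inv ?h) * (\<Sum>l<s. F l)"
        by (simp only: sum_distrib_left[symmetric] sum_periodic_shift[of F, OF per])
      finally show ?thesis by (simp only: S_def F_def)
    qed
    have "(M \<omega> ** M \<omega>) $ g $ k = (\<Sum>h\<in>UNIV. if h \<in> Y then (\<Sum>i<s. \<omega> ^ i * c g i h) * (\<Sum>j<s. \<omega> ^ j * c h j k) else 0)"
      unfolding matrix_matrix_mult_def M_def using gk by (auto intro!: sum.cong)
    also have "\<dots> = (\<Sum>h\<in>Y. (\<Sum>i<s. \<omega> ^ i * c g i h) * (\<Sum>j<s. \<omega> ^ j * c h j k))"
      by (simp add: sum.If_cases)
    also have "\<dots> = (\<Sum>h\<in>Y. \<Sum>i<s. u (g \<otimes> x \<otimes> inv (h \<otimes> w [^] i)) * S (h \<otimes> w [^] i))"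
      by (intro sum.cong refl) (simp only: sum_product shift)
    also have "\<dots> = (\<Sum>h\<in>carrier G. u (g \<otimes> x \<otimes> inv h) * S h)" by (rule sum_bij[symmetric])
    also have "\<dots> = (\<Sum>l<s. \<omega> ^ l * (\<Sum>h\<in>carrier G. u (g \<otimes> x \<otimes> inv h) * u (h \<otimes> (x [^] (2 * l + 1) \<otimes> inv k))))"
      unfolding S_def sum_distrib_left
      by (subst sum.swap) (intro sum.cong refl, use gkc x in \<open>simp add: m_assoc mult_ac\<close>)
    also have "\<dots> = (\<Sum>l<s. \<omega> ^ l * \<one>\<^bsub>int_group_ring G\<^esub> (g \<otimes> x \<otimes> (x [^] (2 * l + 1) \<otimes> inv k)))"
      using gkc x by (simp add: convolution_at_product uu del: nat_pow_Suc)
    \<comment> \<open>As \<open>g\<close> and \<open>k\<close> both belong to the transversal, the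
      argument is \<open>\<one>\<close> only if \<open>g = k\<close> and
      \<open>x [^] (2 * (l + 1)) = \<one>\<close>; for \<open>l < s\<close> this is
      \<open>l + 1 = s\<close>.\<close>
    also have "\<dots> = (\<Sum>l<s. if l = s - 1 then \<omega> ^ (s - 1) * of_bool (g = k) else 0)"
    proof (rule sum.cong[OF refl])
      fix l assume l: "l \<in> {..<s}"
      have "g \<otimes> x \<otimes> (x [^] (2 * l + 1) \<otimes> inv k) = g \<otimes> x [^] (2 * (l + 1)) \<otimes> inv k"
      proof -
        have "x [^] (2 * (l + 1)) = x [^] (1 :: nat) \<otimes> x [^] (2 * l + 1)" using x by (simp only: nat_pow_mult) (simp add: algebra_simps)
        then show ?thesis using gkc x by (simp only: nat_pow_eone m_assoc nat_pow_closed inv_closed m_closed)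
      qed
      then have *: "g \<otimes> x \<otimes> (x [^] (2 * l + 1) \<otimes> inv k) = \<one> \<longleftrightarrow> g \<otimes> x [^] (2 * (l + 1)) = k"
        using gkc x by (metis inv_closed inv_equality inv_inv m_closed nat_pow_closed r_inv)
      have **: "g \<otimes> x [^] (2 * (l + 1)) = k \<longleftrightarrow> l = s - 1 \<and> g = k"
      proof
        assume "g \<otimes> x [^] (2 * (l + 1)) = k"
        then have "g = k \<otimes> inv (x [^] (2 * (l + 1)))" using gkc x by (metis inv_solve_right nat_pow_closed)
        then have eq: "g \<otimes> w [^] (0 :: nat) = k \<otimes> w [^] (l + 1)" using gkc w by (simp only: wi nat_pow_0 r_one)
        show "l = s - 1 \<and> g = k"
        proof (cases "l = s - 1")
          case True
          then have "w [^] (l + 1) = \<one>" using ordw w s by (simp only: pow_eq_id) simp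
          then show ?thesis using eq gkc True by simp
        next
          case False
          then have "(0 :: nat) \<in> {..<s}" "l + 1 \<in> {..<s}" using l by auto
          then have "(g, 0 :: nat) = (k, l + 1)"
            using bij gk eq by (intro inj_onD[of "\<lambda>(y, i). y \<otimes> w [^] i" "Y \<times> {..<s}"]) (auto simp only: bij_betw_def split: prod.split)
          then show ?thesis by simp
        qed
      next
        assume "l = s - 1 \<and> g = k"
        then show "g \<otimes> x [^] (2 * (l + 1)) = k" using s x2s gkc by simp
      qed
      show "\<omega> ^ l * \<one>\<^bsub>int_group_ring G\<^esub> (g \<otimes> x \<otimes> (x [^] (2 * l + 1) \<otimes> inv k)) =
          (if l = s - 1 then \<omega> ^ (s - 1) * of_bool (g = k) else 0)"
        unfolding int_group_ring_simps(3) * ** by simp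
    qed
    also have "\<dots> = \<omega> ^ (s - 1) * of_bool (g = k)" using s by simp
    finally show ?thesis .
  qed
  have off: "(M \<omega> ** M \<omega>) $ g $ k = 0" if "g \<notin> Y \<or> k \<notin> Y" for \<omega> g k
    using that by (auto simp: matrix_matrix_mult_def M_def intro!: sum.neutral)
  have sq: "M \<omega> ** M \<omega> = (\<chi> g k. \<omega> ^ (s - 1) * K $ g $ k)" if "\<omega> ^ s = 1" for \<omega>
    unfolding vec_eq_iff
  proof (intro allI)
    fix g k
    show "(M \<omega> ** M \<omega>) $ g $ k = (\<chi> g k. \<omega> ^ (s - 1) * K $ g $ k) $ g $ k"
    proof (cases "g \<in> Y \<and> k \<in> Y")
      case True
      then show ?thesis using square[OF that] by (auto simp: K_def)
    next
      case False
      then show ?thesis using off[of g k \<omega>] by (auto simp: K_def)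
    qed
  qed
  have "M 1 ** M 1 = K" using sq[of 1] by (simp add: vec_eq_iff)
  moreover have "M (-1) ** M (-1) = - K"
  proof -
    have "(-1 :: int) ^ s = 1" "(-1 :: int) ^ (s - 1) = -1" using s by auto
    then show ?thesis using sq[of "-1"] by (simp add: vec_eq_iff)
  qed
  moreover have "M 1 = M (-1) + (Q + Q)"
  proof -
    have "(\<Sum>i<s. c g i h) = (\<Sum>i<s. (-1) ^ i * c g i h) + ((\<Sum>i<s. of_bool (odd i) * c g i h) + (\<Sum>i<s. of_bool (odd i) * c g i h))" for g h
      unfolding sum.distrib[symmetric] by (intro sum.cong refl) auto
    then show ?thesis by (simp add: vec_eq_iff M_def Q_def)
  qed
  moreover have "K ** X = X" "X ** K = X" if "\<And>g h. g \<notin> Y \<or> h \<notin> Y \<Longrightarrow> X $ g $ h = 0" for X :: "int^'a^'a"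
  proof -
    have "K $ g $ j * X $ j $ h = (if j = g then X $ g $ h else 0)"
      and "X $ g $ j * K $ j $ h = (if j = h then X $ g $ h else 0)" for g j h
      using that[of g h] by (auto simp: K_def)
    then show "K ** X = X" "X ** K = X" by (simp_all add: matrix_matrix_mult_def vec_eq_iff)
  qed
  note K_unit = this
  have "M 1 $ g $ h = 0" "Q $ g $ h = 0" if "g \<notin> Y \<or> h \<notin> Y" for g h
    using that by (auto simp: M_def Q_def)
  then have "K ** M 1 = M 1" "M 1 ** K = M 1" "K ** Q = Q" "Q ** K = Q"
    using K_unit[of "M 1"] K_unit[of Q] by blast+
  moreover note this
  ultimately have "trace (M 1) = 0"
    unfolding K_def by (intro involution_trace_zero)
  then have tr: "(\<Sum>g\<in>Y. \<Sum>i<s. c g i g) = 0" by (simp add: trace_def M_def sum.If_cases)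
  \<comment> \<open>\<open>w\<close> commutes with \<open>x\<close>, so all elements of one coset
    conjugate the powers of \<open>x\<close> alike, and the sum over the group is \<open>s\<close>
    times the trace.\<close>
  have inv_conj: "(y \<otimes> w [^] j) \<otimes> x [^] n \<otimes> inv (y \<otimes> w [^] j) = y \<otimes> x [^] n \<otimes> inv y"
    if "y \<in> Y" for y and j n :: nat
  proof -
    let ?a = "x [^] (2 * j)" and ?b = "x [^] n"
    have ab: "?a \<in> carrier G" "?b \<in> carrier G" using x by auto
    have "inv ?a \<otimes> ?b = inv ?a \<otimes> (?b \<otimes> ?a) \<otimes> inv ?a" using ab by (simp only: m_assoc r_inv r_one inv_closed m_closed)
    also have "?b \<otimes> ?a = ?a \<otimes> ?b" using nat_pow_comm[OF x] .
    also have "inv ?a \<otimes> (?a \<otimes> ?b) \<otimes> inv ?a = ?b \<otimes> inv ?a" using ab by (simp only: inv_cancel_left)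
    finally have "inv ?a \<otimes> ?b = ?b \<otimes> inv ?a" .
    then have "w [^] j \<otimes> x [^] n = x [^] n \<otimes> w [^] j" by (simp only: wi)
    then have "(y \<otimes> w [^] j) \<otimes> x [^] n = (y \<otimes> x [^] n) \<otimes> w [^] j" using Yc[OF that] x w by (simp add: m_assoc)
    then have "(y \<otimes> w [^] j) \<otimes> x [^] n \<otimes> inv (y \<otimes> w [^] j) = (y \<otimes> x [^] n) \<otimes> (w [^] j \<otimes> (inv (w [^] j) \<otimes> inv y))"
      using Yc[OF that] x w by (simp add: m_assoc inv_mult_group)
    then show ?thesis using Yc[OF that] x w by (simp add: inv_cancel_left)
  qed
  have "(\<Sum>m\<in>carrier G. \<Sum>i<s. u (m \<otimes> x [^] (2 * i + 1) \<otimes> inv m)) = (\<Sum>y\<in>Y. \<Sum>j<s. \<Sum>i<s. c y i y)"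
    unfolding sum_bij[of "\<lambda>m. \<Sum>i<s. u (m \<otimes> x [^] (2 * i + 1) \<otimes> inv m)"]
    by (intro sum.cong refl) (simp only: inv_conj c_def)
  also have "\<dots> = int s * (\<Sum>y\<in>Y. \<Sum>i<s. c y i y)" by (simp add: sum_distrib_left)
  finally show ?thesis using tr by simp
qed

section \<open>Induced real representations\<close>

lemma (in group) group_ring_mult_sum:
  fixes F :: "'a \<Rightarrow> 'v::real_vector"
  assumes fin: "finite (carrier G)"
  shows "(\<Sum>t\<in>carrier G. real_of_int ((u \<otimes>\<^bsub>int_group_ring G\<^esub> v) t) *\<^sub>R F t) =
    (\<Sum>h\<in>carrier G. \<Sum>k\<in>carrier G. (real_of_int (u h) * real_of_int (v k)) *\<^sub>R F (h \<otimes> k))"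
proof -
  have "(\<Sum>t\<in>carrier G. real_of_int ((u \<otimes>\<^bsub>int_group_ring G\<^esub> v) t) *\<^sub>R F t) =
    (\<Sum>t\<in>carrier G. \<Sum>h\<in>carrier G. (real_of_int (u h) * real_of_int (v (inv h \<otimes> t))) *\<^sub>R F t)"
    by (intro sum.cong refl) (simp add: int_group_ring_mult[OF fin] scaleR_sum_left)
  also have "\<dots> = (\<Sum>h\<in>carrier G. \<Sum>t\<in>carrier G. (real_of_int (u h) * real_of_int (v (inv h \<otimes> t))) *\<^sub>R F t)"
    by (rule sum.swap)
  also have "\<dots> = (\<Sum>h\<in>carrier G. \<Sum>k\<in>carrier G. (real_of_int (u h) * real_of_int (v k)) *\<^sub>R F (h \<otimes> k))"
  proof (rule sum.cong[OF refl])
    fix h assume h: "h \<in> carrier G"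
    show "(\<Sum>t\<in>carrier G. (real_of_int (u h) * real_of_int (v (inv h \<otimes> t))) *\<^sub>R F t) =
      (\<Sum>k\<in>carrier G. (real_of_int (u h) * real_of_int (v k)) *\<^sub>R F (h \<otimes> k))"
      by (subst sum_translate[OF h], rule sum.cong) (use h in \<open>simp_all add: inv_cancel_left\<close>)
  qed
  finally show ?thesis .
qed

text \<open>The plane is \<open>complex\<close> seen as a real vector space: reflections act through
  conjugation, so only real linearity can be asked. The finite type makes
  \<open>complex ^ 'a\<close> a Euclidean space, with the group as a possibly proper subset of the
  index type.\<close>

locale real_plane_rep = group G for G :: "('a::finite, 'b) monoid_scheme" (structure) +
  fixes D :: "'a set" and \<rho> :: "'a \<Rightarrow> complex \<Rightarrow> complex"
  assumes D: "subgroup D G"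
    and \<rho>_linear: "\<And>d. d \<in> D \<Longrightarrow> linear (\<rho> d)"
    and \<rho>_mult: "\<And>d e v. d \<in> D \<Longrightarrow> e \<in> D \<Longrightarrow> \<rho> (d \<otimes> e) v = \<rho> d (\<rho> e v)"
    and \<rho>_one: "\<And>v. \<rho> \<one> v = v"
begin

text \<open>The real representation of \<open>G\<close> induced from \<open>\<rho>\<close>, on the functions \<open>f\<close> with
  \<open>\<rho> d (f (g d)) = f g\<close>, extended to the group ring and composed with the projection onto these
  functions: the unit of the group ring acts as that projection, not as the identity.\<close>

definition induced :: "('a \<Rightarrow> int) \<Rightarrow> complex ^ 'a \<Rightarrow> complex ^ 'a" where
  "induced u f = (\<chi> g. if g \<in> carrier G then
    (1 / real (card D)) *\<^sub>R (\<Sum>d\<in>D. \<Sum>h\<in>carrier G. real_of_int (u h) *\<^sub>R \<rho> d (f $ (inv h \<otimes> g \<otimes> d))) else 0)"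

text \<open>Frobenius's formula for the character of an induced representation.\<close>

definition induced_character :: "'a \<Rightarrow> real" where
  "induced_character h = (1 / real (card D)) *
    (\<Sum>g\<in>carrier G. if inv g \<otimes> h \<otimes> g \<in> D then lin_trace (\<rho> (inv g \<otimes> h \<otimes> g)) else 0)"

lemma D_carrier: "d \<in> D \<Longrightarrow> d \<in> carrier G"
  by (rule subgroup.mem_carrier[OF D])

lemma card_D: "card D > 0"
  using D subgroup.one_closed[OF D] by (auto simp: card_gt_0_iff)

lemma fin: "finite (carrier G)"
  by simp

lemma sum_D_translate: "d \<in> D \<Longrightarrow> (\<Sum>e\<in>D. F (d \<otimes> e)) = (\<Sum>e\<in>D. F e)" for F :: "'a \<Rightarrow> 'v::comm_monoid_add"
  by (rule sum.reindex_bij_witness[where i = "\<lambda>e. inv d \<otimes> e" and j = "\<lambda>e. d \<otimes> e"])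
    (auto simp: inv_cancel_left D_carrier subgroup.m_closed[OF D] subgroup.m_inv_closed[OF D])

lemma linear_induced: "linear (induced u)"
proof (rule linearI)
  show "induced u (f + f') = induced u f + induced u f'" for f f'
    by (simp add: induced_def vec_eq_iff linear_add[OF \<rho>_linear] scaleR_add_right sum.distrib)
  show "induced u (c *\<^sub>R f) = c *\<^sub>R induced u f" for c f
    by (simp add: induced_def vec_eq_iff linear_scale[OF \<rho>_linear] scaleR_sum_right mult_ac)
qed

text \<open>The composite averages over \<open>D\<close> twice. Translating the inner index by
  \<open>d\<close> makes the inner average independent of \<open>d\<close>, so a single average is
  left.\<close>

lemma induced_mult: "induced (u \<otimes>\<^bsub>int_group_ring G\<^esub> v) f = induced u (induced v f)"
proof -
  have "induced u (induced v f) $ g = induced (u \<otimes>\<^bsub>int_group_ring G\<^esub> v) f $ g" if g: "g \<in> carrier G" for g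
  proof -
    define F where "F = (\<lambda>d. \<Sum>h\<in>carrier G. \<Sum>k\<in>carrier G.
      (real_of_int (u h) * real_of_int (v k)) *\<^sub>R \<rho> d (f $ (inv (h \<otimes> k) \<otimes> g \<otimes> d)))"
    have inner: "\<rho> d (induced v f $ (inv h \<otimes> g \<otimes> d)) = (1 / real (card D)) *\<^sub>R
        (\<Sum>e\<in>D. \<Sum>k\<in>carrier G. real_of_int (v k) *\<^sub>R \<rho> (d \<otimes> e) (f $ (inv (h \<otimes> k) \<otimes> g \<otimes> (d \<otimes> e))))"
      if d: "d \<in> D" and h: "h \<in> carrier G" for d h
    proof -
      have "\<rho> d (induced v f $ (inv h \<otimes> g \<otimes> d)) = (1 / real (card D)) *\<^sub>R
        (\<Sum>e\<in>D. \<Sum>k\<in>carrier G. real_of_int (v k) *\<^sub>R \<rho> d (\<rho> e (f $ (inv k \<otimes> (inv h \<otimes> g \<otimes> d) \<otimes> e))))"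
        using d h g by (simp add: induced_def D_carrier linear_scale[OF \<rho>_linear] linear_sum[OF \<rho>_linear])
      also have "\<dots> = (1 / real (card D)) *\<^sub>R
        (\<Sum>e\<in>D. \<Sum>k\<in>carrier G. real_of_int (v k) *\<^sub>R \<rho> (d \<otimes> e) (f $ (inv (h \<otimes> k) \<otimes> g \<otimes> (d \<otimes> e))))"
        using d h g by (intro arg_cong2[where f = scaleR] refl sum.cong)
          (simp_all add: \<rho>_mult inv_mult_group m_assoc D_carrier)
      finally show ?thesis .
    qed
    have "induced u (induced v f) $ g = (1 / real (card D)) *\<^sub>R (\<Sum>d\<in>D. (1 / real (card D)) *\<^sub>R (\<Sum>e\<in>D. F (d \<otimes> e)))"
    proof -
      have "(\<Sum>h\<in>carrier G. real_of_int (u h) *\<^sub>R \<rho> d (induced v f $ (inv h \<otimes> g \<otimes> d))) =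
          (1 / real (card D)) *\<^sub>R (\<Sum>e\<in>D. F (d \<otimes> e))" if d: "d \<in> D" for d
      proof -
        have "(\<Sum>h\<in>carrier G. real_of_int (u h) *\<^sub>R \<rho> d (induced v f $ (inv h \<otimes> g \<otimes> d))) =
          (\<Sum>h\<in>carrier G. \<Sum>e\<in>D. \<Sum>k\<in>carrier G. (1 / real (card D)) *\<^sub>R
            ((real_of_int (u h) * real_of_int (v k)) *\<^sub>R \<rho> (d \<otimes> e) (f $ (inv (h \<otimes> k) \<otimes> g \<otimes> (d \<otimes> e)))))"
          by (intro sum.cong refl) (simp add: inner[OF d] scaleR_sum_right mult_ac)
        also have "\<dots> = (1 / real (card D)) *\<^sub>R (\<Sum>e\<in>D. F (d \<otimes> e))"
          unfolding F_def scaleR_sum_right by (rule sum.swap)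
        finally show ?thesis .
      qed
      then show ?thesis using g by (simp add: induced_def[of u])
    qed
    also have "\<dots> = (1 / real (card D)) *\<^sub>R (\<Sum>d\<in>D. F d)"
    proof -
      have "(\<Sum>d\<in>D. (1 / real (card D)) *\<^sub>R (\<Sum>e\<in>D. F (d \<otimes> e))) = (\<Sum>d\<in>D. (1 / real (card D)) *\<^sub>R (\<Sum>e\<in>D. F e))"
        by (intro sum.cong refl) (simp add: sum_D_translate)
      also have "\<dots> = (\<Sum>d\<in>D. F d)"
        using card_D by (simp only: sum_constant_scaleR scaleR_scaleR) simp
      finally show ?thesis by simp
    qed
    also have "\<dots> = induced (u \<otimes>\<^bsub>int_group_ring G\<^esub> v) f $ g"
      using g by (simp add: induced_def F_def group_ring_mult_sum[OF fin])
    finally show ?thesis .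
  qed
  moreover have "induced u (induced v f) $ g = induced (u \<otimes>\<^bsub>int_group_ring G\<^esub> v) f $ g" if "g \<notin> carrier G" for g
    using that by (simp add: induced_def)
  ultimately show ?thesis unfolding vec_eq_iff by metis
qed

lemma lin_trace_induced: "lin_trace (induced u) = (\<Sum>h\<in>carrier G. real_of_int (u h) * induced_character h)"
proof -
  have basis: "lin_trace T = (\<Sum>g\<in>UNIV. \<Sum>c\<in>Basis. (T (axis g c) $ g) \<bullet> c)"
    for T :: "complex ^ 'a \<Rightarrow> complex ^ 'a"
  proof -
    have "(Basis :: (complex ^ 'a) set) = (\<lambda>(g, c). axis g c) ` (UNIV \<times> Basis)"
      by (auto simp: Basis_vec_def)
    then have "lin_trace T = (\<Sum>b\<in>(\<lambda>(g, c). axis g c) ` (UNIV \<times> Basis). T b \<bullet> b)"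
      by (simp only: lin_trace_def)
    moreover have "inj_on (\<lambda>(g, c). axis g c :: complex ^ 'a) (UNIV \<times> Basis)"
      by (auto simp: inj_on_def axis_eq_axis nonzero_Basis)
    ultimately have "lin_trace T = (\<Sum>(g, c)\<in>UNIV \<times> Basis. T (axis g c) \<bullet> axis g c)"
      by (simp add: sum.reindex case_prod_unfold)
    then show ?thesis by (simp add: sum.cartesian_product inner_axis)
  qed
  define C where "C = (\<lambda>g h. if inv g \<otimes> h \<otimes> g \<in> D then lin_trace (\<rho> (inv g \<otimes> h \<otimes> g)) else 0)"
  have diag: "(\<Sum>c\<in>Basis. (induced u (axis g c) $ g) \<bullet> c) =
      (1 / real (card D)) * (\<Sum>h\<in>carrier G. real_of_int (u h) * C g h)" if g: "g \<in> carrier G" for g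
  proof -
    \<comment> \<open>A diagonal entry involves only the \<open>d\<close> with
      \<open>inv h \<otimes> g \<otimes> d = g\<close>; this is the source of the conjugates of
      \<open>h\<close> in the character.\<close>
    have pick: "(\<Sum>d\<in>D. \<rho> d (axis g c $ (inv h \<otimes> g \<otimes> d))) =
        (if inv g \<otimes> h \<otimes> g \<in> D then \<rho> (inv g \<otimes> h \<otimes> g) c else 0)" if h: "h \<in> carrier G" for h c
    proof -
      have "inv h \<otimes> g \<otimes> d = g \<longleftrightarrow> d = inv g \<otimes> h \<otimes> g" if "d \<in> D" for d
      proof
        assume "inv h \<otimes> g \<otimes> d = g"
        then have "inv g \<otimes> (h \<otimes> (inv h \<otimes> g \<otimes> d)) = inv g \<otimes> (h \<otimes> g)" by simp
        then show "d = inv g \<otimes> h \<otimes> g" using g h D_carrier[OF that] by (simp add: m_assoc inv_cancel_left)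
      next
        assume "d = inv g \<otimes> h \<otimes> g"
        then show "inv h \<otimes> g \<otimes> d = g" using g h by (simp add: m_assoc inv_cancel_left)
      qed
      then have "(\<Sum>d\<in>D. \<rho> d (axis g c $ (inv h \<otimes> g \<otimes> d))) =
          (\<Sum>d\<in>D. if d = inv g \<otimes> h \<otimes> g then \<rho> d c else 0)"
        by (intro sum.cong refl) (auto simp: axis_def linear_0[OF \<rho>_linear])
      then show ?thesis by simp
    qed
    have "induced u (axis g c) $ g = (1 / real (card D)) *\<^sub>R (\<Sum>h\<in>carrier G. real_of_int (u h) *\<^sub>R
        (if inv g \<otimes> h \<otimes> g \<in> D then \<rho> (inv g \<otimes> h \<otimes> g) c else 0))" for c
    proof -
      have "(\<Sum>d\<in>D. \<Sum>h\<in>carrier G. real_of_int (u h) *\<^sub>R \<rho> d (axis g c $ (inv h \<otimes> g \<otimes> d))) =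
        (\<Sum>h\<in>carrier G. real_of_int (u h) *\<^sub>R (\<Sum>d\<in>D. \<rho> d (axis g c $ (inv h \<otimes> g \<otimes> d))))"
        by (subst sum.swap) (simp add: scaleR_sum_right)
      also have "\<dots> = (\<Sum>h\<in>carrier G. real_of_int (u h) *\<^sub>R
          (if inv g \<otimes> h \<otimes> g \<in> D then \<rho> (inv g \<otimes> h \<otimes> g) c else 0))"
        by (intro sum.cong refl) (simp only: pick)
      finally show ?thesis using g by (simp add: induced_def)
    qed
    then have "(\<Sum>c\<in>Basis. (induced u (axis g c) $ g) \<bullet> c) = (1 / real (card D)) *
        (\<Sum>h\<in>carrier G. real_of_int (u h) *
          (\<Sum>c\<in>Basis. (if inv g \<otimes> h \<otimes> g \<in> D then \<rho> (inv g \<otimes> h \<otimes> g) c else 0) \<bullet> c))"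
      by (simp only: inner_scaleR_left inner_sum_left sum_distrib_left sum.swap[of _ Basis "carrier G"])
    also have "\<dots> = (1 / real (card D)) * (\<Sum>h\<in>carrier G. real_of_int (u h) * C g h)"
      by (intro arg_cong2[where f = "(*)"] refl sum.cong) (auto simp: C_def lin_trace_def)
    finally show ?thesis .
  qed
  have "lin_trace (induced u) = (\<Sum>g\<in>UNIV. if g \<in> carrier G then
      (1 / real (card D)) * (\<Sum>h\<in>carrier G. real_of_int (u h) * C g h) else 0)"
    unfolding basis
  proof (rule sum.cong[OF refl])
    fix g show "(\<Sum>c\<in>Basis. (induced u (axis g c) $ g) \<bullet> c) = (if g \<in> carrier G then
      (1 / real (card D)) * (\<Sum>h\<in>carrier G. real_of_int (u h) * C g h) else 0)"
    proof (cases "g \<in> carrier G")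
      case True
      then show ?thesis using diag by simp
    qed (simp add: induced_def)
  qed
  also have "\<dots> = (\<Sum>g\<in>carrier G. (1 / real (card D)) * (\<Sum>h\<in>carrier G. real_of_int (u h) * C g h))"
    by (simp add: sum.If_cases)
  also have "\<dots> = (\<Sum>h\<in>carrier G. real_of_int (u h) * induced_character h)"
  proof -
    have "induced_character h = (1 / real (card D)) * (\<Sum>g\<in>carrier G. C g h)" for h
      by (simp only: induced_character_def C_def)
    then show ?thesis
      by (simp only: sum_distrib_left) (subst sum.swap, simp add: mult_ac)
  qed
  finally show ?thesis .
qed

lemma induced_character_class_function:
  assumes "a \<in> carrier G" "b \<in> carrier G"
  shows "induced_character (a \<otimes> b) = induced_character (b \<otimes> a)"
proof -
  have "inv (a \<otimes> g) \<otimes> (a \<otimes> b) \<otimes> (a \<otimes> g) = inv g \<otimes> (b \<otimes> a) \<otimes> g" if "g \<in> carrier G" for g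
    using that assms by (simp add: inv_mult_group m_assoc inv_cancel_left)
  moreover define P where "P = (\<lambda>t. if t \<in> D then lin_trace (\<rho> t) else 0)"
  ultimately have "(\<Sum>g\<in>carrier G. P (inv g \<otimes> (a \<otimes> b) \<otimes> g)) = (\<Sum>g\<in>carrier G. P (inv g \<otimes> (b \<otimes> a) \<otimes> g))"
    by (subst sum_translate[OF assms(1)]) (simp cong: sum.cong)
  then show ?thesis by (simp only: induced_character_def P_def)
qed

lemma induced_character_one: "induced_character \<one> = 2 * real (card (carrier G)) / real (card D)"
proof -
  have "lin_trace (\<rho> \<one>) = 2" by (simp add: lin_trace_def \<rho>_one Basis_complex_def)
  moreover have "\<one> \<in> D" by (rule subgroup.one_closed[OF D])
  ultimately show ?thesis unfolding induced_character_def by (simp cong: sum.cong)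
qed

end

section \<open>Class functions evaluated at involutory units\<close>

lemma lin_trace_idempotent_eq_0:
  fixes f :: "'v::euclidean_space \<Rightarrow> 'v"
  assumes "linear f" "\<And>v. f (f v) = f v" "lin_trace f = 0"
  shows "f v = 0"
proof -
  have "dim (range f) = 0" using lin_trace_idempotent[OF assms(1,2)] assms(3) by simp
  then show ?thesis by auto
qed

text \<open>The involution case of a theorem of Berman and Higman. Induction from the trivial
  subgroup gives two copies of the regular representation, where the trace is \<open>2 * n\<close>
  times the coefficient at \<open>\<one>\<close>. The projections \<open>E 1\<close> and
  \<open>E (-1)\<close> have trace at least 0, so this coefficient is between -1 and 1. At either
  end one projection vanishes and \<open>u\<close> is plus or minus the unit, which
  \<open>uu\<close> and \<open>aug\<close> exclude.\<close>

lemma involution_unit_at_one: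
  fixes G :: "('a::finite, 'b) monoid_scheme" (structure)
  assumes "group G" and u: "u \<in> carrier (int_group_ring G)"
    and uu: "u \<otimes>\<^bsub>int_group_ring G\<^esub> u = \<one>\<^bsub>int_group_ring G\<^esub>" "u \<noteq> \<one>\<^bsub>int_group_ring G\<^esub>"
    and aug: "augmentation G u = 1"
  shows "u \<one> = 0"
proof -
  interpret group G by fact
  interpret real_plane_rep G "{\<one>}" "\<lambda>d v. v"
    by unfold_locales (auto simp: triv_subgroup linear_id[unfolded id_def])
  interpret R: ring "int_group_ring G" by (rule ring_int_group_ring[OF fin])
  define n where "n = real (card (carrier G))"
  have n: "n > 0" using one_closed by (auto simp: n_def card_gt_0_iff)
  have chi: "induced_character h = (if h = \<one> then 2 * n else 0)" if h: "h \<in> carrier G" for h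
  proof -
    have "inv g \<otimes> h \<otimes> g = \<one> \<longleftrightarrow> h = \<one>" if g: "g \<in> carrier G" for g
      using g h by (metis inv_closed inv_comm inv_equality l_inv l_one m_assoc m_closed r_cancel_one' r_inv inv_inv)
    then have "induced_character h = (\<Sum>g\<in>carrier G. if h = \<one> then 2 else 0)"
      unfolding induced_character_def by (simp add: lin_trace_def Basis_complex_def cong: sum.cong)
    then show ?thesis by (simp add: n_def)
  qed
  have tr: "lin_trace (induced v) = 2 * n * real_of_int (v \<one>)" for v
  proof -
    have "lin_trace (induced v) = (\<Sum>h\<in>carrier G. if h = \<one> then 2 * n * real_of_int (v h) else 0)"
      unfolding lin_trace_induced by (intro sum.cong refl) (simp add: chi)
    then show ?thesis by simp
  qed
  let ?P = "induced \<one>\<^bsub>int_group_ring G\<^esub>" and ?U = "induced u"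
  have PP: "?P (?P f) = ?P f" and PU: "?P (?U f) = ?U f" and UP: "?U (?P f) = ?U f" and UU: "?U (?U f) = ?P f" for f
    by (simp_all flip: induced_mult add: u uu)
  have lin: "linear ?P" "linear ?U" by (rule linear_induced)+
  define E where "E = (\<lambda>c f. (1/2) *\<^sub>R (?P f + c *\<^sub>R ?U f))"
  have linE: "linear (E c)" for c
    unfolding E_def by (intro linear_compose_add linear_compose_scale_right lin)
  have idem: "E c (E c f) = E c f" if "c = 1 \<or> c = -1" for c f
    using that by (auto simp: E_def vec_eq_iff linear_add[OF lin(1)] linear_add[OF lin(2)] linear_scale[OF lin(1)]
      linear_scale[OF lin(2)] linear_diff[OF lin(1)] linear_diff[OF lin(2)] PP PU UP UU complex_eq_iff field_simps)
  have trE: "lin_trace (E c) = n * (1 + c * real_of_int (u \<one>))" for c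
    unfolding E_def by (simp only: lin_trace_scaleR lin_trace_add tr) (simp add: int_group_ring_simps(3) algebra_simps)
  have pos: "1 + c * real_of_int (u \<one>) \<ge> 0" if "c = 1 \<or> c = -1" for c
  proof -
    have "0 \<le> lin_trace (E c)" using lin_trace_idempotent[OF linE idem[OF that]] by simp
    then show ?thesis using n by (simp add: trE zero_le_mult_iff)
  qed
  \<comment> \<open>The function supported at \<open>\<one>\<close> reads off the coefficients of
    \<open>v\<close>, so that a vanishing projection becomes an equation in the group ring.\<close>
  have delta: "induced v (axis \<one> 1) $ g = complex_of_int (v g)" if g: "g \<in> carrier G" for v g
  proof -
    have "inv h \<otimes> g = \<one> \<longleftrightarrow> h = g" if "h \<in> carrier G" for h
      using g that by (metis inv_closed inv_equality inv_inv l_inv)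
    then have "(\<Sum>h\<in>carrier G. real_of_int (v h) *\<^sub>R (axis \<one> 1 $ (inv h \<otimes> g) :: complex)) =
      (\<Sum>h\<in>carrier G. if h = g then complex_of_int (v g) else 0)"
      by (intro sum.cong refl) (auto simp: axis_def scaleR_conv_of_real)
    then show ?thesis using g by (simp add: induced_def)
  qed
  have no: "1 + c * real_of_int (u \<one>) \<noteq> 0" if c: "c = 1 \<or> c = -1" for c
  proof
    assume "1 + c * real_of_int (u \<one>) = 0"
    then have "E c (axis \<one> 1) = 0" using lin_trace_idempotent_eq_0[OF linE idem[OF c]] by (simp add: trE)
    then have PcU: "?P (axis \<one> 1) + c *\<^sub>R ?U (axis \<one> 1) = 0" by (simp only: E_def scaleR_eq_0_iff) simp
    have eq: "u g = (if c = 1 then -1 else 1) * \<one>\<^bsub>int_group_ring G\<^esub> g" if g: "g \<in> carrier G" for g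
    proof -
      have "(?P (axis \<one> 1) + c *\<^sub>R ?U (axis \<one> 1)) $ g = 0" unfolding PcU by simp
      then have comp: "complex_of_int (\<one>\<^bsub>int_group_ring G\<^esub> g) + c *\<^sub>R complex_of_int (u g) = 0"
        by (simp add: delta[OF g])
      from c show ?thesis
      proof
        assume "c = 1"
        then have "complex_of_int (\<one>\<^bsub>int_group_ring G\<^esub> g + u g) = 0" using comp by simp
        then have "\<one>\<^bsub>int_group_ring G\<^esub> g + u g = 0" by (simp only: of_int_eq_0_iff)
        then show ?thesis using \<open>c = 1\<close> by simp
      next
        assume "c = -1"
        then have "complex_of_int (\<one>\<^bsub>int_group_ring G\<^esub> g - u g) = 0" using comp by simp
        then have "\<one>\<^bsub>int_group_ring G\<^esub> g - u g = 0" by (simp only: of_int_eq_0_iff)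
        then show ?thesis using \<open>c = -1\<close> by simp
      qed
    qed
    show False
    proof (cases "c = 1")
      case True
      then have "augmentation G u = - augmentation G \<one>\<^bsub>int_group_ring G\<^esub>"
        using eq by (simp add: augmentation_def sum_negf)
      then show False using aug by (simp add: augmentation_def int_group_ring_simps(3))
    next
      case False
      have "u = \<one>\<^bsub>int_group_ring G\<^esub>"
      proof
        fix g
        have out: "u g = 0" "\<one>\<^bsub>int_group_ring G\<^esub> g = 0" if "g \<notin> carrier G"
          using that u R.one_closed unfolding int_group_ring_simps(1) by blast+
        show "u g = \<one>\<^bsub>int_group_ring G\<^esub> g"
        proof (cases "g \<in> carrier G")
          case True
          then show ?thesis using eq False by simp
        qed (simp add: out)
      qed
      then show False using uu by simp
    qed
  qed
  have "1 + u \<one> > 0" "1 - u \<one> > 0" using pos[of 1] no[of 1] pos[of "-1"] no[of "-1"] by linarith+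
  then show ?thesis by simp
qed

lemma (in group) ord_mult_commute:
  assumes "a \<in> carrier G" "b \<in> carrier G"
  shows "ord (a \<otimes> b) = ord (b \<otimes> a)"
proof -
  have "(b \<otimes> a) [^] n = \<one> \<longleftrightarrow> (a \<otimes> b) [^] n = \<one>" for n :: nat
  proof -
    have "b \<otimes> c \<otimes> inv b = \<one> \<longleftrightarrow> c = \<one>" if "c \<in> carrier G" for c
    proof
      assume "b \<otimes> c \<otimes> inv b = \<one>"
      then have "inv b \<otimes> (b \<otimes> c \<otimes> inv b) \<otimes> b = \<one>" using assms by simp
      then show "c = \<one>" using assms that by (simp add: m_assoc inv_cancel_left)
    qed (use assms in simp)
    then show ?thesis using assms by (simp only: pow_mult_commute[OF assms] nat_pow_closed m_closed)
  qed
  then show ?thesis using assms by (simp add: ord_unique pow_eq_id)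
qed

text \<open>\<theta> is cut into pieces by the order of the elements, and only order 2 survives.
  There \<theta> is constant by \<open>one_class\<close>, and the same reduction for the constant
  function 1 shows that the coefficients of \<open>u\<close> at involutions sum to the
  augmentation.\<close>

theorem involution_unit_class_function:
  fixes G :: "('a::finite, 'b) monoid_scheme" (structure) and \<theta> :: "'a \<Rightarrow> real"
  assumes "group G" and z: "z \<in> carrier G" "z \<noteq> \<one>" "z \<otimes> z = \<one>"
    and one_class: "\<And>t. \<lbrakk>t \<in> carrier G; t \<noteq> \<one>; t \<otimes> t = \<one>\<rbrakk> \<Longrightarrow> \<exists>g\<in>carrier G. t = g \<otimes> z \<otimes> inv g"
    and u: "u \<in> carrier (int_group_ring G)"
      "u \<otimes>\<^bsub>int_group_ring G\<^esub> u = \<one>\<^bsub>int_group_ring G\<^esub>" "u \<noteq> \<one>\<^bsub>int_group_ring G\<^esub>" "augmentation G u = 1"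
    and \<theta>: "\<And>a b. a \<in> carrier G \<Longrightarrow> b \<in> carrier G \<Longrightarrow> \<theta> (a \<otimes> b) = \<theta> (b \<otimes> a)"
  shows "(\<Sum>g\<in>carrier G. u g * \<theta> g) = \<theta> z"
proof -
  interpret group G by fact
  have fin: "finite (carrier G)" by simp
  note odd_inv = involution_unit_odd_power_invariance[OF fin u(1,2)]
  define two where "two = (\<lambda>g. \<exists>j. ord g = 2 ^ j)"
  have conj_ord: "ord (g \<otimes> a \<otimes> inv g) = ord a" if "g \<in> carrier G" "a \<in> carrier G" for g a
    using ord_mult_commute[of "g \<otimes> a" "inv g"] that by (simp add: inv_cancel_left)
  obtain n m where nm: "Coset.order G = 2 ^ n * m" "odd m"
  proof -
    have "Coset.order G \<noteq> 0" using fin order_gt_0_iff_finite by simp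
    then obtain y where "Coset.order G = 2 ^ multiplicity 2 (Coset.order G) * y" "odd y"
      by (rule multiplicity_decompose'[of "Coset.order G" 2]) auto
    then show thesis by (rule that)
  qed
  \<comment> \<open>Taking for the exponent the odd part \<open>m\<close> of the group order makes
    every \<open>g [^] m\<close> a 2-element.\<close>
  have not_two: "(\<Sum>g\<in>carrier G. u g * (\<theta> g * of_bool (\<not> two g))) = 0"
    if \<theta>: "\<And>a b. a \<in> carrier G \<Longrightarrow> b \<in> carrier G \<Longrightarrow> \<theta> (a \<otimes> b) = \<theta> (b \<otimes> a)" for \<theta> :: "'a \<Rightarrow> real"
  proof -
    have "two (g [^] m)" if "g \<in> carrier G" for g
    proof -
      have "(g [^] m) [^] (2 ^ n :: nat) = \<one>"
        using pow_order_eq_1[OF that] that nm(1) by (simp add: nat_pow_pow mult.commute)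
      then have "ord (g [^] m) dvd 2 ^ n" using that by (simp add: pow_eq_id)
      then show ?thesis by (auto simp: two_def divides_primepow_nat[of 2])
    qed
    then have "(\<Sum>g\<in>carrier G. u g * (\<theta> (g [^] m) * of_bool (\<not> two (g [^] m)))) = 0"
      by (intro sum.neutral) auto
    then show ?thesis
      using odd_inv[of "\<lambda>g. \<theta> g * of_bool (\<not> two g)" m] nm(2) \<theta> ord_mult_commute by (simp add: two_def)
  qed
  have high: "(\<Sum>g\<in>carrier G. u g * (\<theta> g * of_bool (ord g = 2 * s))) = 0" if s: "2 * s = 2 ^ j" "j \<ge> 2"
    and \<theta>: "\<And>a b. a \<in> carrier G \<Longrightarrow> b \<in> carrier G \<Longrightarrow> \<theta> (a \<otimes> b) = \<theta> (b \<otimes> a)" for s j and \<theta> :: "'a \<Rightarrow> real"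
  proof -
    define \<Omega> where "\<Omega> = {g \<in> carrier G. ord g = 2 * s}"
    have se: "even s" "s > 0"
    proof -
      obtain j' where "j = Suc (Suc j')" using s(2) by (metis add_2_eq_Suc le_Suc_ex)
      then have "s = 2 * 2 ^ j'" using s(1) by simp
      then show "even s" "s > 0" by auto
    qed
    have sum\<Omega>: "(\<Sum>g\<in>carrier G. f g * of_bool (ord g = 2 * s)) = (\<Sum>g\<in>\<Omega>. f g)" for f :: "'a \<Rightarrow> real"
      unfolding \<Omega>_def by (simp add: sum.inter_filter[symmetric] of_bool_def if_distrib cong: if_cong)
    have conj_inv: "\<theta> (g \<otimes> a \<otimes> inv g) = \<theta> a" if "g \<in> carrier G" "a \<in> carrier G" for g a
      using \<theta>[of "g \<otimes> a" "inv g"] that by (simp add: inv_cancel_left)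
    define T where "T = (\<Sum>g\<in>\<Omega>. u g * \<theta> g)"
    have pow_class: "\<theta> ((a \<otimes> b) [^] k) = \<theta> ((b \<otimes> a) [^] k)" if "a \<in> carrier G" "b \<in> carrier G" for a b and k :: nat
      using that conj_inv[of b "(a \<otimes> b) [^] k"] by (simp only: pow_mult_commute[OF that] nat_pow_closed m_closed)
    \<comment> \<open>Invariance puts the exponent into \<theta> and into the condition on the
      order. For a 2-element \<open>g [^] k\<close> has the order of \<open>g\<close>; the other
      elements contribute 0 by \<open>not_two\<close>.\<close>
    have powT: "(\<Sum>g\<in>\<Omega>. u g * \<theta> (g [^] k)) = T" if k: "odd k" for k :: nat
    proof -
      have eq: "\<theta> (g [^] k) * of_bool (ord (g [^] k) = 2 * s) =
        \<theta> (g [^] k) * of_bool (ord g = 2 * s) + (\<theta> (g [^] k) * of_bool (ord (g [^] k) = 2 * s)) * of_bool (\<not> two g)"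
        if g: "g \<in> carrier G" for g
      proof (cases "two g")
        case True
        then have "ord (g [^] k) = ord g" using k pow_ord_eq_ord_iff[OF fin g, of k] by (auto simp: two_def)
        then show ?thesis using True by simp
      next
        case False
        then have "ord g \<noteq> 2 * s" using s by (auto simp: two_def)
        then show ?thesis using False by simp
      qed
      have "T = (\<Sum>g\<in>carrier G. u g * (\<theta> g * of_bool (ord g = 2 * s)))"
        unfolding T_def sum\<Omega>[symmetric] by (simp add: mult.assoc)
      also have "\<dots> = (\<Sum>g\<in>carrier G. u g * (\<theta> (g [^] k) * of_bool (ord (g [^] k) = 2 * s)))"
        using odd_inv[of "\<lambda>g. \<theta> g * of_bool (ord g = 2 * s)" k] k \<theta> ord_mult_commute by simp
      also have "\<dots> = (\<Sum>g\<in>carrier G. u g * (\<theta> (g [^] k) * of_bool (ord g = 2 * s))) +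
          (\<Sum>g\<in>carrier G. u g * ((\<theta> (g [^] k) * of_bool (ord (g [^] k) = 2 * s)) * of_bool (\<not> two g)))"
        by (subst sum.distrib[symmetric], rule sum.cong[OF refl]) (subst eq, simp_all add: distrib_left)
      also have "(\<Sum>g\<in>carrier G. u g * ((\<theta> (g [^] k) * of_bool (ord (g [^] k) = 2 * s)) * of_bool (\<not> two g))) = 0"
      proof (rule not_two)
        fix a b assume ab: "a \<in> carrier G" "b \<in> carrier G"
        have "ord ((a \<otimes> b) [^] k) = ord ((b \<otimes> a) [^] k)"
          using ab ord_pow_gen[of "a \<otimes> b" k] ord_pow_gen[of "b \<otimes> a" k] ord_mult_commute[OF ab] by simp
        then show "\<theta> ((a \<otimes> b) [^] k) * of_bool (ord ((a \<otimes> b) [^] k) = 2 * s) =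
          \<theta> ((b \<otimes> a) [^] k) * of_bool (ord ((b \<otimes> a) [^] k) = 2 * s)" using pow_class[OF ab] by simp
      qed
      also have "(\<Sum>g\<in>carrier G. u g * (\<theta> (g [^] k) * of_bool (ord g = 2 * s))) = (\<Sum>g\<in>\<Omega>. u g * \<theta> (g [^] k))"
        using sum\<Omega>[of "\<lambda>g. u g * \<theta> (g [^] k)"] by (simp add: mult.assoc)
      finally show ?thesis by simp
    qed
    \<comment> \<open>Substitute \<open>y = a \<otimes> x [^] (2 * i + 1) \<otimes> inv a\<close>.
      With \<open>l\<close> inverse to the exponent modulo \<open>2 * s\<close>,
      \<open>\<theta> x\<close> becomes \<open>\<theta> (y [^] l)\<close>, and \<open>powT\<close>
      removes the exponent \<open>l\<close>.\<close>
    have orbit: "(\<Sum>x\<in>\<Omega>. \<theta> x * u (a \<otimes> x [^] (2 * i + 1) \<otimes> inv a)) = T" if a: "a \<in> carrier G" for a and i :: nat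
    proof -
      let ?k = "2 * i + 1 :: nat"
      have "coprime ?k (2 * s)" unfolding s(1) by simp
      then obtain l where l: "[?k * l = 1] (mod (2 * s))" using cong_solve_coprime_nat[of ?k "2 * s"] unfolding One_nat_def by blast
      have "odd l"
      proof
        assume "even l"
        then have "[?k * l = 0] (mod 2)" by (simp add: cong_def)
        moreover have "[?k * l = 1] (mod 2)" using l by (rule cong_modulus_mult_nat)
        ultimately show False by (simp add: cong_def)
      qed
      have pow_l: "(x [^] ?k) [^] l = x \<and> (x [^] l) [^] ?k = x" if "x \<in> \<Omega>" for x
      proof -
        have x: "x \<in> carrier G" "ord x = 2 * s" using that by (auto simp: \<Omega>_def)
        have "int (2 * s) dvd int 1 - int (?k * l)"
          using l by (metis cong_int_iff cong_iff_dvd_diff cong_sym)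
        then have "x [^] int (?k * l) = x [^] int 1" by (simp only: int_pow_eq[OF x(1)] x(2))
        then have "x [^] (?k * l) = x" using x(1) by (simp only: int_pow_int nat_pow_eone)
        then show ?thesis using x(1) by (simp only: nat_pow_pow mult.commute[of l])
      qed
      have inO: "x [^] k \<in> \<Omega>" if "x \<in> \<Omega>" "odd k" for x and k :: nat
      proof -
        have x: "x \<in> carrier G" "ord x = 2 * s" using that by (auto simp: \<Omega>_def)
        have "coprime k (ord x)" unfolding x(2) s(1) using that(2) by simp
        then show ?thesis using pow_ord_eq_ord_iff[OF fin x(1), of k] x by (simp add: \<Omega>_def)
      qed
      have conjO: "g \<otimes> x \<otimes> inv g \<in> \<Omega>" if "x \<in> \<Omega>" "g \<in> carrier G" for x g
        using that conj_ord by (simp add: \<Omega>_def)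
      have \<Omega>c: "x \<in> carrier G" if "x \<in> \<Omega>" for x using that by (simp add: \<Omega>_def)
      have "(\<Sum>x\<in>\<Omega>. \<theta> x * u (a \<otimes> x [^] ?k \<otimes> inv a)) = (\<Sum>y\<in>\<Omega>. u y * \<theta> (y [^] l))"
      proof (rule sum.reindex_bij_witness[where i = "\<lambda>y. inv a \<otimes> y [^] l \<otimes> a" and j = "\<lambda>x. a \<otimes> x [^] ?k \<otimes> inv a"])
        fix x assume x: "x \<in> \<Omega>"
        have xc: "x \<in> carrier G" using \<Omega>c x .
        have 1: "(a \<otimes> x [^] ?k \<otimes> inv a) [^] l = a \<otimes> x \<otimes> inv a"
          using conj_nat_pow[of a "x [^] ?k" l] a xc pow_l[OF x] by (simp only: nat_pow_closed)
        show "inv a \<otimes> (a \<otimes> x [^] ?k \<otimes> inv a) [^] l \<otimes> a = x"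
          unfolding 1 using a xc by (simp add: m_assoc inv_cancel_left)
        show "a \<otimes> x [^] ?k \<otimes> inv a \<in> \<Omega>" by (rule conjO[OF inO[OF x] a]) simp
        show "u (a \<otimes> x [^] ?k \<otimes> inv a) * \<theta> ((a \<otimes> x [^] ?k \<otimes> inv a) [^] l) = \<theta> x * u (a \<otimes> x [^] ?k \<otimes> inv a)"
          unfolding 1 using conj_inv[OF a xc] by simp
      next
        fix y assume y: "y \<in> \<Omega>"
        have yc: "y \<in> carrier G" using \<Omega>c y .
        show "inv a \<otimes> y [^] l \<otimes> a \<in> \<Omega>"
          using conjO[OF inO[OF y \<open>odd l\<close>], of "inv a"] a by simp
        have "(inv a \<otimes> y [^] l \<otimes> a) [^] ?k = inv a \<otimes> y \<otimes> a"
          using conj_nat_pow[of "inv a" "y [^] l" ?k] a yc pow_l[OF y] by (simp only: nat_pow_closed inv_closed inv_inv)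
        then show "a \<otimes> (inv a \<otimes> y [^] l \<otimes> a) [^] ?k \<otimes> inv a = y"
          using a yc by (simp add: m_assoc inv_cancel_left del: nat_pow_Suc)
      qed
      also have "\<dots> = T" by (rule powT[OF \<open>odd l\<close>])
      finally show ?thesis .
    qed
    \<comment> \<open>One triple sum evaluated in two orders: for fixed \<open>x\<close> it vanishes
      by the sum over generators, for fixed \<open>a\<close> and \<open>i\<close> it is
      \<open>T\<close>.\<close>
    have "0 = (\<Sum>x\<in>\<Omega>. \<theta> x * real_of_int (\<Sum>a\<in>carrier G. \<Sum>i<s. u (a \<otimes> x [^] (2 * i + 1) \<otimes> inv a)))"
    proof (rule sum.neutral[symmetric], intro ballI)
      fix x assume "x \<in> \<Omega>"
      then have x: "x \<in> carrier G" "ord x = 2 * s" by (auto simp: \<Omega>_def)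
      show "\<theta> x * real_of_int (\<Sum>a\<in>carrier G. \<Sum>i<s. u (a \<otimes> x [^] (2 * i + 1) \<otimes> inv a)) = 0"
        using involution_unit_generator_sum[OF group_axioms u(2) x se] by (simp only: of_int_0 mult_zero_right)
    qed
    also have "\<dots> = (\<Sum>a\<in>carrier G. \<Sum>i<s. \<Sum>x\<in>\<Omega>. \<theta> x * u (a \<otimes> x [^] (2 * i + 1) \<otimes> inv a))"
      by (simp only: of_int_sum sum_distrib_left sum.swap[of _ _ \<Omega>])
    also have "\<dots> = (\<Sum>a\<in>carrier G. \<Sum>i<s. T)" by (intro sum.cong refl orbit)
    also have "\<dots> = real (card (carrier G)) * (real s * T)" by simp
    finally have "T = 0" using se(2) fin one_closed by auto
    then show ?thesis unfolding T_def sum\<Omega>[symmetric] by (simp add: mult.assoc)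
  qed
  have reduce: "(\<Sum>g\<in>carrier G. u g * \<theta> g) = (\<Sum>g\<in>{g \<in> carrier G. ord g = 2}. u g * \<theta> g)"
    if \<theta>: "\<And>a b. a \<in> carrier G \<Longrightarrow> b \<in> carrier G \<Longrightarrow> \<theta> (a \<otimes> b) = \<theta> (b \<otimes> a)" for \<theta> :: "'a \<Rightarrow> real"
  proof -
    let ?f = "\<lambda>g. u g * \<theta> g"
    have "(\<Sum>g\<in>carrier G. ?f g) = (\<Sum>g\<in>carrier G. ?f g * of_bool (two g)) + (\<Sum>g\<in>carrier G. u g * (\<theta> g * of_bool (\<not> two g)))"
      unfolding sum.distrib[symmetric] by (intro sum.cong refl) auto
    also have "\<dots> = (\<Sum>g\<in>carrier G. ?f g * of_bool (two g))" using not_two[of \<theta>, OF \<theta>] by simp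
    also have "\<dots> = (\<Sum>g\<in>{g \<in> carrier G. two g}. ?f g)"
      by (simp add: sum.inter_filter[symmetric] of_bool_def if_distrib cong: if_cong)
    also have "\<dots> = (\<Sum>d\<in>ord ` {g \<in> carrier G. two g} \<union> {2}. \<Sum>g\<in>{g \<in> {g \<in> carrier G. two g}. ord g = d}. ?f g)"
      by (rule sum.group[symmetric]) auto
    also have "\<dots> = (\<Sum>d\<in>{2}. \<Sum>g\<in>{g \<in> {g \<in> carrier G. two g}. ord g = d}. ?f g)"
    proof (rule sum.mono_neutral_right)
      show "\<forall>d\<in>(ord ` {g \<in> carrier G. two g} \<union> {2}) - {2}. (\<Sum>g\<in>{g \<in> {g \<in> carrier G. two g}. ord g = d}. ?f g) = 0"
      proof
        fix d assume d: "d \<in> (ord ` {g \<in> carrier G. two g} \<union> {2}) - {2}"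
        then obtain j where j: "d = 2 ^ j" "d \<noteq> 2" by (auto simp: two_def)
        have set: "{g \<in> {g \<in> carrier G. two g}. ord g = d} = {g \<in> carrier G. ord g = d}" using j by (auto simp: two_def)
        show "(\<Sum>g\<in>{g \<in> {g \<in> carrier G. two g}. ord g = d}. ?f g) = 0"
        proof (cases "j = 0")
          case True
          then have "{g \<in> carrier G. ord g = d} = {\<one>}" using j ord_eq_1 by auto
          then show ?thesis unfolding set using involution_unit_at_one[OF group_axioms u] by simp
        next
          case False
          then have "j \<ge> 2" using j by (cases j; cases "j - 1") auto
          moreover have "2 * 2 ^ (j - 1) = (2 :: nat) ^ j" using False by (cases j) auto
          ultimately have "(\<Sum>g\<in>carrier G. u g * (\<theta> g * of_bool (ord g = 2 * 2 ^ (j - 1)))) = 0" by (intro high \<theta>) auto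
          also have "(\<Sum>g\<in>carrier G. u g * (\<theta> g * of_bool (ord g = 2 * 2 ^ (j - 1)))) = (\<Sum>g\<in>{g \<in> carrier G. ord g = d}. ?f g)"
            unfolding \<open>2 * 2 ^ (j - 1) = 2 ^ j\<close> j(1)
            by (simp add: sum.inter_filter[symmetric] of_bool_def if_distrib mult.assoc cong: if_cong)
          finally show ?thesis unfolding set .
        qed
      qed
    qed auto
    also have "\<dots> = (\<Sum>g\<in>{g \<in> carrier G. ord g = 2}. ?f g)"
    proof -
      have "{g \<in> {g \<in> carrier G. two g}. ord g = 2} = {g \<in> carrier G. ord g = 2}"
        by (auto simp: two_def intro: exI[of _ 1])
      then show ?thesis by (simp only: sum.insert finite.emptyI empty_iff sum.empty not_False_eq_True add_0_right)
    qed
    finally show ?thesis .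
  qed
  have invol: "t \<noteq> \<one> \<and> t \<otimes> t = \<one>" if "t \<in> carrier G" "ord t = 2" for t
  proof -
    have "t [^] (2::nat) = \<one>" using that pow_ord_eq_1 by metis
    moreover have "t \<noteq> \<one>" using that ord_eq_1 by auto
    ultimately show ?thesis using that by (simp add: numeral_2_eq_2)
  qed
  have const: "\<theta> t = \<theta> z" if t: "t \<in> carrier G" "ord t = 2" for t
  proof -
    obtain g where g: "g \<in> carrier G" "t = g \<otimes> z \<otimes> inv g" using one_class[of t] invol[OF t] t by blast
    then show ?thesis using \<theta>[of "g \<otimes> z" "inv g"] z by (simp add: inv_cancel_left)
  qed
  have "(\<Sum>g\<in>carrier G. u g * \<theta> g) = (\<Sum>g\<in>{g \<in> carrier G. ord g = 2}. u g * \<theta> g)"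
    by (rule reduce) (rule \<theta>)
  also have "\<dots> = (\<Sum>g\<in>{g \<in> carrier G. ord g = 2}. u g * \<theta> z)"
    by (intro sum.cong refl) (simp add: const)
  also have "\<dots> = (\<Sum>g\<in>{g \<in> carrier G. ord g = 2}. u g * 1) * \<theta> z" by (simp add: sum_distrib_right)
  also have "(\<Sum>g\<in>{g \<in> carrier G. ord g = 2}. u g * 1) = (1 :: real)"
    using reduce[of "\<lambda>_. 1"] u(4) by (simp add: augmentation_def flip: of_int_sum)
  finally show ?thesis by simp
qed

section \<open>The trace condition on a 2-group\<close>

text \<open>\<open>R \<one>\<close> may be a proper projection, so \<open>d\<close> is the dimension
  of its image. The -1 eigenspace of an involution has dimension \<open>(d - c) / 2\<close>, and
  \<open>d_c\<close> says that this is 2 modulo 4.\<close>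

locale involution_trace_rep = group H for H :: "('x, 'y) monoid_scheme" (structure) +
  fixes R :: "'x \<Rightarrow> 'v::euclidean_space \<Rightarrow> 'v" and d c :: int
  assumes R_linear: "\<And>h. linear (R h)"
    and R_mult: "\<And>g h v. g \<in> carrier H \<Longrightarrow> h \<in> carrier H \<Longrightarrow> R g (R h v) = R (g \<otimes> h) v"
    and trace_one: "lin_trace (R \<one>) = d"
    and trace_involution: "\<And>t. t \<in> carrier H \<Longrightarrow> t \<noteq> \<one> \<Longrightarrow> t \<otimes> t = \<one> \<Longrightarrow> lin_trace (R t) = c"
    and d_c: "(d - c) mod 8 = 4"
begin

text \<open>For \<open>t \<otimes> t = \<one>\<close> and a sign \<open>s\<close>: the projection
  onto the \<open>s\<close> eigenspace of \<open>R t\<close> within the image of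
  \<open>R \<one>\<close>.\<close>

definition half :: "real \<Rightarrow> 'x \<Rightarrow> 'v \<Rightarrow> 'v" where
  "half s t v = (1/2) *\<^sub>R (R \<one> v + s *\<^sub>R R t v)"

lemma R_algebra:
  "R h (v + w) = R h v + R h w" "R h (v - w) = R h v - R h w" "R h (- v) = - R h v" "R h (r *\<^sub>R v) = r *\<^sub>R R h v"
  using R_linear[of h] by (simp_all add: linear_add linear_diff linear_neg linear_scale)

lemma linear_half: "linear (half s t)"
  unfolding half_def by (intro linear_compose_add linear_compose_scale_right R_linear)

lemma half_commute:
  assumes "t \<in> carrier H" "t' \<in> carrier H" "t \<otimes> t' = t' \<otimes> t"
  shows "half s t (half s' t' v) = half s' t' (half s t v)"
  using assms by (simp add: half_def R_algebra R_mult algebra_simps)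

lemma R_half_commute:
  assumes "g \<in> carrier H" "t \<in> carrier H" "g \<otimes> t = t \<otimes> g"
  shows "R g (half s t v) = half s t (R g v)"
  using assms by (simp add: half_def R_algebra R_mult)

lemma half_idem:
  assumes "t \<in> carrier H" "t \<otimes> t = \<one>" "s = 1 \<or> s = -1"
  shows "half s t (half s t v) = half s t v"
proof -
  have "half s t (half s t v) = (1/4) *\<^sub>R ((R \<one> v + R \<one> v) + s *\<^sub>R (R t v + R t v))"
    using assms by (auto simp: half_def R_algebra R_mult algebra_simps)
  also have "\<dots> = half s t v"
    unfolding half_def scaleR_2[symmetric] scaleR_add_right scaleR_scaleR by (simp add: mult.commute)
  finally show ?thesis .
qed

lemma R_half_minus:
  assumes "t \<in> carrier H" "t \<otimes> t = \<one>"
  shows "R t (half (-1) t v) = - half (-1) t v"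
  using assms by (simp add: half_def R_algebra R_mult algebra_simps)

lemma trace_half_minus:
  assumes "t \<in> carrier H" "t \<noteq> \<one>" "t \<otimes> t = \<one>"
  shows "2 * lin_trace (half (-1) t) = d - c"
  unfolding half_def lin_trace_scaleR lin_trace_add using assms by (simp add: trace_one trace_involution)

text \<open>The three involutions of the four-group have equal trace, so the sum of traces is
  \<open>d + c - c - c\<close>.\<close>

lemma trace_half_half:
  assumes a: "a \<in> carrier H" "a \<noteq> \<one>" "a \<otimes> a = \<one>" and b: "b \<in> carrier H" "b \<noteq> \<one>" "b \<otimes> b = \<one>"
    and ab: "a \<otimes> b = b \<otimes> a" "b \<noteq> a"
  shows "4 * lin_trace (\<lambda>v. half (-1) a (half 1 b v)) = d - c"
proof -
  have "a \<otimes> b \<noteq> \<one>" using a b ab by (metis inv_equality inv_unique)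
  moreover have "(a \<otimes> b) \<otimes> (a \<otimes> b) = \<one>"
    using a b pow_mult_distrib[OF ab(1) a(1) b(1), of 2] by (simp add: numeral_2_eq_2)
  ultimately have tr: "lin_trace (R (a \<otimes> b)) = c" using a b by (intro trace_involution) auto
  have tr_ab: "lin_trace (R a) = c" "lin_trace (R b) = c" using a b by (simp_all add: trace_involution)
  have "(\<lambda>v. half (-1) a (half 1 b v)) =
    (\<lambda>v. (1/4) *\<^sub>R (R \<one> v + R b v - R a v - R (a \<otimes> b) v))"
    using a b by (simp add: half_def R_algebra R_mult algebra_simps fun_eq_iff)
  then have "lin_trace (\<lambda>v. half (-1) a (half 1 b v)) =
      (1/4) * (real_of_int d + real_of_int c - real_of_int c - real_of_int c)"
    using tr_ab by (simp only: lin_trace_scaleR lin_trace_add lin_trace_diff trace_one tr)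
  then show ?thesis by simp
qed

text \<open>The joint eigenspace for the signs -1, 1, 1 would have dimension
  \<open>(d - c) / 8\<close>: of the seven involutions three enter with plus and four with minus.
  This is not an integer.\<close>

lemma no_elementary_abelian_8:
  assumes a: "a \<in> carrier H" "a \<otimes> a = \<one>" "a \<noteq> \<one>" and b: "b \<in> carrier H" "b \<otimes> b = \<one>" "b \<noteq> \<one>" "b \<noteq> a"
    and e: "e \<in> carrier H" "e \<otimes> e = \<one>" and comm: "a \<otimes> b = b \<otimes> a" "a \<otimes> e = e \<otimes> a" "b \<otimes> e = e \<otimes> b"
  shows "e \<in> {\<one>, a, b, a \<otimes> b}"
proof (rule ccontr)
  assume ne: "e \<notin> {\<one>, a, b, a \<otimes> b}"
  have inv: "inv a = a" "inv b = b" using a b by (simp_all add: inv_equality)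
  have prod_invol: "(g \<otimes> h) \<otimes> (g \<otimes> h) = \<one>"
    if "g \<in> carrier H" "h \<in> carrier H" "g \<otimes> g = \<one>" "h \<otimes> h = \<one>" "g \<otimes> h = h \<otimes> g" for g h
    using that pow_mult_distrib[of g h 2] by (simp add: numeral_2_eq_2)
  have ne1: "g \<otimes> h \<noteq> \<one>" if "g \<in> carrier H" "h \<in> carrier H" "g \<otimes> g = \<one>" "g \<noteq> h" for g h
    using that by (metis inv_equality inv_inv)
  have ae: "a \<otimes> b \<in> carrier H" "(a \<otimes> b) \<otimes> (a \<otimes> b) = \<one>" "a \<otimes> b \<noteq> \<one>" "a \<otimes> b \<otimes> e = e \<otimes> (a \<otimes> b)"
    using a b e comm prod_invol ne1[of a b] by (auto simp: m_assoc) (simp flip: m_assoc)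
  have tr: "lin_trace (R (a \<otimes> b)) = c" "lin_trace (R (a \<otimes> e)) = c" "lin_trace (R (b \<otimes> e)) = c"
    "lin_trace (R (a \<otimes> b \<otimes> e)) = c" "lin_trace (R a) = c" "lin_trace (R b) = c" "lin_trace (R e) = c"
    using a b e ne comm ae prod_invol ne1[of a e] ne1[of b e] ne1[of "a \<otimes> b" e]
    by (auto intro!: trace_involution simp del: m_assoc)
  define f where "f = (\<lambda>v. half (-1) a (half 1 b (half 1 e v)))"
  have lin: "linear f" unfolding f_def
    using linear_compose[OF linear_compose[OF linear_half linear_half] linear_half] by (simp add: comp_def)
  have idem: "f (f v) = f v" for v
    using a b e comm half_idem
    by (simp add: f_def half_commute[of e a] half_commute[of e b] half_commute[of b a])
  have f: "f = (\<lambda>v. (1/8) *\<^sub>R (R \<one> v + R b v + R e v + R (b \<otimes> e) v - R a v - R (a \<otimes> b) v - R (a \<otimes> e) v - R (a \<otimes> b \<otimes> e) v))"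
    using a b e by (simp add: f_def half_def R_algebra R_mult m_assoc algebra_simps fun_eq_iff)
  have "lin_trace f = (1/8) * (real_of_int d + real_of_int c + real_of_int c + real_of_int c - real_of_int c - real_of_int c - real_of_int c - real_of_int c)"
    by (simp only: f lin_trace_scaleR lin_trace_add lin_trace_diff trace_one tr)
  then have "8 * real (dim (range f)) = d - c" using lin_trace_idempotent[OF lin idem] by simp
  then have "8 * int (dim (range f)) = d - c" by linarith
  then show False using d_c by (metis mod_mult_self1_is_0 zero_neq_numeral)
qed

text \<open>Where \<open>y \<otimes> y\<close> acts as -1 and \<open>t\<close> as 1,
  \<open>y\<close> is a complex structure, but the dimension \<open>(d - c) / 4\<close> is
  odd.\<close>

lemma no_cyclic_4_times_2:
  assumes y: "y \<in> carrier H" "y \<otimes> y \<noteq> \<one>" "(y \<otimes> y) \<otimes> (y \<otimes> y) = \<one>"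
    and t: "t \<in> carrier H" "t \<otimes> y = y \<otimes> t" "t \<otimes> t = \<one>" "t \<noteq> \<one>"
  shows "t = y \<otimes> y"
proof (rule ccontr)
  assume ne: "t \<noteq> y \<otimes> y"
  have yy: "y \<otimes> y \<in> carrier H" using y by simp
  have yt: "(y \<otimes> y) \<otimes> t = t \<otimes> (y \<otimes> y)" using y(1) t(1,2) by (metis m_assoc)
  define f where "f = (\<lambda>v. half (-1) (y \<otimes> y) (half 1 t v))"
  have lin: "linear f" unfolding f_def using linear_compose[OF linear_half linear_half] by (simp add: comp_def)
  have idem: "f (f v) = f v" for v
    using y t yt half_idem by (simp add: f_def half_commute[of t "y \<otimes> y"])
  have "4 * real (dim (range f)) = d - c"
    using trace_half_half[OF yy y(2,3) t(1,4,3) yt ne] lin_trace_idempotent[OF lin idem] by (simp add: f_def)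
  then have "4 * int (dim (range f)) = d - c" by linarith
  moreover have "even (dim (range f))"
  proof (rule complex_structure_even_dim[OF R_linear[of y]])
    show "subspace (range f)" by (intro linear_subspace_image lin subspace_UNIV)
    fix v assume "v \<in> range f"
    then obtain w where w: "v = f w" by blast
    have "R y (f w) = f (R y w)"
      using y t by (simp add: f_def R_half_commute m_assoc)
    then show "R y v \<in> range f" using w by simp
    show "R y (R y v) = - v" using y R_half_minus[OF yy y(3)] by (simp add: w f_def R_mult)
  qed
  then obtain b where "dim (range f) = 2 * b" by blast
  ultimately have "d - c = 8 * int b" by simp
  then show False using d_c by simp
qed

text \<open>\<open>y\<close> and \<open>v\<close> would give a quaternionic structure on the -1
  eigenspace of their common square, whose dimension \<open>(d - c) / 2\<close> is not divisible by
  4.\<close>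

lemma no_quaternion:
  assumes y: "y \<in> carrier H" "y \<otimes> y \<noteq> \<one>" "(y \<otimes> y) \<otimes> (y \<otimes> y) = \<one>"
    and v: "v \<in> carrier H" "v \<otimes> y = inv y \<otimes> v"
  shows "v \<otimes> v \<noteq> y \<otimes> y"
proof
  assume vv: "v \<otimes> v = y \<otimes> y"
  let ?z = "y \<otimes> y"
  have z: "?z \<in> carrier H" using y by simp
  have zy: "y \<otimes> ?z = ?z \<otimes> y" using y by (simp add: m_assoc)
  have zv: "v \<otimes> ?z = ?z \<otimes> v" using v by (simp add: vv[symmetric] m_assoc)
  have inv_y: "inv y = ?z \<otimes> y" using y by (intro inv_equality) (simp_all add: m_assoc)
  define f where "f = half (-1) ?z"
  have lin: "linear f" unfolding f_def by (rule linear_half)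
  have idem: "f (f w) = f w" for w unfolding f_def using z y by (intro half_idem) auto
  have neg: "R ?z w = - w" if "w \<in> range f" for w
    using that R_half_minus[OF z y(3)] by (auto simp: f_def)
  have "2 * real (dim (range f)) = d - c"
    using trace_half_minus[OF z y(2,3)] lin_trace_idempotent[OF lin idem] by (simp add: f_def)
  then have "2 * int (dim (range f)) = d - c" by linarith
  moreover have "4 dvd dim (range f)"
  proof (rule quaternionic_structure_dim[OF R_linear[of y] R_linear[of v]])
    show "subspace (range f)" by (intro linear_subspace_image lin subspace_UNIV)
    fix w assume w: "w \<in> range f"
    then obtain x where x: "w = f x" by blast
    show y_in: "R y w \<in> range f" and v_in: "R v w \<in> range f"
      using y v z zy zv by (auto simp: x f_def R_half_commute)
    show "R y (R y w) = - w" using neg[OF w] y by (simp add: R_mult)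
    show "R v (R v w) = - w" using neg[OF w] v by (simp add: R_mult vv)
    have "R v (R y w) = R (inv y \<otimes> v) w" using v y by (simp add: R_mult v(2))
    also have "\<dots> = R ?z (R y (R v w))" using v y by (simp add: inv_y R_mult m_assoc)
    also have "R y (R v w) \<in> range f \<Longrightarrow> R ?z (R y (R v w)) = - R y (R v w)" by (rule neg)
    finally show "R v (R y w) = - R y (R v w)"
      using v_in y z zy by (auto simp: f_def R_half_commute)
  qed
  ultimately have "8 dvd d - c" by presburger
  then show False using d_c by auto
qed

theorem two_group_with_trace_condition:
  assumes "Coset.order H = 2 ^ k"
  shows "cyclic_group H \<or> is_dihedral H"
  using assms
proof (rule two_group_cyclic_or_dihedral)
  show "\<lbrakk>a \<in> carrier H; b \<in> carrier H; e \<in> carrier H; a \<otimes> a = \<one>; b \<otimes> b = \<one>; e \<otimes> e = \<one>;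
      a \<otimes> b = b \<otimes> a; a \<otimes> e = e \<otimes> a; b \<otimes> e = e \<otimes> b; a \<noteq> \<one>; b \<noteq> \<one>; b \<noteq> a\<rbrakk> \<Longrightarrow> e \<in> {\<one>, a, b, a \<otimes> b}" for a b e
    by (rule no_elementary_abelian_8)
  show "\<lbrakk>y \<in> carrier H; t \<in> carrier H; y \<otimes> y \<noteq> \<one>; (y \<otimes> y) \<otimes> (y \<otimes> y) = \<one>;
      t \<otimes> y = y \<otimes> t; t \<otimes> t = \<one>; t \<noteq> \<one>\<rbrakk> \<Longrightarrow> t = y \<otimes> y" for y t
    by (rule no_cyclic_4_times_2)
  show "\<lbrakk>y \<in> carrier H; v \<in> carrier H; y \<otimes> y \<noteq> \<one>; (y \<otimes> y) \<otimes> (y \<otimes> y) = \<one>;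
      v \<otimes> y = inv y \<otimes> v\<rbrakk> \<Longrightarrow> v \<otimes> v \<noteq> y \<otimes> y" for y v
    by (rule no_quaternion)
qed

end

section \<open>Extension of characters\<close>

text \<open>The least \<open>k > 0\<close> with \<open>a [^] k\<close> in \<open>B\<close> divides
  every exponent with this property. Therefore any \<open>k\<close>-th root \<zeta> of
  \<open>\<alpha> (a [^] k)\<close> makes \<open>\<alpha> b * \<zeta> ^ i\<close> a function of
  \<open>b \<otimes> a [^] i\<close>.\<close>

lemma (in comm_group) character_extension_step:
  fixes \<alpha> :: "'a \<Rightarrow> complex"
  assumes fin: "finite (carrier G)" and B: "subgroup B G" and a: "a \<in> carrier G"
    and mult: "\<And>x y. x \<in> B \<Longrightarrow> y \<in> B \<Longrightarrow> \<alpha> (x \<otimes> y) = \<alpha> x * \<alpha> y"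
    and norm: "\<And>x. x \<in> B \<Longrightarrow> norm (\<alpha> x) = 1"
  obtains B' \<beta> where "subgroup B' G" "B \<subseteq> B'" "a \<in> B'"
    "\<And>x y. x \<in> B' \<Longrightarrow> y \<in> B' \<Longrightarrow> \<beta> (x \<otimes> y) = \<beta> x * \<beta> y"
    "\<And>x. x \<in> B' \<Longrightarrow> norm (\<beta> x) = (1 :: real)" "\<And>x. x \<in> B \<Longrightarrow> \<beta> x = (\<alpha> x :: complex)"
proof -
  have Bc: "b \<in> carrier G" if "b \<in> B" for b by (rule subgroup.mem_carrier[OF B that])
  have oneB: "\<one> \<in> B" by (rule subgroup.one_closed[OF B])
  have mB: "x \<otimes> y \<in> B" if "x \<in> B" "y \<in> B" for x y by (rule subgroup.m_closed[OF B that])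
  have iB: "inv x \<in> B" if "x \<in> B" for x by (rule subgroup.m_inv_closed[OF B that])
  have pB: "x [^] n \<in> B" if "x \<in> B" for x and n :: nat
    by (induction n) (use that oneB mB in auto)
  have \<alpha>1: "\<alpha> \<one> = 1" using mult[OF oneB oneB] norm[OF oneB] by auto
  have \<alpha>pow: "\<alpha> (x [^] n) = \<alpha> x ^ n" if "x \<in> B" for x and n :: nat
    by (induction n) (use that pB mult \<alpha>1 in auto)
  define k :: nat where "k = (LEAST k. k > 0 \<and> a [^] k \<in> B)"
  define N where "N = card (carrier G)"
  have N: "N > 0" "a [^] N = \<one>"
    using fin one_closed pow_order_eq_1[OF a] by (auto simp: N_def card_gt_0_iff Coset.order_def)
  have k: "k > 0" "a [^] k \<in> B"
    using LeastI[of "\<lambda>k. k > 0 \<and> a [^] k \<in> B" N] N oneB by (auto simp: k_def)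
  have k_dvd: "k dvd n" if n: "a [^] n \<in> B" for n :: nat
  proof (rule ccontr)
    assume "\<not> k dvd n"
    then have r: "n mod k > 0" "n mod k < k" using k by (auto simp: mod_greater_zero_iff_not_dvd)
    have "a [^] n = a [^] (k * (n div k)) \<otimes> a [^] (n mod k)" using a by (simp add: nat_pow_mult)
    also have "a [^] (k * (n div k)) = (a [^] k) [^] (n div k)" using a by (simp add: nat_pow_pow)
    finally have "a [^] (n mod k) = inv ((a [^] k) [^] (n div k)) \<otimes> a [^] n" using a by (simp add: inv_cancel_left)
    then have "a [^] (n mod k) \<in> B" using mB iB pB k n by simp
    then show False using not_less_Least[of "n mod k" "\<lambda>k. k > 0 \<and> a [^] k \<in> B"] r by (simp add: k_def)
  qed
  obtain \<zeta> where \<zeta>: "\<alpha> (a [^] k) = \<zeta> ^ k" using exists_complex_root[of k "\<alpha> (a [^] k)"] k by auto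
  have "norm \<zeta> ^ k = 1" using norm[OF k(2)] by (simp add: \<zeta> flip: norm_power)
  then have norm\<zeta>: "norm \<zeta> = 1" using power_eq_imp_eq_base[of "norm \<zeta>" k 1] k(1) by simp
  have \<zeta>_pow: "\<alpha> (a [^] n) = \<zeta> ^ n" if "a [^] n \<in> B" for n :: nat
  proof -
    obtain q where q: "n = k * q" using k_dvd[OF \<open>a [^] n \<in> B\<close>] by blast
    have "\<alpha> (a [^] n) = \<alpha> ((a [^] k) [^] q)" using a by (simp add: q nat_pow_pow)
    then show ?thesis using \<alpha>pow[OF k(2)] by (simp add: q \<zeta> power_mult)
  qed
  have well_le: "\<alpha> b * \<zeta> ^ i = \<alpha> c * \<zeta> ^ j"
    if bc: "b \<in> B" "c \<in> B" and ij: "i \<le> j" and eq: "b \<otimes> a [^] i = c \<otimes> a [^] j" for b c and i j :: nat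
  proof -
    have "a [^] j = a [^] (j - i) \<otimes> a [^] i" using ij a by (simp add: nat_pow_mult)
    then have "b \<otimes> a [^] i = (c \<otimes> a [^] (j - i)) \<otimes> a [^] i" using eq bc Bc a by (simp add: m_assoc)
    then have b: "b = c \<otimes> a [^] (j - i)" using bc Bc a by simp
    then have "a [^] (j - i) = inv c \<otimes> b" using bc Bc a by (simp add: inv_cancel_left)
    then have "a [^] (j - i) \<in> B" using bc mB iB by simp
    then have "\<alpha> b = \<alpha> c * \<zeta> ^ (j - i)" using b mult[OF bc(2)] \<zeta>_pow by simp
    then show ?thesis using ij by (simp add: power_add[symmetric])
  qed
  have well: "\<alpha> b * \<zeta> ^ i = \<alpha> c * \<zeta> ^ j"
    if "b \<in> B" "c \<in> B" "b \<otimes> a [^] i = c \<otimes> a [^] j" for b c and i j :: nat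
    using well_le[of b c i j] well_le[of c b j i] that by (cases "i \<le> j") auto
  define B' where "B' = {b \<otimes> a [^] i |b (i :: nat). b \<in> B}"
  define \<beta> where "\<beta> = (\<lambda>x. SOME y. \<exists>b (i :: nat). b \<in> B \<and> x = b \<otimes> a [^] i \<and> y = \<alpha> b * \<zeta> ^ i)"
  have \<beta>: "\<beta> (b \<otimes> a [^] i) = \<alpha> b * \<zeta> ^ i" if b: "b \<in> B" for b and i :: nat
  proof -
    have "\<exists>c (j :: nat). c \<in> B \<and> b \<otimes> a [^] i = c \<otimes> a [^] j \<and> \<beta> (b \<otimes> a [^] i) = \<alpha> c * \<zeta> ^ j"
      unfolding \<beta>_def by (rule someI_ex) (use b in blast)
    then show ?thesis using well[OF b] by metis
  qed
  have prod: "(b \<otimes> a [^] i) \<otimes> (c \<otimes> a [^] j) = (b \<otimes> c) \<otimes> a [^] (i + j)" if "b \<in> B" "c \<in> B" for b c and i j :: nat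
    using that Bc a by (simp add: nat_pow_mult[symmetric] m_ac)
  have inv_pow: "inv (a [^] i) = a [^] (i * (N - 1))" for i :: nat
  proof (rule inv_equality)
    have "i * (N - 1) + i = N * i" using N(1) by (cases N) auto
    then have "a [^] (i * (N - 1)) \<otimes> a [^] i = (a [^] N) [^] i" using a by (simp add: nat_pow_mult nat_pow_pow)
    then show "a [^] (i * (N - 1)) \<otimes> a [^] i = \<one>" using N by simp
  qed (use a in auto)
  show thesis
  proof (rule that[of B' \<beta>])
    show "subgroup B' G"
    proof (rule subgroupI)
      show "B' \<subseteq> carrier G" using Bc a by (auto simp: B'_def)
      show "B' \<noteq> {}" using oneB by (auto simp: B'_def)
    next
      fix x assume "x \<in> B'"
      then obtain b and i :: nat where x: "b \<in> B" "x = b \<otimes> a [^] i" by (auto simp: B'_def)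
      have "inv x = inv b \<otimes> a [^] (i * (N - 1))" using x Bc a by (simp add: inv_mult inv_pow)
      then show "inv x \<in> B'" using iB[OF x(1)] by (auto simp: B'_def)
    next
      fix x y assume "x \<in> B'" "y \<in> B'"
      then obtain b c and i j :: nat where "b \<in> B" "x = b \<otimes> a [^] i" "c \<in> B" "y = c \<otimes> a [^] j"
        unfolding B'_def by blast
      then show "x \<otimes> y \<in> B'" unfolding B'_def using prod mB by blast
    qed
    have 0: "b = b \<otimes> a [^] (0 :: nat)" if "b \<in> B" for b using Bc[OF that] by simp
    show "B \<subseteq> B'" unfolding B'_def using 0 by blast
    have "a = \<one> \<otimes> a [^] (1 :: nat)" using a by simp
    then show "a \<in> B'" unfolding B'_def using oneB by blast
    show "\<beta> x = \<alpha> x" if "x \<in> B" for x using \<beta>[OF that, of 0] 0[OF that] by simp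
    show "norm (\<beta> x) = 1" if xB: "x \<in> B'" for x
    proof -
      obtain b and i :: nat where "b \<in> B" "x = b \<otimes> a [^] i" using xB unfolding B'_def by blast
      then show ?thesis by (simp add: \<beta> norm_mult norm_power norm norm\<zeta>)
    qed
    show "\<beta> (x \<otimes> y) = \<beta> x * \<beta> y" if xy: "x \<in> B'" "y \<in> B'" for x y
    proof -
      obtain b c and i j :: nat where *: "b \<in> B" "x = b \<otimes> a [^] i" "c \<in> B" "y = c \<otimes> a [^] j"
        using xy unfolding B'_def by blast
      then show ?thesis by (simp only: prod \<beta> mB mult) (simp add: power_add)
    qed
  qed
qed

lemma (in comm_group) exists_character_minus_one:
  assumes fin: "finite (carrier G)" and z: "z \<in> carrier G" "z \<noteq> \<one>" "z \<otimes> z = \<one>"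
  obtains \<alpha> :: "'a \<Rightarrow> complex"
  where "\<And>x y. x \<in> carrier G \<Longrightarrow> y \<in> carrier G \<Longrightarrow> \<alpha> (x \<otimes> y) = \<alpha> x * \<alpha> y"
    "\<And>x. x \<in> carrier G \<Longrightarrow> norm (\<alpha> x) = 1" "\<alpha> z = -1"
proof -
  define P where "P = (\<lambda>B. \<exists>\<alpha> :: 'a \<Rightarrow> complex. subgroup B G \<and> z \<in> B \<and> (\<forall>x\<in>B. \<forall>y\<in>B. \<alpha> (x \<otimes> y) = \<alpha> x * \<alpha> y) \<and>
    (\<forall>x\<in>B. norm (\<alpha> x) = 1) \<and> \<alpha> z = -1)"
  have inv_z: "inv z = z" using z by (simp add: inv_equality)
  have "subgroup {\<one>, z} G" by (rule subgroupI) (use z inv_z in auto)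
  \<comment> \<open>The start is the nontrivial character of the group of order 2; a subgroup of
    largest size carrying an extension must be everything.\<close>
  then have "P {\<one>, z}" unfolding P_def
    by (intro exI[of _ "\<lambda>x. if x = \<one> then 1 else -1"]) (use z in auto)
  moreover have "\<forall>B. P B \<longrightarrow> card B < Suc (card (carrier G))"
    using fin by (auto simp: P_def less_Suc_eq_le intro!: card_mono subgroup.subset)
  ultimately obtain B where B: "P B" "\<And>B'. P B' \<Longrightarrow> card B' \<le> card B"
    using ex_has_greatest_nat[of P "{\<one>, z}" card "Suc (card (carrier G))"] by blast
  then obtain \<alpha> :: "'a \<Rightarrow> complex" where \<alpha>: "subgroup B G" "z \<in> B" "\<And>x y. x \<in> B \<Longrightarrow> y \<in> B \<Longrightarrow> \<alpha> (x \<otimes> y) = \<alpha> x * \<alpha> y"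
    "\<And>x. x \<in> B \<Longrightarrow> norm (\<alpha> x) = 1" "\<alpha> z = -1" unfolding P_def by blast
  have "B = carrier G"
  proof (rule ccontr)
    assume "B \<noteq> carrier G"
    then obtain a where a: "a \<in> carrier G" "a \<notin> B" using subgroup.subset[OF \<alpha>(1)] by blast
    obtain B' \<beta> where B': "subgroup B' G" "B \<subseteq> B'" "a \<in> B'"
      "\<And>x y. x \<in> B' \<Longrightarrow> y \<in> B' \<Longrightarrow> \<beta> (x \<otimes> y) = \<beta> x * \<beta> y"
      "\<And>x. x \<in> B' \<Longrightarrow> norm (\<beta> x) = (1 :: real)" "\<And>x. x \<in> B \<Longrightarrow> \<beta> x = (\<alpha> x :: complex)"
      using character_extension_step[OF fin \<alpha>(1) a(1) \<alpha>(3,4)] by metis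
    have "P B'" unfolding P_def using B' \<alpha>(2,5) by (intro exI[of _ \<beta>]) auto
    then have "card B' \<le> card B" by (rule B(2))
    moreover have "finite B'" using fin subgroup.subset[OF B'(1)] finite_subset by blast
    ultimately have "B = B'" using B'(2) by (metis card_seteq)
    then show False using a B' by blast
  qed
  then show thesis using that \<alpha> by blast
qed

section \<open>Groups with dihedral involution centralizer\<close>

text \<open>Pairing \<open>g\<close> with \<open>inv g\<close> leaves \<open>\<one>\<close> and the
  involutions, and \<open>z\<close> makes the group order even.\<close>

lemma (in group) odd_number_of_involutions:
  assumes fin: "finite (carrier G)" and z: "z \<in> carrier G" "z \<noteq> \<one>" "z \<otimes> z = \<one>"
  shows "odd (card {t \<in> carrier G. t \<noteq> \<one> \<and> t \<otimes> t = \<one>})" (is "odd (card ?Inv)")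
proof -
  let ?X = "{g \<in> carrier G. inv g \<noteq> g}"
  have "int 2 dvd (\<Sum>g\<in>?X. 1)"
  proof (rule free_cyclic_action_dvd_sum[where \<sigma> = "m_inv G"])
    show "(m_inv G ^^ 2) g = g" if "g \<in> ?X" for g using that by (simp add: numeral_2_eq_2)
    show "(m_inv G ^^ i) g \<noteq> g" if "g \<in> ?X" "0 < i" "i < 2" for g i
    proof -
      have "i = 1" using that(2,3) by linarith
      show ?thesis unfolding \<open>i = 1\<close> using that(1) by simp
    qed
  qed (use fin in auto)
  then have "even (card ?X)" by simp
  moreover have "even (card (carrier G))"
  proof -
    have "z [^] (2::nat) = \<one>" using z by (simp add: numeral_2_eq_2)
    then have "ord z dvd 2" using z by (simp add: pow_eq_id)
    moreover have "ord z \<noteq> 1" using z ord_eq_1 by blast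
    ultimately have "ord z = 2" using prime_nat_iff two_is_prime_nat by blast
    then show ?thesis using ord_dvd_group_order[OF z(1)] by (simp add: Coset.order_def)
  qed
  moreover have "carrier G = insert \<one> (?X \<union> ?Inv)"
  proof -
    have "g \<otimes> g = \<one>" if "g \<in> carrier G" "inv g = g" for g using r_inv[OF that(1)] that(2) by simp
    then show ?thesis by auto
  qed
  moreover have "card (insert \<one> (?X \<union> ?Inv)) = Suc (card ?X + card ?Inv)"
  proof -
    have "\<one> \<notin> ?X \<union> ?Inv" by simp
    moreover have "?X \<inter> ?Inv = {}" using inv_equality by auto
    ultimately show ?thesis using fin by (simp add: card_Un_disjoint)
  qed
  ultimately show ?thesis by simp
qed

text \<open>This isolates what is required of PSL(2,q): one class of involutions, with a centralizer
  \<open>D\<close> that is generalized dihedral over the abelian group \<open>T\<close>, in which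
  \<open>z\<close> is the only involution.\<close>

theorem finite_two_subgroup_of_normalized_units:
  fixes G :: "('a::finite, 'b) monoid_scheme" (structure)
  assumes "group G" and z: "z \<in> carrier G" "z \<noteq> \<one>" "z \<otimes> z = \<one>"
    and one_class: "\<And>t. \<lbrakk>t \<in> carrier G; t \<noteq> \<one>; t \<otimes> t = \<one>\<rbrakk> \<Longrightarrow> \<exists>g\<in>carrier G. t = g \<otimes> z \<otimes> inv g"
    and cent: "D = {g \<in> carrier G. g \<otimes> z = z \<otimes> g}"
    and T: "subgroup T G" "T \<subseteq> D" "z \<in> T" "\<And>s t. s \<in> T \<Longrightarrow> t \<in> T \<Longrightarrow> s \<otimes> t = t \<otimes> s"
    and T_invol: "\<And>t. t \<in> T \<Longrightarrow> t \<noteq> \<one> \<Longrightarrow> t \<otimes> t = \<one> \<Longrightarrow> t = z"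
    and w: "w \<in> D" "w \<notin> T"
    and outer: "\<And>d. d \<in> D \<Longrightarrow> d \<notin> T \<Longrightarrow> d \<otimes> d = \<one>"
      "\<And>d e. d \<in> D \<Longrightarrow> e \<in> D \<Longrightarrow> d \<notin> T \<Longrightarrow> e \<notin> T \<Longrightarrow> d \<otimes> e \<in> T"
    and H: "subgroup H (normalized_units G)" "card H = 2 ^ k"
  shows "cyclic_group ((normalized_units G)\<lparr>carrier := H\<rparr>) \<or> is_dihedral ((normalized_units G)\<lparr>carrier := H\<rparr>)"
proof -
  interpret group G by fact
  have fin: "finite (carrier G)" by simp
  have Dc: "d \<in> carrier G" if "d \<in> D" for d using that by (simp add: cent)
  have Tc: "t \<in> carrier G" if "t \<in> T" for t by (rule subgroup.mem_carrier[OF T(1) that])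
  have Tm: "s \<otimes> t \<in> T" if "s \<in> T" "t \<in> T" for s t by (rule subgroup.m_closed[OF T(1) that])
  have Ti: "inv t \<in> T" if "t \<in> T" for t by (rule subgroup.m_inv_closed[OF T(1) that])
  have T1: "\<one> \<in> T" by (rule subgroup.one_closed[OF T(1)])
  have subD: "subgroup D G"
  proof (rule subgroupI)
    fix a assume "a \<in> D"
    then have a: "a \<in> carrier G" "a \<otimes> z = z \<otimes> a" by (auto simp: cent)
    have "inv a \<otimes> z = inv a \<otimes> (z \<otimes> a) \<otimes> inv a" using a(1) z by (simp add: m_assoc)
    also have "\<dots> = z \<otimes> inv a" unfolding a(2)[symmetric] using a(1) z by (simp add: inv_cancel_left)
    finally show "inv a \<in> D" using a by (simp add: cent)
  next
    fix a b assume "a \<in> D" "b \<in> D"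
    then have ab: "a \<in> carrier G" "b \<in> carrier G" "a \<otimes> z = z \<otimes> a" "b \<otimes> z = z \<otimes> b" by (auto simp: cent)
    have "a \<otimes> b \<otimes> z = a \<otimes> (z \<otimes> b)" using ab(1,2,4) z by (simp add: m_assoc)
    also have "\<dots> = a \<otimes> z \<otimes> b" using ab(1,2) z by (simp add: m_assoc)
    also have "\<dots> = z \<otimes> (a \<otimes> b)" unfolding ab(3) using ab(1,2) z by (simp add: m_assoc)
    finally show "a \<otimes> b \<in> D" using ab by (simp add: cent)
  qed (use z in \<open>auto simp: cent\<close>)
  have Dm: "d \<otimes> e \<in> D" if "d \<in> D" "e \<in> D" for d e by (rule subgroup.m_closed[OF subD that])
  have mixed: "t \<otimes> d \<notin> T" "d \<otimes> t \<notin> T" if t: "t \<in> T" and d: "d \<in> D" "d \<notin> T" for t d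
  proof -
    have "inv t \<otimes> (t \<otimes> d) = d" "(d \<otimes> t) \<otimes> inv t = d" using Tc[OF t] Dc[OF d(1)] by (simp_all add: inv_cancel_left m_assoc)
    then show "t \<otimes> d \<notin> T" "d \<otimes> t \<notin> T" using Tm Ti t d by metis+
  qed
  have outer_inv: "inv d = d" if "d \<in> D" "d \<notin> T" for d
    using outer(1)[OF that] Dc[OF that(1)] by (simp add: inv_equality)
  \<comment> \<open>Both \<open>d\<close> and \<open>d \<otimes> t\<close> are outside
    \<open>T\<close>, hence their own inverses.\<close>
  have inverts: "d \<otimes> t = inv t \<otimes> d" if t: "t \<in> T" and d: "d \<in> D" "d \<notin> T" for t d
  proof -
    have dt: "d \<otimes> t \<in> D" "d \<otimes> t \<notin> T" using Dm d T(2) t mixed by auto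
    have "d \<otimes> t = inv (d \<otimes> t)" using outer_inv[OF dt] by simp
    also have "\<dots> = inv t \<otimes> inv d" using Tc[OF t] Dc[OF d(1)] by (simp add: inv_mult_group)
    finally show ?thesis using outer_inv[OF d] by simp
  qed
  define Inv where "Inv = {t \<in> carrier G. t \<noteq> \<one> \<and> t \<otimes> t = \<one>}"
  have odd_Inv: "odd (card Inv)" unfolding Inv_def by (rule odd_number_of_involutions[OF fin z])
  \<comment> \<open>The -1 eigenspace of \<open>z\<close> will have dimension
    \<open>card Inv\<close> minus \<open>\<alpha> z\<close>; the sign is the one that makes it 2
    modulo 4. For the sign 1 the trivial character will do.\<close>
  obtain \<alpha> :: "'a \<Rightarrow> complex" where \<alpha>: "\<And>x y. x \<in> T \<Longrightarrow> y \<in> T \<Longrightarrow> \<alpha> (x \<otimes> y) = \<alpha> x * \<alpha> y"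
    "\<And>x. x \<in> T \<Longrightarrow> norm (\<alpha> x) = 1" "\<alpha> z = (if card Inv mod 4 = 1 then -1 else 1)"
  proof (cases "card Inv mod 4 = 1")
    case True
    interpret T: comm_group "G\<lparr>carrier := T\<rparr>"
      using T(1,4) by (intro group.group_comm_groupI subgroup.subgroup_is_group group_axioms) auto
    show thesis
      using T.exists_character_minus_one[of z] T(3) z True that by (simp add: finite_subset[OF subgroup.subset[OF T(1)] fin]) blast
  next
    case False
    then show thesis by (intro that[of "\<lambda>_. 1"]) auto
  qed
  have \<alpha>1: "\<alpha> \<one> = 1" using \<alpha>(1)[OF T1 T1] \<alpha>(2)[OF T1] by auto
  have \<alpha>_inv: "\<alpha> (inv t) = cnj (\<alpha> t)" if t: "t \<in> T" for t
  proof -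
    have "\<alpha> (inv t) * \<alpha> t = 1" using \<alpha>(1)[OF Ti[OF t] t] Tc[OF t] \<alpha>1 by simp
    moreover have "cnj (\<alpha> t) * \<alpha> t = 1" using \<alpha>(2)[OF t] by (simp add: mult.commute complex_norm_square[symmetric])
    ultimately show ?thesis by (metis mult_cancel_right mult_zero_right zero_neq_one)
  qed
  \<comment> \<open>The real form of the representation of \<open>D\<close> induced from \<alpha>:
    \<open>T\<close> acts by rotations, the other elements by reflections, and \<open>w\<close> by
    conjugation.\<close>
  define \<rho> where "\<rho> = (\<lambda>d v. if d \<in> T then \<alpha> d * v else \<alpha> (d \<otimes> w) * cnj v)"
  interpret real_plane_rep G D \<rho>
  proof (intro real_plane_rep.intro real_plane_rep_axioms.intro group_axioms)
    show "subgroup D G" by (rule subD)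
    show "linear (\<rho> d)" for d by (auto simp: \<rho>_def intro!: linearI simp: algebra_simps)
    show "\<rho> \<one> v = v" for v by (simp add: \<rho>_def T1 \<alpha>1)
    fix d e v assume d: "d \<in> D" and e: "e \<in> D"
    have dw: "d \<otimes> w \<in> T" if "d \<notin> T" using outer(2)[OF d w(1) that w(2)] .
    have ew: "e \<otimes> w \<in> T" if "e \<notin> T" using outer(2)[OF e w(1) that w(2)] .
    have c: "d \<in> carrier G" "e \<in> carrier G" "w \<in> carrier G" using d e w Dc by auto
    show "\<rho> (d \<otimes> e) v = \<rho> d (\<rho> e v)"
    proof (cases "d \<in> T"; cases "e \<in> T")
      assume "d \<in> T" "e \<in> T"
      then show ?thesis by (simp add: \<rho>_def Tm \<alpha>(1))
    next
      assume *: "d \<in> T" "e \<notin> T"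
      have "\<alpha> (d \<otimes> e \<otimes> w) = \<alpha> d * \<alpha> (e \<otimes> w)" using \<alpha>(1)[OF *(1) ew[OF *(2)]] c by (simp add: m_assoc)
      then show ?thesis using * mixed(1)[OF *(1) e *(2)] by (simp add: \<rho>_def)
    next
      assume *: "d \<notin> T" "e \<in> T"
      have "d \<otimes> e \<otimes> w = d \<otimes> (e \<otimes> w)" using c by (simp add: m_assoc)
      also have "e \<otimes> w = w \<otimes> inv e" using inverts[OF Ti[OF *(2)] w] c by simp
      also have "d \<otimes> (w \<otimes> inv e) = (d \<otimes> w) \<otimes> inv e" using c by (simp add: m_assoc)
      finally have "\<alpha> (d \<otimes> e \<otimes> w) = \<alpha> (d \<otimes> w) * cnj (\<alpha> e)"
        using \<alpha>(1)[OF dw[OF *(1)] Ti[OF *(2)]] \<alpha>_inv[OF *(2)] by simp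
      then show ?thesis using * mixed(2)[OF *(2) d *(1)] by (simp add: \<rho>_def)
    next
      assume *: "d \<notin> T" "e \<notin> T"
      have "inv (e \<otimes> w) = w \<otimes> e" using c outer_inv[OF e *(2)] outer_inv[OF w] by (simp add: inv_mult_group)
      then have "(d \<otimes> w) \<otimes> inv (e \<otimes> w) = d \<otimes> (w \<otimes> w) \<otimes> e" using c by (simp add: m_assoc)
      then have "(d \<otimes> w) \<otimes> inv (e \<otimes> w) = d \<otimes> e" using outer(1)[OF w] c by simp
      then have "\<alpha> (d \<otimes> e) = \<alpha> (d \<otimes> w) * cnj (\<alpha> (e \<otimes> w))"
        using \<alpha>(1)[OF dw[OF *(1)] Ti[OF ew[OF *(2)]]] \<alpha>_inv[OF ew[OF *(2)]] by simp
      then show ?thesis using * outer(2)[OF d e *] by (simp add: \<rho>_def)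
    qed
  qed
  have trace_out: "lin_trace (\<rho> d) = 0" if "d \<notin> T" for d
    using that by (simp add: lin_trace_def \<rho>_def Basis_complex_def)
  have trace_z: "lin_trace (\<rho> z) = 2 * Re (\<alpha> z)"
    using T(3) by (simp add: lin_trace_def \<rho>_def Basis_complex_def)
  define N where "N = card Inv"
  \<comment> \<open>The fibres of \<open>g\<close> mapping to the conjugate of \<open>z\<close> by
    \<open>g\<close> are cosets of \<open>D\<close>. So the index of \<open>D\<close>, half the
    degree of the representation, is the number of involutions.\<close>
  have card_G: "card (carrier G) = N * card D"
  proof -
    have "card (carrier G) = (\<Sum>t\<in>Inv. card {g \<in> carrier G. g \<otimes> z \<otimes> inv g = t})"
    proof -
      have img: "(\<lambda>g. g \<otimes> z \<otimes> inv g) ` carrier G \<subseteq> Inv"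
      proof
        fix t assume "t \<in> (\<lambda>g. g \<otimes> z \<otimes> inv g) ` carrier G"
        then obtain g where g: "g \<in> carrier G" "t = g \<otimes> z \<otimes> inv g" by blast
        have "t \<otimes> t = g \<otimes> (z \<otimes> z) \<otimes> inv g" using g z(1) by (simp add: m_assoc inv_cancel_left)
        then have tt: "t \<otimes> t = \<one>" using g z by simp
        have "inv g \<otimes> t \<otimes> g = z" using g z(1) by (simp add: m_assoc inv_cancel_left)
        then have "t \<noteq> \<one>" using g z(2) by auto
        then show "t \<in> Inv" using g z tt by (simp add: Inv_def)
      qed
      have "(\<Sum>g\<in>carrier G. 1::nat) = (\<Sum>t\<in>Inv. \<Sum>g\<in>{g \<in> carrier G. g \<otimes> z \<otimes> inv g = t}. 1)"
        by (rule sum.group[symmetric]) (use fin img in \<open>auto simp: Inv_def\<close>)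
      then show ?thesis by simp
    qed
    also have "\<dots> = (\<Sum>t\<in>Inv. card D)"
    proof (rule sum.cong[OF refl])
      fix t assume "t \<in> Inv"
      then obtain g where g: "g \<in> carrier G" "t = g \<otimes> z \<otimes> inv g" using one_class by (auto simp: Inv_def)
      have fibre: "h \<otimes> z \<otimes> inv h = t \<longleftrightarrow> inv g \<otimes> h \<in> D" if h: "h \<in> carrier G" for h
      proof -
        have "h \<otimes> z \<otimes> inv h = t \<longleftrightarrow> inv g \<otimes> (h \<otimes> z \<otimes> inv h) \<otimes> h = inv g \<otimes> t \<otimes> h"
          using g h z by simp
        also have "\<dots> \<longleftrightarrow> inv g \<otimes> h \<in> D" using g h z by (simp add: cent m_assoc inv_cancel_left)
        finally show ?thesis .
      qed
      have "bij_betw (\<lambda>d. g \<otimes> d) D {h \<in> carrier G. h \<otimes> z \<otimes> inv h = t}"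
      proof (rule bij_betw_byWitness[where f' = "\<lambda>h. inv g \<otimes> h"])
        show "\<forall>d\<in>D. inv g \<otimes> (g \<otimes> d) = d" using g(1) Dc by (simp add: inv_cancel_left)
        show "\<forall>h\<in>{h \<in> carrier G. h \<otimes> z \<otimes> inv h = t}. g \<otimes> (inv g \<otimes> h) = h"
          using g(1) by (simp add: inv_cancel_left)
        show "(\<lambda>d. g \<otimes> d) ` D \<subseteq> {h \<in> carrier G. h \<otimes> z \<otimes> inv h = t}"
        proof
          fix h assume "h \<in> (\<lambda>d. g \<otimes> d) ` D"
          then obtain d where d: "d \<in> D" "h = g \<otimes> d" by blast
          then have "h \<in> carrier G" "inv g \<otimes> h \<in> D" using g(1) Dc by (simp_all add: inv_cancel_left)
          then show "h \<in> {h \<in> carrier G. h \<otimes> z \<otimes> inv h = t}" using fibre by blast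
        qed
        show "(\<lambda>h. inv g \<otimes> h) ` {h \<in> carrier G. h \<otimes> z \<otimes> inv h = t} \<subseteq> D"
          using fibre by blast
      qed
      then show "card {h \<in> carrier G. h \<otimes> z \<otimes> inv h = t} = card D" by (rule bij_betw_same_card[symmetric])
    qed
    finally show ?thesis by (simp add: N_def)
  qed
  have chi_one: "induced_character \<one> = 2 * N"
    using card_D by (auto simp: induced_character_one card_G)
  have chi_z: "induced_character z = 2 * Re (\<alpha> z)"
  proof -
    \<comment> \<open>A conjugate of \<open>z\<close> in \<open>T\<close> is \<open>z\<close>
      itself, and one in \<open>D\<close> outside \<open>T\<close> is a reflection of trace 0. Only
      \<open>g\<close> in \<open>D\<close> contributes.\<close>
    have summand: "(if inv g \<otimes> z \<otimes> g \<in> D then lin_trace (\<rho> (inv g \<otimes> z \<otimes> g)) else 0) = (if g \<in> D then 2 * Re (\<alpha> z) else 0)"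
      if g: "g \<in> carrier G" for g
    proof -
      let ?t = "inv g \<otimes> z \<otimes> g"
      have tz: "?t = z \<longleftrightarrow> g \<in> D"
      proof
        assume "?t = z"
        then have "g \<otimes> (inv g \<otimes> z \<otimes> g) = g \<otimes> z" by simp
        then show "g \<in> D" using g z by (simp add: cent m_assoc inv_cancel_left)
      next
        assume "g \<in> D"
        then have "z \<otimes> g = g \<otimes> z" by (simp add: cent)
        then show "?t = z" using g z by (simp add: m_assoc inv_cancel_left)
      qed
      have "?t \<otimes> ?t = inv g \<otimes> (z \<otimes> z) \<otimes> g" using g z(1) by (simp add: m_assoc inv_cancel_left)
      then have tt: "?t \<otimes> ?t = \<one>" using g z by simp
      have "g \<otimes> ?t \<otimes> inv g = z" using g z(1) by (simp add: m_assoc inv_cancel_left)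
      then have "?t \<noteq> \<one>" using g z(2) by auto
      then have "?t = z" if "?t \<in> T" using T_invol that tt by blast
      moreover have "z \<in> D" using T by blast
      ultimately show ?thesis using tz trace_out[of ?t] trace_z by auto
    qed
    have "induced_character z = (1 / real (card D)) * (\<Sum>g\<in>carrier G. if g \<in> D then 2 * Re (\<alpha> z) else 0)"
      unfolding induced_character_def by (simp only: summand cong: sum.cong)
    also have "(\<Sum>g\<in>carrier G. if g \<in> D then 2 * Re (\<alpha> z) else 0) = (\<Sum>g\<in>D. 2 * Re (\<alpha> z))"
      using subgroup.subset[OF subD] by (simp add: sum.If_cases Int_absorb1)
    finally show ?thesis using card_D by auto
  qed
  interpret V: group "normalized_units G" by (rule group_normalized_units[OF fin])
  define c :: int where "c = (if N mod 4 = 1 then -2 else 2)"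
  have chi_z': "induced_character z = c" unfolding chi_z \<alpha>(3) c_def N_def by simp
  have Vmult: "x \<otimes>\<^bsub>normalized_units G\<^esub> y = x \<otimes>\<^bsub>int_group_ring G\<^esub> y" for x y
    by (simp add: normalized_units_def units_of_def)
  have Vone: "\<one>\<^bsub>normalized_units G\<^esub> = \<one>\<^bsub>int_group_ring G\<^esub>"
    by (simp add: normalized_units_def units_of_def)
  have Vcar: "u \<in> carrier (int_group_ring G)" "augmentation G u = 1" if "u \<in> H" for u
    using that subgroup.subset[OF H(1)] by (auto simp: normalized_units_def units_of_def Units_def)
  interpret W: involution_trace_rep "(normalized_units G)\<lparr>carrier := H\<rparr>" induced "2 * int N" c
  proof (intro involution_trace_rep.intro involution_trace_rep_axioms.intro)
    show "group ((normalized_units G)\<lparr>carrier := H\<rparr>)"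
      by (rule subgroup.subgroup_is_group[OF H(1) V.group_axioms])
    show "linear (induced h)" for h by (rule linear_induced)
    show "induced g (induced h v) = induced (g \<otimes>\<^bsub>(normalized_units G)\<lparr>carrier := H\<rparr>\<^esub> h) v" for g h v
      by (simp add: Vmult induced_mult)
    have "lin_trace (induced \<one>\<^bsub>int_group_ring G\<^esub>) = (\<Sum>h\<in>carrier G. if h = \<one> then induced_character h else 0)"
      unfolding lin_trace_induced by (intro sum.cong refl) (simp add: int_group_ring_simps(3))
    then show "lin_trace (induced \<one>\<^bsub>(normalized_units G)\<lparr>carrier := H\<rparr>\<^esub>) = real_of_int (2 * int N)"
      by (simp add: Vone chi_one)
    show "lin_trace (induced t) = real_of_int c"
      if t: "t \<in> carrier ((normalized_units G)\<lparr>carrier := H\<rparr>)" "t \<noteq> \<one>\<^bsub>(normalized_units G)\<lparr>carrier := H\<rparr>\<^esub>"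
        "t \<otimes>\<^bsub>(normalized_units G)\<lparr>carrier := H\<rparr>\<^esub> t = \<one>\<^bsub>(normalized_units G)\<lparr>carrier := H\<rparr>\<^esub>" for t
    proof -
      have "(\<Sum>g\<in>carrier G. t g * induced_character g) = induced_character z"
        using t Vcar[of t]
        by (intro involution_unit_class_function[OF group_axioms z one_class] induced_character_class_function)
          (auto simp: Vmult Vone)
      then show ?thesis by (simp add: lin_trace_induced chi_z')
    qed
    have "N mod 4 = 1 \<or> N mod 4 = 3" using odd_Inv unfolding N_def by presburger
    then show "(2 * int N - c) mod 8 = 4" unfolding c_def by (auto simp: ) presburger+
  qed
  show ?thesis
    by (rule W.two_group_with_trace_condition[where k = k]) (simp add: Coset.order_def H(2))
qed

section \<open>The group PSL(2,q)\<close>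

definition mat2 :: "'f::zero \<Rightarrow> 'f \<Rightarrow> 'f \<Rightarrow> 'f \<Rightarrow> 'f ^ 2 ^ 2" where
  "mat2 a b c d = (\<chi> i j. if i = 1 then (if j = 1 then a else b) else (if j = 1 then c else d))"

lemma mat2_eq_iff [simp]: "mat2 a b c d = mat2 a' b' c' d' \<longleftrightarrow> a = a' \<and> b = b' \<and> c = c' \<and> d = d'"
  by (auto simp: mat2_def vec_eq_iff forall_2)

lemma mat2_cases: obtains a b c d where "A = mat2 a b c d"
proof
  show "A = mat2 (A $ 1 $ 1) (A $ 1 $ 2) (A $ 2 $ 1) (A $ 2 $ 2)"
    by (simp add: mat2_def vec_eq_iff forall_2)
qed

lemma mat2_mult [simp]: "mat2 a b c d ** mat2 a' b' c' d' =
    mat2 (a * a' + b * c') (a * b' + b * d') (c * a' + d * c') (c * b' + d * d')"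
  for a :: "'f::semiring_1"
  by (simp add: mat2_def matrix_matrix_mult_def vec_eq_iff forall_2 sum_2)

lemma mat2_det [simp]: "det (mat2 a b c d) = a * d - b * c" for a :: "'f::comm_ring_1"
  by (simp add: det_2 mat2_def)

lemma mat2_one: "mat 1 = mat2 1 0 0 (1 :: 'f::zero_neq_one)"
  by (simp add: mat2_def mat_def vec_eq_iff forall_2)

lemma mat2_uminus [simp]: "- mat2 a b c d = mat2 (- a) (- b) (- c) (- d)" for a :: "'f::ring_1"
  by (simp add: mat2_def vec_eq_iff forall_2)

text \<open>In characteristic 2 translation by 1 would pair off the elements of the field.\<close>

lemma two_neq_zero_of_odd_card:
  assumes "odd CARD('f::{field, finite})"
  shows "(2 :: 'f) \<noteq> 0"
proof
  assume 2: "(2 :: 'f) = 0"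
  have "int 2 dvd (\<Sum>x\<in>(UNIV :: 'f set). 1)"
  proof (rule free_cyclic_action_dvd_sum[where \<sigma> = "\<lambda>x. x + 1"])
    show "((\<lambda>x. x + 1) ^^ 2) x = x" for x :: 'f
      using 2 by (simp add: numeral_2_eq_2 add.assoc one_add_one)
    show "((\<lambda>x. x + 1) ^^ i) x \<noteq> x" if "0 < i" "i < 2" for i and x :: 'f
    proof -
      have "i = 1" using that by linarith
      show ?thesis unfolding \<open>i = 1\<close> by simp
    qed
  qed auto
  then show False using assms by simp
qed

text \<open>Each value of the squaring map is taken at most twice, so the squares fill more than
  half of the field and meet their image under the map from \<open>y\<close> to
  \<open>c - y\<close>.\<close>

lemma sum_of_two_squares_field:
  fixes c :: "'f::{field, finite}"
  assumes odd: "odd CARD('f)"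
  obtains s t where "s\<^sup>2 + t\<^sup>2 = c"
proof -
  define S where "S = range (\<lambda>x :: 'f. x\<^sup>2)"
  have "CARD('f) = (\<Sum>y\<in>S. card {x. x\<^sup>2 = y})"
    using sum.group[of "UNIV :: 'f set" S "\<lambda>x. x\<^sup>2" "\<lambda>_. 1 :: nat"] by (simp add: S_def)
  also have "\<dots> \<le> (\<Sum>y\<in>S. 2)"
  proof (rule sum_mono)
    fix y assume "y \<in> S"
    then obtain r where r: "y = r\<^sup>2" by (auto simp: S_def)
    have "{x. x\<^sup>2 = y} \<subseteq> {r, - r}" by (auto simp: r power2_eq_iff)
    then have "card {x. x\<^sup>2 = y} \<le> card {r, - r}" by (intro card_mono) auto
    also have "\<dots> \<le> 2" by (simp add: card_insert_if)
    finally show "card {x. x\<^sup>2 = y} \<le> 2" .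
  qed
  finally have "CARD('f) \<le> 2 * card S" by simp
  then have big: "CARD('f) < 2 * card S" using odd by (metis dvd_triv_left le_neq_implies_less)
  have "S \<inter> (\<lambda>y. c - y) ` S \<noteq> {}"
  proof
    assume disj: "S \<inter> (\<lambda>y. c - y) ` S = {}"
    have "card ((\<lambda>y. c - y) ` S) = card S" by (intro card_image) (auto simp: inj_on_def)
    then have "card (S \<union> (\<lambda>y. c - y) ` S) = 2 * card S" using disj by (simp add: card_Un_disjoint)
    moreover have "card (S \<union> (\<lambda>y. c - y) ` S) \<le> CARD('f)" by (intro card_mono) auto
    ultimately show False using big by simp
  qed
  then obtain x y where "x\<^sup>2 = c - y\<^sup>2" by (auto simp: S_def)
  then have "x\<^sup>2 + y\<^sup>2 = c" by simp
  then show thesis by (rule that)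
qed

section \<open>SL(2,q), and PSL(2,q) as matrices up to sign\<close>

lemma SL2_simps:
  "carrier SL2 = {A. det A = 1}" "A \<otimes>\<^bsub>SL2\<^esub> B = A ** B" "\<one>\<^bsub>SL2\<^esub> = mat 1"
  by (simp_all add: SL2_def)

lemma SL2_center: "group_center SL2 = {mat 1, - mat 1 :: 'f::field ^ 2 ^ 2}"
proof
  show "{mat 1, - mat 1 :: 'f ^ 2 ^ 2} \<subseteq> group_center SL2"
  proof -
    have "mat 1 ** A = A ** mat 1 \<and> - mat 1 ** A = A ** - mat 1" for A :: "'f ^ 2 ^ 2"
      by (cases A rule: mat2_cases) (simp add: mat2_one)
    then show ?thesis by (auto simp: group_center_def SL2_simps mat2_one)
  qed
  show "group_center SL2 \<subseteq> {mat 1, - mat 1 :: 'f ^ 2 ^ 2}"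
  proof
    fix A :: "'f ^ 2 ^ 2" assume A: "A \<in> group_center SL2"
    obtain a b c d where abcd: "A = mat2 a b c d" by (rule mat2_cases)
    \<comment> \<open>Commuting with these two unipotent matrices already forces a scalar
      matrix.\<close>
    have "mat2 1 1 0 1 \<in> carrier (SL2 :: ('f ^ 2 ^ 2) monoid)" "mat2 1 0 1 1 \<in> carrier (SL2 :: ('f ^ 2 ^ 2) monoid)"
      by (auto simp: SL2_simps)
    then have "A ** mat2 1 1 0 1 = mat2 1 1 0 1 ** A" "A ** mat2 1 0 1 1 = mat2 1 0 1 1 ** A" "det A = 1"
      using A by (auto simp: group_center_def SL2_simps)
    then have "b = 0" "c = 0" "a = d" "a * d = 1" by (auto simp: abcd)
    then have "a = 1 \<or> a = -1" by (metis power2_eq_1_iff power2_eq_square)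
    then show "A \<in> {mat 1, - mat 1}" using \<open>b = 0\<close> \<open>c = 0\<close> \<open>a = d\<close> by (auto simp: abcd mat2_one)
  qed
qed

definition PSL2_proj :: "'f::field ^ 2 ^ 2 \<Rightarrow> ('f ^ 2 ^ 2) set" where
  "PSL2_proj A = {A, - A}"

lemma PSL2_proj_coset: "group_center SL2 #>\<^bsub>SL2\<^esub> A = PSL2_proj A" for A :: "'f::field ^ 2 ^ 2"
proof -
  have "- mat 1 ** A = - A"
    by (cases A rule: mat2_cases) (simp add: mat2_one)
  then show ?thesis by (auto simp: r_coset_def SL2_simps SL2_center PSL2_proj_def)
qed

lemma PSL2_proj_eq_iff: "PSL2_proj A = PSL2_proj B \<longleftrightarrow> A = B \<or> A = - B"
  by (auto simp: PSL2_proj_def doubleton_eq_iff)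

lemma carrier_PSL2: "carrier PSL2 = PSL2_proj ` {A. det A = 1}"
  by (simp add: PSL2_def carrier_FactGroup PSL2_proj_coset SL2_simps)

lemma PSL2_mult:
  assumes "det A = 1" "det B = 1"
  shows "PSL2_proj A \<otimes>\<^bsub>PSL2\<^esub> PSL2_proj B = PSL2_proj (A ** B)"
proof -
  interpret normal "group_center SL2" "SL2 :: ('a ^ 2 ^ 2) monoid"
    by (intro group.group_center_normal group_SL2)
  show ?thesis
    using assms rcos_sum[of A B] by (simp add: PSL2_def FactGroup_def PSL2_proj_coset SL2_simps)
qed

lemma PSL2_one: "\<one>\<^bsub>PSL2\<^esub> = PSL2_proj (mat 1)"
  by (simp add: PSL2_def SL2_center PSL2_proj_def)

context
  assumes two: "(2 :: 'f::{field, finite}) \<noteq> 0"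
begin

text \<open>The off-diagonal entries of the square are \<open>b\<close> and \<open>c\<close> times
  the trace. If the trace is not 0, the matrix is diagonal with entries of equal square, hence
  scalar. So the involutions are the traceless matrices up to sign.\<close>

lemma PSL2_square_eq_one_iff:
  fixes a b c d :: 'f
  assumes det: "a * d - b * c = 1"
  shows "PSL2_proj (mat2 a b c d ** mat2 a b c d) = PSL2_proj (mat 1) \<longleftrightarrow> PSL2_proj (mat2 a b c d) = PSL2_proj (mat 1) \<or> d = - a"
proof
  assume "PSL2_proj (mat2 a b c d ** mat2 a b c d) = PSL2_proj (mat 1)"
  then have "mat2 a b c d ** mat2 a b c d = mat2 1 0 0 1 \<or> mat2 a b c d ** mat2 a b c d = mat2 (-1) 0 0 (-1)"
    by (auto simp: PSL2_proj_eq_iff mat2_one simp del: mat2_mult)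
  then obtain e where "mat2 a b c d ** mat2 a b c d = mat2 e 0 0 e" by blast
  then have "a * a + b * c = e" "a * b + b * d = 0" "c * a + d * c = 0" "c * b + d * d = e" by auto
  then have e: "a * a + b * c = e" "b * (a + d) = 0" "c * (a + d) = 0" "c * b + d * d = e"
    by (simp_all add: algebra_simps)
  show "PSL2_proj (mat2 a b c d) = PSL2_proj (mat 1) \<or> d = - a"
  proof (cases "a + d = 0")
    case False
    then have bc: "b = 0" "c = 0" using e by auto
    then have "a * a = d * d" using e(1,4) by simp
    then have "a = d" using False by (metis add_eq_0_iff2 square_eq_iff)
    then have "a * a = 1" using det bc by simp
    then have "a = 1 \<or> a = -1" by (simp add: square_eq_1_iff)
    then show ?thesis using bc \<open>a = d\<close> by (auto simp: PSL2_proj_eq_iff mat2_one)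
  qed (simp add: add_eq_0_iff)
next
  assume "PSL2_proj (mat2 a b c d) = PSL2_proj (mat 1) \<or> d = - a"
  then show "PSL2_proj (mat2 a b c d ** mat2 a b c d) = PSL2_proj (mat 1)"
  proof
    assume "PSL2_proj (mat2 a b c d) = PSL2_proj (mat 1)"
    then show ?thesis by (auto simp: PSL2_proj_eq_iff mat2_one)
  next
    assume "d = - a"
    then have "- (a * a + b * c) = 1" using det by simp
    then have "a * a + b * c = -1" by (metis minus_minus)
    then show ?thesis using \<open>d = - a\<close> by (simp add: PSL2_proj_eq_iff mat2_one algebra_simps)
  qed
qed

text \<open>The given matrix A squares to -1, so the matrix with columns v and Av conjugates it to
  the standard one. Its determinant for v = (x, y) is \<open>Qf x y\<close>, which has to be 1.
  Replacing v by sv + tAv multiplies it by \<open>s\<^sup>2 + t\<^sup>2\<close>, and every field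
  element has this form.\<close>

lemma traceless_conjugate:
  fixes a b c :: 'f
  assumes odd: "odd CARD('f)" and det: "a * a + b * c = -1"
  obtains g where "det g = 1" "mat2 a b c (- a) ** g = g ** mat2 0 (-1) 1 0"
proof -
  define Qf where "Qf = (\<lambda>x y. c * x\<^sup>2 - 2 * a * x * y - b * y\<^sup>2)"
  have "\<exists>x y. Qf x y \<noteq> 0"
  proof (rule ccontr)
    assume "\<nexists>x y. Qf x y \<noteq> 0"
    then have "Qf 1 0 = 0" "Qf 0 1 = 0" "Qf 1 1 = 0" by blast+
    then have "c = 0" "b = 0" "2 * a = 0" by (auto simp: Qf_def)
    then show False using det two by simp
  qed
  then obtain x y where xy: "Qf x y \<noteq> 0" by blast
  obtain s t :: 'f where st: "s\<^sup>2 + t\<^sup>2 = inverse (Qf x y)" using sum_of_two_squares_field[OF odd] by blast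
  define x' y' where "x' = s * x + t * (a * x + b * y)" and "y' = s * y + t * (c * x - a * y)"
  have "Qf x' y' = (s\<^sup>2 + t\<^sup>2) * Qf x y"
  proof -
    have "Qf x' y' = (s\<^sup>2 - t\<^sup>2 * (a * a + b * c)) * Qf x y"
      unfolding Qf_def x'_def y'_def by (simp add: power2_eq_square algebra_simps)
    then show ?thesis by (simp add: det)
  qed
  then have one: "Qf x' y' = 1" using st xy by simp
  show thesis
  proof (rule that[of "mat2 x' (a * x' + b * y') y' (c * x' - a * y')"])
    show "det (mat2 x' (a * x' + b * y') y' (c * x' - a * y')) = 1"
      using one by (simp add: Qf_def power2_eq_square algebra_simps)
    have "a * (a * x' + b * y') + b * (c * x' - a * y') = - x'"
      "c * (a * x' + b * y') + - a * (c * x' - a * y') = - y'"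
    proof -
      have "a * (a * x' + b * y') + b * (c * x' - a * y') = (a * a + b * c) * x'"
        "c * (a * x' + b * y') + - a * (c * x' - a * y') = (a * a + b * c) * y'"
        by (simp_all add: algebra_simps)
      then show "a * (a * x' + b * y') + b * (c * x' - a * y') = - x'"
        "c * (a * x' + b * y') + - a * (c * x' - a * y') = - y'" by (simp_all only: det) simp_all
    qed
    then show "mat2 a b c (- a) ** mat2 x' (a * x' + b * y') y' (c * x' - a * y') =
        mat2 x' (a * x' + b * y') y' (c * x' - a * y') ** mat2 0 (-1) 1 0"
      by simp
  qed
qed

end

lemma finite_two_subgroup_of_units_PSL2:
  fixes H :: "(('f::{field, finite} ^ 2 ^ 2) set \<Rightarrow> int) set"
  assumes odd: "odd CARD('f)" and H: "subgroup H (normalized_units PSL2)" "card H = 2 ^ k"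
  shows "cyclic_group ((normalized_units PSL2)\<lparr>carrier := H\<rparr>) \<or>
    is_dihedral ((normalized_units PSL2)\<lparr>carrier := H\<rparr>)"
proof -
  let ?G = "PSL2 :: ('f ^ 2 ^ 2) set monoid"
  let ?\<pi> = "PSL2_proj :: 'f ^ 2 ^ 2 \<Rightarrow> ('f ^ 2 ^ 2) set"
  have two: "(2 :: 'f) \<noteq> 0" by (rule two_neq_zero_of_odd_card[OF odd])
  have eq_minus: "x = - x \<longleftrightarrow> x = 0" "- x = x \<longleftrightarrow> x = 0" for x :: 'f
  proof -
    have "x = - x \<longleftrightarrow> 2 * x = 0" by (metis add_eq_0_iff mult_2)
    then show "x = - x \<longleftrightarrow> x = 0" using two by simp
    then show "- x = x \<longleftrightarrow> x = 0" by metis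
  qed
  interpret group ?G by (rule group_PSL2)
  have carI: "?\<pi> (mat2 a b c d) \<in> carrier ?G" if "a * d - b * c = 1" for a b c d
    using that by (auto simp: carrier_PSL2)
  have carE: "\<exists>a b c d. a * d - b * c = 1 \<and> t = ?\<pi> (mat2 a b c d)" if t: "t \<in> carrier ?G" for t
  proof -
    obtain A where A: "det A = 1" "t = ?\<pi> A" using t by (auto simp: carrier_PSL2)
    obtain a b c d where "A = mat2 a b c d" by (rule mat2_cases)
    then show ?thesis using A by auto
  qed
  have mult: "?\<pi> (mat2 a b c d) \<otimes>\<^bsub>PSL2\<^esub> ?\<pi> (mat2 a' b' c' d') =
      ?\<pi> (mat2 (a * a' + b * c') (a * b' + b * d') (c * a' + d * c') (c * b' + d * d'))"
    if "a * d - b * c = 1" "a' * d' - b' * c' = 1" for a b c d a' b' c' d'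
    using PSL2_mult[of "mat2 a b c d" "mat2 a' b' c' d'"] that by simp
  have pi_eq: "?\<pi> (mat2 a b c d) = ?\<pi> (mat2 a' b' c' d') \<longleftrightarrow>
      a = a' \<and> b = b' \<and> c = c' \<and> d = d' \<or> a = - a' \<and> b = - b' \<and> c = - c' \<and> d = - d'" for a b c d a' b' c' d'
    by (simp add: PSL2_proj_eq_iff)
  have one: "\<one>\<^bsub>PSL2\<^esub> = ?\<pi> (mat2 1 0 0 1)" by (simp add: PSL2_one mat2_one)
  have invol: "d = - a" if "a * d - b * c = 1" "?\<pi> (mat2 a b c d) \<noteq> \<one>\<^bsub>PSL2\<^esub>"
    "?\<pi> (mat2 a b c d) \<otimes>\<^bsub>PSL2\<^esub> ?\<pi> (mat2 a b c d) = \<one>\<^bsub>PSL2\<^esub>" for a b c d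
    using PSL2_square_eq_one_iff[OF two that(1)] that(2,3) PSL2_mult[of "mat2 a b c d" "mat2 a b c d"] that(1)
    by (simp add: PSL2_one)
  define z where "z = ?\<pi> (mat2 0 (-1) 1 0)"
  have z: "z \<in> carrier ?G" "z \<noteq> \<one>\<^bsub>PSL2\<^esub>" "z \<otimes>\<^bsub>PSL2\<^esub> z = \<one>\<^bsub>PSL2\<^esub>"
    by (auto simp: z_def one mult pi_eq intro!: carI)
  have one_class: "\<exists>g\<in>carrier ?G. t = g \<otimes>\<^bsub>PSL2\<^esub> z \<otimes>\<^bsub>PSL2\<^esub> inv\<^bsub>PSL2\<^esub> g"
    if t: "t \<in> carrier ?G" "t \<noteq> \<one>\<^bsub>PSL2\<^esub>" "t \<otimes>\<^bsub>PSL2\<^esub> t = \<one>\<^bsub>PSL2\<^esub>" for t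
  proof -
    obtain a b c d where A: "a * d - b * c = 1" "t = ?\<pi> (mat2 a b c d)" using carE[OF t(1)] by blast
    have "d = - a" using invol[OF A(1)] t A(2) by blast
    have "- (a * a + b * c) = 1" using A(1) \<open>d = - a\<close> by simp
    then have "a * a + b * c = -1" by (metis minus_minus)
    then obtain g where g: "det g = 1" "mat2 a b c (- a) ** g = g ** mat2 0 (-1) 1 0"
      using traceless_conjugate[OF two odd] by blast
    have gc: "?\<pi> g \<in> carrier ?G" using g by (auto simp: carrier_PSL2)
    have "t \<otimes>\<^bsub>PSL2\<^esub> ?\<pi> g = ?\<pi> g \<otimes>\<^bsub>PSL2\<^esub> z"
      unfolding A(2) z_def \<open>d = - a\<close> using A(1) \<open>d = - a\<close> g by (subst (1 2) PSL2_mult) auto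
    then have "t = ?\<pi> g \<otimes>\<^bsub>PSL2\<^esub> z \<otimes>\<^bsub>PSL2\<^esub> inv\<^bsub>PSL2\<^esub> (?\<pi> g)"
      using t gc z by (metis inv_solve_right m_closed)
    then show ?thesis using gc by blast
  qed
  define D where "D = {g \<in> carrier ?G. g \<otimes>\<^bsub>PSL2\<^esub> z = z \<otimes>\<^bsub>PSL2\<^esub> g}"
  \<comment> \<open>The matrices that commute with that of \<open>z\<close>. The other elements of
    \<open>D\<close> come from matrices that anticommute with it, that is, commute up to
    sign.\<close>
  define T where "T = {?\<pi> (mat2 a (- b) b a) |a b. a * a + b * b = 1}"
  have D_iff: "?\<pi> (mat2 a b c d) \<in> D \<longleftrightarrow> (c = - b \<and> d = a) \<or> (c = b \<and> d = - a)"
    if det: "a * d - b * c = 1" for a b c d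
    using det carI[OF det] by (auto simp: D_def z_def mult pi_eq)
  have TI: "?\<pi> (mat2 a b c d) \<in> T" if "a * d - b * c = 1" "c = - b" "d = a" for a b c d
    unfolding T_def using that by (intro CollectI exI[of _ a] exI[of _ "- b"]) auto
  have TE: "\<exists>a b. t = ?\<pi> (mat2 a (- b) b a) \<and> a * a + b * b = 1" if "t \<in> T" for t
    using that by (auto simp: T_def)
  have outerE: "\<exists>a b. d = ?\<pi> (mat2 a b b (- a)) \<and> a * (- a) - b * b = 1" if d: "d \<in> D" "d \<notin> T" for d
  proof -
    have "d \<in> carrier ?G" using d by (simp add: D_def)
    then obtain a b c e where A: "a * e - b * c = 1" "d = ?\<pi> (mat2 a b c e)" using carE by blast
    have "\<not> (c = - b \<and> e = a)" using TI[OF A(1)] A(2) d(2) by blast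
    then have "c = b \<and> e = - a" using D_iff[OF A(1)] A(2) d(1) by blast
    then show ?thesis using A by blast
  qed
  have T: "subgroup T ?G"
  proof (rule subgroupI)
    show "T \<subseteq> carrier ?G" by (auto simp: T_def intro!: carI)
    show "T \<noteq> {}" unfolding T_def by (auto intro: exI[of _ 1] exI[of _ 0])
  next
    fix s assume "s \<in> T"
    then obtain a b where s: "s = ?\<pi> (mat2 a (- b) b a)" "a * a + b * b = 1" using TE by blast
    let ?i = "?\<pi> (mat2 a b (- b) a)"
    have iT: "?i \<in> T" by (rule TI) (use s in \<open>auto simp: algebra_simps\<close>)
    have "?i \<otimes>\<^bsub>PSL2\<^esub> s = \<one>\<^bsub>PSL2\<^esub>" using s by (simp add: mult one algebra_simps)
    then have "inv\<^bsub>PSL2\<^esub> s = ?i" using s by (intro inv_equality carI) (auto intro!: carI)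
    then show "inv\<^bsub>PSL2\<^esub> s \<in> T" using iT by simp
  next
    fix s t assume "s \<in> T" "t \<in> T"
    then obtain a b a' b' where st: "s = ?\<pi> (mat2 a (- b) b a)" "a * a + b * b = 1"
      "t = ?\<pi> (mat2 a' (- b') b' a')" "a' * a' + b' * b' = 1" using TE by metis
    have "(a * a' - b * b') * (a * a' - b * b') + (b * a' + a * b') * (b * a' + a * b') = (a * a + b * b) * (a' * a' + b' * b')"
      by (simp add: algebra_simps)
    then have "(a * a' - b * b') * (a * a' - b * b') + (b * a' + a * b') * (b * a' + a * b') = 1" using st by simp
    moreover have "s \<otimes>\<^bsub>PSL2\<^esub> t = ?\<pi> (mat2 (a * a' - b * b') (- (b * a' + a * b')) (b * a' + a * b') (a * a' - b * b'))"
      using st by (simp add: mult algebra_simps)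
    ultimately show "s \<otimes>\<^bsub>PSL2\<^esub> t \<in> T" unfolding T_def by blast
  qed
  \<comment> \<open>Outside \<open>T\<close> the matrices in \<open>D\<close> are symmetric and
    traceless, so determinant 1 asks for -1 as a sum of two squares.\<close>
  obtain p r :: 'f where pr: "p\<^sup>2 + r\<^sup>2 = -1" using sum_of_two_squares_field[OF odd] by blast
  have pr': "p * (- p) - r * r = 1" using pr by (simp add: power2_eq_square) (metis add_uminus_conv_diff minus_add_distrib minus_minus)
  define w where "w = ?\<pi> (mat2 p r r (- p))"
  show ?thesis
  proof (rule finite_two_subgroup_of_normalized_units[OF group_axioms z one_class D_def T])
    show "T \<subseteq> D"
    proof
      fix t assume "t \<in> T"
      then obtain a b where t: "t = ?\<pi> (mat2 a (- b) b a)" "a * a + b * b = 1" using TE by blast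
      then show "t \<in> D" using D_iff[of a a "- b" b] by simp
    qed
    show "z \<in> T" unfolding z_def by (rule TI) auto
    show "s \<otimes>\<^bsub>PSL2\<^esub> t = t \<otimes>\<^bsub>PSL2\<^esub> s" if st: "s \<in> T" "t \<in> T" for s t
    proof -
      obtain a b a' b' where "s = ?\<pi> (mat2 a (- b) b a)" "a * a + b * b = 1"
        "t = ?\<pi> (mat2 a' (- b') b' a')" "a' * a' + b' * b' = 1" using TE st by metis
      then show ?thesis by (simp add: mult algebra_simps)
    qed
    show "t = z" if t: "t \<in> T" "t \<noteq> \<one>\<^bsub>PSL2\<^esub>" "t \<otimes>\<^bsub>PSL2\<^esub> t = \<one>\<^bsub>PSL2\<^esub>" for t
    proof -
      obtain a b where ab: "t = ?\<pi> (mat2 a (- b) b a)" "a * a + b * b = 1" using TE[OF t(1)] by blast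
      \<comment> \<open>An involution is traceless, and the diagonal of an element of
        \<open>T\<close> is constant.\<close>
      have "a = - a" using invol[of a a "- b" b] t ab by simp
      then have "a = 0" using eq_minus by simp
      then have "b = 1 \<or> b = -1" using ab by (simp add: square_eq_1_iff)
      then show ?thesis using \<open>a = 0\<close> by (auto simp: ab z_def pi_eq)
    qed
    show "w \<in> D" unfolding w_def using D_iff[OF pr'] by simp
    show "w \<notin> T"
    proof
      assume "w \<in> T"
      then obtain a b where "?\<pi> (mat2 p r r (- p)) = ?\<pi> (mat2 a (- b) b a)" using TE w_def by blast
      then have "p = - p" "r = - r" by (auto simp: pi_eq)
      then show False using pr' eq_minus by simp
    qed
    show "d \<otimes>\<^bsub>PSL2\<^esub> d = \<one>\<^bsub>PSL2\<^esub>" if d: "d \<in> D" "d \<notin> T" for d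
    proof -
      obtain a b where ab: "d = ?\<pi> (mat2 a b b (- a))" "a * (- a) - b * b = 1" using outerE[OF d] by blast
      have "- (a * a + b * b) = 1" using ab(2) by simp
      then have "a * a + b * b = -1" by (metis minus_minus)
      then show ?thesis unfolding ab(1) mult[OF ab(2) ab(2)] one pi_eq by (simp add: algebra_simps)
    qed
    show "d \<otimes>\<^bsub>PSL2\<^esub> e \<in> T" if de: "d \<in> D" "e \<in> D" "d \<notin> T" "e \<notin> T" for d e
    proof -
      obtain a b where ab: "d = ?\<pi> (mat2 a b b (- a))" "a * (- a) - b * b = 1" using outerE de by blast
      obtain a' b' where ab': "e = ?\<pi> (mat2 a' b' b' (- a'))" "a' * (- a') - b' * b' = 1" using outerE de by blast
      have "(a * a' + b * b') * (b * b' + - a * - a') - (a * b' + b * - a') * (b * a' + - a * b') =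
          (a * (- a) - b * b) * (a' * (- a') - b' * b')" by (simp add: algebra_simps)
      also have "\<dots> = 1" by (simp only: ab(2) ab'(2) mult_1)
      finally show ?thesis unfolding ab(1) ab'(1) mult[OF ab(2) ab'(2)]
        by (rule TI) (simp_all add: algebra_simps)
    qed
    show "subgroup H (normalized_units ?G)" "card H = 2 ^ k" by (rule H)+
  qed
qed

theorem theorem2p1:
  fixes q :: nat
    and G :: "('f::{field, finite} ^ 2 ^ 2) set monoid"
    and H :: "(('f ^ 2 ^ 2) set \<Rightarrow> int) set"
  assumes "primepow q" and "odd q" and "CARD('f) = q"
    and "G = PSL2"
    and "subgroup H (normalized_units G)" and "finite H" and "\<exists>k. card H = 2 ^ k"
  shows "cyclic_group ((normalized_units G)\<lparr>carrier := H\<rparr>) \<or>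
    is_dihedral ((normalized_units G)\<lparr>carrier := H\<rparr>)"
  using assms finite_two_subgroup_of_units_PSL2 by blast

end
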